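(* A sequence $\{X(N)\in\mathbb{G}_N : N=1,2,\dots\}$ is regular if and only if it stabilizes to some configuration $X\in\mathbb{G}_\infty$. Moreover, the correspondence $\{X(N)\}\mapsto X$ established in this way induces a bijection from the Martin boundary of the chain $\{\mathbb{G}_N,\Lambda^{N+1}_N\}$ (the set of equivalence classes of regular sequences) onto $\mathbb{G}_\infty$. In this way the Martin boundary is identified with the set $\mathbb{G}_\infty$ of infinite bounded configurations on $\mathfrak{L}$.
   Context: Fix $q\in(0,1)$, $\zeta_-<0$, $\zeta_+>0$, and let $\mathfrak{L}=\{\zeta_-q^m:m\in\mathbb{Z}\}\sqcup\{\zeta_+q^n:n\in\mathbb{Z}\}\subset\mathbb{R}\setminus\{0\}$. A configuration is a subset of $\mathfrak{L}$; $\mathbb{G}_N$ ($N\ge1$) is the set of $N$-element configurations $X=(x_1<\dots<x_N)$. Interlacing. For $a<b$ in $\mathfrak{L}$ put $I(a,b)=[a,b)\cap\mathfrak{L}$ if $a<b<0$; $I(a,b)=[a,b]\cap\mathfrak{L}$ if $a<0<b$; $I(a,b)=(a,b]\cap\mathfrak{L}$ if $0<a<b$. For $X\in\mathbb{G}_{N+1}$, $Y\in\mathbb{G}_N$ write $Y\prec X$ if $y_i\in I(x_i,x_{i+1})$ for $i=1,\dots,N$. $q$-links. $\Lambda^{N+1}_N$ is the stochastic matrix of format $\mathbb{G}_{N+1}\times\mathbb{G}_N$ with $$\Lambda^{N+1}_N(X,Y)=\prod_{i=1}^N|y_i|\cdot(1-q)\cdots(1-q^N)\cdot\frac{\prod_{1\le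 i<j\le N}(y_j-y_i)}{\prod_{1\le i<j\le N+1}(x_j-x_i)}$$ if $Y\prec X$, and $\Lambda^{N+1}_N(X,Y)=0$ otherwise. For $N>K$, $\Lambda^N_K=\Lambda^N_{N-1}\cdots\Lambda^{K+1}_K$. Regular sequences and Martin boundary. A sequence $\{X(N)\in\mathbb{G}_N\}$ is regular if for every fixed $K$ the probability measures $\Lambda^N_K(X(N),\cdot)$ on the discrete set $\mathbb{G}_K$ converge weakly, as $N\to\infty$, to a probability measure $M_K$. Two regular sequences are equivalent if their limit measures $M_K$ coincide for all $K$. The Martin boundary is the set of equivalence classes of regular sequences. Variational series and stabilization. A configuration is bounded if it is contained in a bounded segment of $\mathbb{R}$. $\mathbb{G}_\infty$ is the set of all infinite bounded configurations. For a bounded configuration $X$, its variational series $(x_{(1)},x_{(2)},\dots)$ lists the elements of $X$ in decreasing order of absolute value (if two elements of opposite sign have the same absolute value the positive one comes first), completed by infinitely many $0$'s if $X$ is finite. A sequence $\{X(N)\in\mathbb{G}_N\}$ stabilizes to $X\in\mathbb{G}_\infty$ if for every fixed $k$ there is $N_0(k)$ such that $x_{(k)}(N)=x_{(k)}$ for all $N\ge N_0(k)$, where $(x_{(i)}(N))_i$ is the variational series of $X(N)$. *)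

theory Defs
  imports "HOL-Probability.Probability"
begin

text \<open>Throughout, \<open>q\<close> is the base, and \<open>zm\<close>, \<open>zp\<close> stand for \<open>\<zeta>\<^sub>-\<close>, \<open>\<zeta>\<^sub>+\<close>.\<close>

definition qlattice :: "real \<Rightarrow> real \<Rightarrow> real \<Rightarrow> real set" where
  "qlattice q zm zp = range (\<lambda>m::int. zm * q powi m) \<union> range (\<lambda>n::int. zp * q powi n)"

definition configs :: "real \<Rightarrow> real \<Rightarrow> real \<Rightarrow> nat \<Rightarrow> real set set" where
  "configs q zm zp N = {X. X \<subseteq> qlattice q zm zp \<and> finite X \<and> card X = N}"

definition inf_configs :: "real \<Rightarrow> real \<Rightarrow> real \<Rightarrow> real set set" where
  "inf_configs q zm zp = {X. X \<subseteq> qlattice q zm zp \<and> infinite X \<and> bounded X}"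

text \<open>The increasing enumeration of a finite configuration is 0-based: \<open>elt X i\<close> is
  \<open>x\<^sub>i\<^sub>+\<^sub>1\<close> in \<open>x\<^sub>1 < \<dots> < x\<^sub>N\<close>.\<close>

definition elt :: "real set \<Rightarrow> nat \<Rightarrow> real" where
  "elt X i = sorted_list_of_set X ! i"

text \<open>Only meant for \<open>a < b\<close> in the lattice, which does not contain \<open>0\<close>.\<close>

definition qinterval :: "real \<Rightarrow> real \<Rightarrow> real \<Rightarrow> real \<Rightarrow> real \<Rightarrow> real set" where
  "qinterval q zm zp a b =
     (if b < 0 then {a..<b} else if a < 0 then {a..b} else {a<..b}) \<inter> qlattice q zm zp"

definition interlaces :: "real \<Rightarrow> real \<Rightarrow> real \<Rightarrow> real set \<Rightarrow> real set \<Rightarrow> bool" where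
  "interlaces q zm zp Y X \<longleftrightarrow>
     (\<forall>i<card Y. elt Y i \<in> qinterval q zm zp (elt X i) (elt X (Suc i)))"

definition vandermonde :: "real set \<Rightarrow> real" where
  "vandermonde X = (\<Prod>j<card X. \<Prod>i<j. elt X j - elt X i)"

text \<open>The matrix \<open>\<Lambda>\<^sup>N\<^sup>+\<^sup>1\<^sub>N\<close>; meant for \<open>X\<close> in \<open>configs q zm zp (N + 1)\<close> and \<open>Y\<close> in
  \<open>configs q zm zp N\<close>.\<close>

definition qlink1 :: "real \<Rightarrow> real \<Rightarrow> real \<Rightarrow> nat \<Rightarrow> real set \<Rightarrow> real set \<Rightarrow> real" where
  "qlink1 q zm zp N X Y =
     (if interlaces q zm zp Y X
      then (\<Prod>i<N. \<bar>elt Y i\<bar>) * (\<Prod>i=1..N. 1 - q ^ i) * (vandermonde Y / vandermonde X)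
      else 0)"

text \<open>The matrix \<open>\<Lambda>\<^sup>N\<^sub>K\<close> for \<open>N > K\<close>, as the product \<open>\<Lambda>\<^sup>N\<^sub>N\<^sub>-\<^sub>1 \<cdots> \<Lambda>\<^sup>K\<^sup>+\<^sup>1\<^sub>K\<close>. The empty product
  \<open>N = K\<close> is the identity matrix; values for \<open>N < K\<close> are irrelevant. Rows may have infinite
  support, whence the infinite sum.\<close>

fun qlink :: "real \<Rightarrow> real \<Rightarrow> real \<Rightarrow> nat \<Rightarrow> nat \<Rightarrow> real set \<Rightarrow> real set \<Rightarrow> real" where
  "qlink q zm zp 0 K X Y = (if X = Y then 1 else 0)"
| "qlink q zm zp (Suc N) K X Y =
     (if Suc N \<le> K then (if X = Y then 1 else 0)
      else (\<Sum>\<^sub>\<infinity>Z\<in>configs q zm zp N. qlink1 q zm zp N X Z * qlink q zm zp N K Z Y))"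

definition link_measure ::
  "real \<Rightarrow> real \<Rightarrow> real \<Rightarrow> nat \<Rightarrow> nat \<Rightarrow> real set \<Rightarrow> real set measure" where
  "link_measure q zm zp N K X =
     point_measure (configs q zm zp K) (\<lambda>Y. ennreal (qlink q zm zp N K X Y))"

definition weakly_converges ::
  "'a topology \<Rightarrow> (nat \<Rightarrow> 'a measure) \<Rightarrow> 'a measure \<Rightarrow> bool" where
  "weakly_converges T \<mu> M \<longleftrightarrow>
     (\<forall>f::'a \<Rightarrow> real. continuous_map T euclideanreal f \<and> bounded (f ` topspace T) \<longrightarrow>
        (\<lambda>n. integral\<^sup>L (\<mu> n) f) \<longlonglongrightarrow> integral\<^sup>L M f)"

text \<open>Sequences are indexed by \<open>N \<ge> 1\<close>; \<open>PiE\<close> pins down the unused value at \<open>N = 0\<close>.\<close>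

definition config_seqs :: "real \<Rightarrow> real \<Rightarrow> real \<Rightarrow> (nat \<Rightarrow> real set) set" where
  "config_seqs q zm zp = (\<Pi>\<^sub>E N\<in>{1..}. configs q zm zp N)"

definition is_limit_measure ::
  "real \<Rightarrow> real \<Rightarrow> real \<Rightarrow> (nat \<Rightarrow> real set) \<Rightarrow> nat \<Rightarrow> real set measure \<Rightarrow> bool" where
  "is_limit_measure q zm zp Xs K M \<longleftrightarrow>
     prob_space M \<and> sets M = Pow (configs q zm zp K) \<and>
     weakly_converges (discrete_topology (configs q zm zp K))
       (\<lambda>N. link_measure q zm zp N K (Xs N)) M"

definition regular_seq :: "real \<Rightarrow> real \<Rightarrow> real \<Rightarrow> (nat \<Rightarrow> real set) \<Rightarrow> bool" where
  "regular_seq q zm zp Xs \<longleftrightarrow> (\<forall>K\<ge>1. \<exists>M. is_limit_measure q zm zp Xs K M)"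

definition regular_seqs :: "real \<Rightarrow> real \<Rightarrow> real \<Rightarrow> (nat \<Rightarrow> real set) set" where
  "regular_seqs q zm zp = {Xs \<in> config_seqs q zm zp. regular_seq q zm zp Xs}"

definition same_limits ::
  "real \<Rightarrow> real \<Rightarrow> real \<Rightarrow> ((nat \<Rightarrow> real set) \<times> (nat \<Rightarrow> real set)) set" where
  "same_limits q zm zp =
     {(Xs, Ys). Xs \<in> regular_seqs q zm zp \<and> Ys \<in> regular_seqs q zm zp \<and>
        (\<forall>K\<ge>1. \<exists>M. is_limit_measure q zm zp Xs K M \<and> is_limit_measure q zm zp Ys K M)}"

definition martin_boundary :: "real \<Rightarrow> real \<Rightarrow> real \<Rightarrow> (nat \<Rightarrow> real set) set set" where
  "martin_boundary q zm zp = regular_seqs q zm zp // same_limits q zm zp"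

definition precedes :: "real \<Rightarrow> real \<Rightarrow> bool" where
  "precedes x y \<longleftrightarrow> \<bar>x\<bar> > \<bar>y\<bar> \<or> (\<bar>x\<bar> = \<bar>y\<bar> \<and> x > y)"

text \<open>\<open>var_series X k\<close> is \<open>x\<^sub>(\<^sub>k\<^sub>+\<^sub>1\<^sub>)\<close>: the element of \<open>X\<close> preceded by exactly \<open>k\<close> others, or \<open>0\<close>
  if \<open>X\<close> has at most \<open>k\<close> elements. In a bounded configuration every element has finitely many
  predecessors, as the lattice accumulates only at \<open>0\<close>.\<close>

definition var_series :: "real set \<Rightarrow> nat \<Rightarrow> real" where
  "var_series X k =
     (if \<exists>x\<in>X. finite {y \<in> X. precedes y x} \<and> card {y \<in> X. precedes y x} = k
      then THE x. x \<in> X \<and> finite {y \<in> X. precedes y x} \<and> card {y \<in> X. precedes y x} = k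
      else 0)"

definition stabilizes_to :: "(nat \<Rightarrow> real set) \<Rightarrow> real set \<Rightarrow> bool" where
  "stabilizes_to Xs X \<longleftrightarrow> (\<forall>k. \<exists>N0. \<forall>N\<ge>N0. var_series (Xs N) k = var_series X k)"

end

theory Submission imports Defs "Jordan_Normal_Form.Determinant" begin

text \<open>
  The links act simply on alternants. For functions \<open>f\<^sub>j\<close> on the lattice consider the ratio
  \<open>det [f\<^sub>j(x\<^sub>i)] / V(X)\<close>, where \<open>V\<close> is the Vandermonde determinant. A configuration interlacing with \<open>X\<close> is an
  independent choice of one point in each interval between neighbours of \<open>X\<close>, and
  \<open>\<Sum>y\<in>I(a,b). \<bar>y\<bar> \<phi>(y)\<close> telescopes to \<open>\<Phi>(b) - \<Phi>(a)\<close> when \<open>\<Phi>(x) - \<Phi>(q x) = x \<phi>(x)\<close>. Hence a link turns the ratio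
  for \<open>f\<^sub>1, \<dots>, f\<^sub>N\<close> into the ratio for \<open>1\<close> and the primitives of the \<open>f\<^sub>j\<close>, one level up
  (\<open>link1_alternant_ratio\<close>). After many steps from level \<open>K\<close> the alternant consists of monomials and of
  \<open>K\<close> iterated primitives, and Newton interpolation reduces it to a \<open>K \<times> K\<close> determinant of divided
  differences of the latter (\<open>link_divdiff\<close>). Two choices of functions at level \<open>K\<close> are used.

  Point masses give every entry of a link (\<open>link_entry\<close>). The primitives of a point mass at \<open>b\<close> vanish
  closer to \<open>0\<close> than \<open>b\<close>, so the entries are finite sums of convergent products whenever the sequence
  \<open>X(N)\<close> stabilizes, and they converge (\<open>link_converges\<close>). Moreover, the set of the first \<open>K\<close> members of the
  variational series of \<open>X\<close> has, under the law on level \<open>K\<close> started from \<open>X\<close>, a mass that is an explicit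
  product; it is bounded below by a constant depending only on \<open>K\<close> (\<open>link_top_part_lower_bound\<close>).

  A test function \<open>1 / (u y; q)\<^sub>m\<^sub>+\<^sub>1\<close> in one of the variables has \<open>1 / (1 - u x)\<close> as its last primitive, with
  divided differences over \<open>n\<close> points \<open>u\<^sup>n\<^sup>-\<^sup>1 / \<Prod>(1 - u x)\<close>. For \<open>u = \<i> v\<close> with \<open>v\<close> large it is concentrated near \<open>y = 0\<close>, but its
  mean tends to \<open>0\<close> since a stabilizing sequence has infinitely many points in the limit. So no mass
  escapes to configurations with one point at \<open>0\<close> (\<open>insertion_mass_vanishes\<close>). Two points near \<open>0\<close> force a point
  near \<open>0\<close> one level down, and induction gives tightness (\<open>link_tight\<close>). Together with the convergence of
  the entries, stabilizing sequences are regular.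

  Conversely, in a regular sequence the outer parts of the \<open>X(N)\<close> carry mass bounded below and so lie in
  a finite set for large \<open>N\<close>; each of them then has positive mass under the laws started from the
  others. Interlacing does not increase the number of points beyond a given one, and so two outer
  parts that are reached from each other's configurations coincide (\<open>top_parts_equal\<close>). The outer parts
  are eventually constant, which is stabilization.

  Finally, two sequences are compared by alternating between them (\<open>same_limits_iff\<close>): the merged sequence
  is regular if the limit measures agree, and it stabilizes if the limit configurations agree; both
  implications above, applied to it, identify equivalence of regular sequences with equality of the
  limit configurations.
\<close>

section \<open>Determinants of square arrays\<close>

text \<open>A determinant on functions of indices, rather than on a matrix type of fixed dimension, so that the
  size may vary within one statement; only rows and columns below \<open>n\<close> matter.\<close>

definition detf :: "nat \<Rightarrow> (nat \<Rightarrow> nat \<Rightarrow> 'a::idom) \<Rightarrow> 'a" where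
  "detf n A = (\<Sum>\<pi> | \<pi> permutes {..<n}. signof \<pi> * (\<Prod>i<n. A i (\<pi> i)))"

lemma detf_eq_det: "detf n A = Determinant.det (Matrix.mat n n (\<lambda>(i, j). A i j))"
proof -
  have "(\<Prod>i<n. A i (\<pi> i)) = (\<Prod>i = 0..<n. Matrix.mat n n (\<lambda>(i, j). A i j) $$ (i, \<pi> i))"
    if "\<pi> permutes {..<n}" for \<pi>
    unfolding atLeast0LessThan
    by (intro prod.cong refl) (use permutes_in_image[OF that] in auto)
  then show ?thesis
    unfolding detf_def by (subst det_def'[of _ n]) (auto simp: atLeast0LessThan intro!: sum.cong)
qed

lemma detf_cong:
  assumes "\<And>i j. i < n \<Longrightarrow> j < n \<Longrightarrow> A i j = B i j"
  shows "detf n A = detf n B"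
proof -
  have "Matrix.mat n n (\<lambda>(i, j). A i j) = Matrix.mat n n (\<lambda>(i, j). B i j)"
    using assms by (intro eq_matI) auto
  then show ?thesis by (simp add: detf_eq_det)
qed

lemma detf_mult: "detf n (\<lambda>i j. \<Sum>k<n. A i k * B k j) = detf n A * detf n B"
proof -
  have "Matrix.mat n n (\<lambda>(i, j). \<Sum>k<n. A i k * B k j) =
        Matrix.mat n n (\<lambda>(i, j). A i j) * Matrix.mat n n (\<lambda>(i, j). B i j)"
    by (intro eq_matI) (auto simp: scalar_prod_def atLeast0LessThan)
  then show ?thesis unfolding detf_eq_det by (subst det_mult[symmetric, of _ n]) auto
qed

lemma detf_lower_triangular:
  assumes "\<And>i j. i < j \<Longrightarrow> j < n \<Longrightarrow> A i j = 0"
  shows "detf n A = (\<Prod>i<n. A i i)"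
proof -
  have "Determinant.det (Matrix.mat n n (\<lambda>(i, j). A i j)) = prod_list (diag_mat (Matrix.mat n n (\<lambda>(i, j). A i j)))"
    by (rule det_lower_triangular[of n]) (use assms in auto)
  also have "\<dots> = (\<Prod>i<n. A i i)"
    by (simp add: diag_mat_def atLeast0LessThan[symmetric] flip: prod.distinct_set_conv_list)
  finally show ?thesis by (simp add: detf_eq_det)
qed

lemma detf_upper_triangular:
  assumes "\<And>i j. j < i \<Longrightarrow> i < n \<Longrightarrow> A i j = 0"
  shows "detf n A = (\<Prod>i<n. A i i)"
proof -
  have "Determinant.det (Matrix.mat n n (\<lambda>(i, j). A i j)) = prod_list (diag_mat (Matrix.mat n n (\<lambda>(i, j). A i j)))"
    by (rule det_upper_triangular[of _ n]) (use assms in auto)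
  also have "\<dots> = (\<Prod>i<n. A i i)"
    by (simp add: diag_mat_def atLeast0LessThan[symmetric] flip: prod.distinct_set_conv_list)
  finally show ?thesis by (simp add: detf_eq_det)
qed

lemma detf_block_triangular:
  assumes "\<And>i j. m \<le> i \<Longrightarrow> i < m + k \<Longrightarrow> j < m \<Longrightarrow> A i j = 0"
  shows "detf (m + k) A = detf m A * detf k (\<lambda>i j. A (m + i) (m + j))"
proof -
  have eq: "Matrix.mat (m + k) (m + k) (\<lambda>(i, j). A i j) =
     four_block_mat (Matrix.mat m m (\<lambda>(i, j). A i j)) (Matrix.mat m k (\<lambda>(i, j). A i (m + j)))
       (0\<^sub>m k m) (Matrix.mat k k (\<lambda>(i, j). A (m + i) (m + j)))"
    using assms by (intro eq_matI) auto
  show ?thesis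
    unfolding detf_eq_det eq by (rule det_four_block_mat_lower_left_zero) auto
qed

lemma detf_permute_rows:
  assumes "\<pi> permutes {..<n}"
  shows "detf n (\<lambda>i. A (\<pi> i)) = signof \<pi> * detf n A"
proof -
  have eq: "Matrix.mat n n (\<lambda>(i, j). A (\<pi> i) j) = Matrix.mat n n (\<lambda>(i, j). Matrix.mat n n (\<lambda>(i, j). A i j) $$ (\<pi> i, j))"
    using permutes_in_image[OF assms] by (intro eq_matI) auto
  show ?thesis
    unfolding detf_eq_det eq by (rule det_permute_rows) (use assms in \<open>auto simp: atLeast0LessThan\<close>)
qed

lemma detf_zero_column:
  assumes "j < n" "\<And>i. i < n \<Longrightarrow> A i j = 0"
  shows "detf n A = 0"
  unfolding detf_def
proof (rule sum.neutral, intro ballI)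
  fix \<pi> assume "\<pi> \<in> {\<pi>. \<pi> permutes {..<n}}"
  then have \<pi>: "\<pi> permutes {..<n}" by simp
  from permutes_surj[OF \<pi>] obtain i where i: "\<pi> i = j" by (metis surjD)
  then have "i < n" using permutes_in_image[OF \<pi>, of i] assms(1) by auto
  then have "(\<Prod>i<n. A i (\<pi> i)) = 0" using assms(2) i by (intro prod_zero) auto
  then show "signof \<pi> * (\<Prod>i<n. A i (\<pi> i)) = 0" by simp
qed

text \<open>Subtracting each row from the next one turns the column of ones into a unit vector. This is the
  algebraic form of passing from a telescoping sum over \<open>n\<close> intervals to their \<open>n + 1\<close> end points.\<close>

lemma detf_bordered:
  assumes "\<And>i. i \<le> n \<Longrightarrow> G i 0 = 1"
  shows "detf (Suc n) G = detf n (\<lambda>i j. G (Suc i) (Suc j) - G i (Suc j))"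
proof -
  \<comment> \<open>left multiplication by \<open>L\<close> is the row operation\<close>
  define L :: "nat \<Rightarrow> nat \<Rightarrow> 'a" where
    "L = (\<lambda>i k. if k = i then 1 else if Suc k = i then -1 else 0)"
  define H where "H = (\<lambda>i j. if i = 0 then G 0 j else G i j - G (i - 1) j)"
  have "detf (Suc n) L = 1"
    by (subst detf_lower_triangular) (auto simp: L_def)
  moreover have "(\<Sum>k<Suc n. L i k * G k j) = H i j" if "i < Suc n" for i j
  proof (cases i)
    case 0
    have "(\<Sum>k<Suc n. L i k * G k j) = (\<Sum>k\<in>{0}. L i k * G k j)"
      by (rule sum.mono_neutral_right) (auto simp: L_def 0)
    then show ?thesis by (simp add: L_def H_def 0)
  next
    case (Suc i')
    have "(\<Sum>k<Suc n. L i k * G k j) = (\<Sum>k\<in>{i', i}. L i k * G k j)"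
      by (rule sum.mono_neutral_right) (use that in \<open>auto simp: L_def Suc\<close>)
    then show ?thesis by (simp add: L_def H_def Suc)
  qed
  ultimately have "detf (Suc n) G = detf (Suc n) H"
    using detf_mult[of "Suc n" L G] detf_cong[of "Suc n" "\<lambda>i j. \<Sum>k<Suc n. L i k * G k j" H] by simp
  also have "\<dots> = detf (1 + n) H" by simp
  also have "\<dots> = detf 1 H * detf n (\<lambda>i j. H (1 + i) (1 + j))"
    by (rule detf_block_triangular) (use assms in \<open>auto simp: H_def\<close>)
  also have "detf 1 H = 1"
    using assms by (subst detf_lower_triangular) (auto simp: H_def)
  finally show ?thesis by (simp add: H_def)
qed

text \<open>Every term of the expansion takes exactly one factor from each column, so a single small column
  makes the whole determinant small.\<close>

lemma norm_detf_le:
  fixes A :: "nat \<Rightarrow> nat \<Rightarrow> complex"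
  assumes "\<And>i j. i < n \<Longrightarrow> j < n \<Longrightarrow> norm (A i j) \<le> d j"
  shows "norm (detf n A) \<le> fact n * (\<Prod>j<n. d j)"
proof -
  have "norm (signof \<pi> * (\<Prod>i<n. A i (\<pi> i))) \<le> (\<Prod>j<n. d j)" if \<pi>: "\<pi> permutes {..<n}" for \<pi>
  proof -
    have "norm (signof \<pi> * (\<Prod>i<n. A i (\<pi> i))) = (\<Prod>i<n. norm (A i (\<pi> i)))"
      by (simp add: norm_mult prod_norm sign_def)
    also have "\<dots> \<le> (\<Prod>i<n. d (\<pi> i))"
      by (intro prod_mono) (use assms permutes_in_image[OF \<pi>] in auto)
    also have "\<dots> = (\<Prod>j<n. d j)" by (rule prod.permute[OF \<pi>, symmetric, unfolded comp_def])
    finally show ?thesis .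
  qed
  then have "norm (detf n A) \<le> of_nat (card {\<pi>. \<pi> permutes {..<n}}) * (\<Prod>j<n. d j)"
    unfolding detf_def by (intro sum_norm_bound) auto
  then show ?thesis by (simp add: card_permutations)
qed

lemma tendsto_detf:
  fixes A :: "nat \<Rightarrow> nat \<Rightarrow> nat \<Rightarrow> complex"
  assumes "\<And>i j. i < n \<Longrightarrow> j < n \<Longrightarrow> (\<lambda>N. A N i j) \<longlonglongrightarrow> B i j"
  shows "(\<lambda>N. detf n (A N)) \<longlonglongrightarrow> detf n B"
  unfolding detf_def
proof (intro tendsto_sum tendsto_mult tendsto_const tendsto_prod)
  fix \<pi> i assume "\<pi> \<in> {\<pi>. \<pi> permutes {..<n}}" "i \<in> {..<n}"
  then show "(\<lambda>N. A N i (\<pi> i)) \<longlonglongrightarrow> B i (\<pi> i)"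
    by (intro assms) (use permutes_in_image[of \<pi> "{..<n}" i] in auto)
qed

lemma detf_0 [simp]: "detf 0 A = 1"
  by (simp add: detf_lower_triangular)

section \<open>Divided differences\<close>

text \<open>For \<open>S = {p\<^sub>0, \<dots>, p\<^sub>k}\<close> this is Newton's divided difference \<open>f[p\<^sub>0, \<dots>, p\<^sub>k]\<close>, written in a way that
  shows its independence of the order of the points.\<close>

definition divdiff :: "real set \<Rightarrow> (real \<Rightarrow> complex) \<Rightarrow> complex" where
  "divdiff S f = (\<Sum>a\<in>S. f a / (\<Prod>x\<in>S - {a}. of_real (a - x)))"

lemma divdiff_cong: "(\<And>x. x \<in> S \<Longrightarrow> f x = g x) \<Longrightarrow> divdiff S f = divdiff S g"
  unfolding divdiff_def by (intro sum.cong) auto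

lemma divdiff_add: "divdiff S (\<lambda>x. f x + g x) = divdiff S f + divdiff S g"
  unfolding divdiff_def by (simp add: add_divide_distrib sum.distrib)

lemma divdiff_cmult: "divdiff S (\<lambda>x. c * f x) = c * divdiff S f"
  unfolding divdiff_def by (simp add: sum_distrib_left)

text \<open>Writing the factor \<open>x\<close> as \<open>s + (x - s)\<close>, the second summand cancels one factor of each
  denominator and removes the point \<open>s\<close>. All explicit divided differences below follow from this
  recursion.\<close>

lemma divdiff_mult_id:
  assumes "finite S" "s \<in> S"
  shows "divdiff S (\<lambda>x. of_real x * f x) = of_real s * divdiff S f + divdiff (S - {s}) f"
proof -
  have "divdiff S (\<lambda>x. of_real x * f x) - of_real s * divdiff S f =
        (\<Sum>a\<in>S. of_real (a - s) * f a / (\<Prod>x\<in>S - {a}. of_real (a - x)))"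
    unfolding divdiff_def sum_distrib_left sum_subtractf[symmetric]
    by (intro sum.cong) (auto simp: field_simps diff_divide_distrib)
  also have "\<dots> = (\<Sum>a\<in>S - {s}. of_real (a - s) * f a / (\<Prod>x\<in>S - {a}. of_real (a - x)))"
    using assms by (subst sum.remove[of S s]) auto
  also have "\<dots> = (\<Sum>a\<in>S - {s}. f a / (\<Prod>x\<in>S - {s} - {a}. of_real (a - x)))"
  proof (intro sum.cong refl)
    fix a assume a: "a \<in> S - {s}"
    have "(\<Prod>x\<in>S - {a}. of_real (a - x)) = (of_real (a - s) :: complex) * (\<Prod>x\<in>S - {a} - {s}. of_real (a - x))"
      using a assms by (intro prod.remove) auto
    moreover have "S - {a} - {s} = S - {s} - {a}" by auto
    moreover have "of_real (a - s) \<noteq> (0::complex)" using a by auto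
    ultimately show "of_real (a - s) * f a / (\<Prod>x\<in>S - {a}. of_real (a - x)) =
        f a / (\<Prod>x\<in>S - {s} - {a}. of_real (a - x))"
      by (metis (no_types, lifting) mult_divide_mult_cancel_left)
  qed
  also have "\<dots> = divdiff (S - {s}) f" by (simp add: divdiff_def)
  finally show ?thesis by (simp add: algebra_simps)
qed

lemma divdiff_one:
  assumes "finite S" "S \<noteq> {}"
  shows "divdiff S (\<lambda>x. 1) = (if card S = 1 then 1 else 0)"
  using assms
proof (induction "card S" arbitrary: S rule: less_induct)
  case less
  show ?case
  proof (cases "card S = 1")
    case True
    then obtain s where "S = {s}" by (auto simp: card_1_singleton_iff)
    then show ?thesis by (simp add: divdiff_def)
  next
    case False
    obtain s where s: "s \<in> S" using less.prems by auto
    have "S \<noteq> {s}" using False by auto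
    with s obtain t where st: "s \<in> S" "t \<in> S" "s \<noteq> t" by auto
    have c: "card S > 1" using False less.prems card_gt_0_iff[of S] by linarith
    have IH: "divdiff (S - {r}) (\<lambda>x. 1) = (if card S = 2 then 1 else 0)" if "r \<in> S" for r
    proof -
      have r: "card (S - {r}) = card S - 1" using that less.prems by simp
      then have "S - {r} \<noteq> {}" using c by fastforce
      then show ?thesis using less.hyps[of "S - {r}"] r c less.prems(1) by auto
    qed
    have *: "divdiff (S - {s}) (\<lambda>x. 1) = divdiff (S - {t}) (\<lambda>x. 1)"
      using IH st by simp
    have "of_real s * divdiff S (\<lambda>x. 1) = of_real t * divdiff S (\<lambda>x. 1)"
      using divdiff_mult_id[of S s "\<lambda>x. 1"] divdiff_mult_id[of S t "\<lambda>x. 1"] less.prems st * by simp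
    then show ?thesis using st False by auto
  qed
qed

lemma divdiff_power:
  assumes "finite S" "j < card S"
  shows "divdiff S (\<lambda>x. of_real x ^ j) = (if Suc j = card S then 1 else 0)"
  using assms
proof (induction j arbitrary: S)
  case 0
  then have "S \<noteq> {}" by auto
  then show ?case using divdiff_one[of S] 0 by auto
next
  case (Suc j)
  then obtain s where s: "s \<in> S" by fastforce
  have "divdiff S (\<lambda>x. of_real x ^ Suc j) = of_real s * divdiff S (\<lambda>x. of_real x ^ j) + divdiff (S - {s}) (\<lambda>x. of_real x ^ j)"
    using divdiff_mult_id[OF Suc.prems(1) s, of "\<lambda>x. of_real x ^ j"] by simp
  with Suc.IH[of S] Suc.IH[of "S - {s}"] Suc.prems s show ?case by auto
qed

text \<open>The function \<open>f x = 1 / (1 - u x)\<close> satisfies \<open>f x = 1 + u x f x\<close>, which turns the recursion of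
  \<open>divdiff_mult_id\<close> into an equation for the divided difference itself.\<close>

lemma divdiff_geometric:
  assumes "finite S" "S \<noteq> {}" "\<And>x. x \<in> S \<Longrightarrow> 1 - u * of_real x \<noteq> 0"
  shows "divdiff S (\<lambda>x. 1 / (1 - u * of_real x)) = u ^ (card S - 1) / (\<Prod>x\<in>S. 1 - u * of_real x)"
  using assms
proof (induction "card S" arbitrary: S)
  case 0
  then show ?case by simp
next
  case (Suc n)
  let ?f = "\<lambda>x::real. 1 / (1 - u * of_real x)"
  from Suc.prems obtain s where s: "s \<in> S" by auto
  have "divdiff S ?f = divdiff S (\<lambda>x. 1 + u * (of_real x * ?f x))"
    by (rule divdiff_cong) (use Suc.prems(3) in \<open>auto simp: field_simps\<close>)
  also have "\<dots> = divdiff S (\<lambda>x. 1) + u * (of_real s * divdiff S ?f + divdiff (S - {s}) ?f)"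
    by (simp only: divdiff_add divdiff_cmult divdiff_mult_id[OF Suc.prems(1) s])
  finally have eq: "(1 - u * of_real s) * divdiff S ?f = divdiff S (\<lambda>x. 1) + u * divdiff (S - {s}) ?f"
    by (simp add: algebra_simps)
  have P: "(\<Prod>x\<in>S. 1 - u * of_real x) = (1 - u * of_real s) * (\<Prod>x\<in>S - {s}. 1 - u * of_real x)"
    using Suc.prems s by (intro prod.remove) auto
  have nz: "1 - u * of_real s \<noteq> 0" "(\<Prod>x\<in>S - {s}. 1 - u * of_real x) \<noteq> 0"
    using Suc.prems s by auto
  show ?case
  proof (cases "card S = 1")
    case True
    then have "S = {s}" using s by (auto simp: card_1_singleton_iff)
    then show ?thesis by (simp add: divdiff_def)
  next
    case False
    have c: "card (S - {s}) = card S - 1" using s Suc.prems(1) by simp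
    have c2: "card S - 1 > 0" using False Suc(2) by simp
    have ne: "S - {s} \<noteq> {}" using c c2 by (metis card.empty less_numeral_extra(3))
    have "divdiff (S - {s}) ?f = u ^ (card (S - {s}) - 1) / (\<Prod>x\<in>S - {s}. 1 - u * of_real x)"
      by (rule Suc.hyps(1)) (use Suc s ne in auto)
    moreover have "u * u ^ (card (S - {s}) - 1) = u ^ (card S - 1)"
    proof -
      obtain r where "card S = Suc (Suc r)" using c2 by (cases "card S" rule: nat.exhaust; cases "card S - 1" rule: nat.exhaust) auto
      then show ?thesis using c by simp
    qed
    moreover have "divdiff S (\<lambda>x. 1) = 0" using divdiff_one[of S] Suc.prems False by simp
    ultimately have "(1 - u * of_real s) * divdiff S ?f = u ^ (card S - 1) / (\<Prod>x\<in>S - {s}. 1 - u * of_real x)"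
      using eq by (metis add_0 times_divide_eq_right)
    then show ?thesis unfolding P using nz by (simp add: field_simps)
  qed
qed

lemma divdiff_real:
  "divdiff S (\<lambda>x. of_real (f x)) = of_real (\<Sum>a\<in>S. f a / (\<Prod>x\<in>S - {a}. a - x))"
  unfolding divdiff_def by simp

section \<open>Ratios of alternants\<close>

definition alternant :: "nat \<Rightarrow> (nat \<Rightarrow> real \<Rightarrow> complex) \<Rightarrow> (nat \<Rightarrow> real) \<Rightarrow> complex" where
  "alternant n f p = detf n (\<lambda>i j. f j (p i))"

abbreviation monomial :: "nat \<Rightarrow> real \<Rightarrow> complex" where
  "monomial j \<equiv> (\<lambda>x. of_real x ^ j)"

text \<open>Divided differences over the initial segments of an enumeration form a lower triangular linear
  map on the values at the points.\<close>

lemma newton_row: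
  fixes p :: "nat \<Rightarrow> real"
  assumes "inj_on p {..<n}" "k < n"
  defines "L \<equiv> \<lambda>k i. if i \<le> k then 1 / (\<Prod>x\<in>p ` {..k} - {p i}. complex_of_real (p i - x)) else 0"
  shows "(\<Sum>i<n. L k i * f (p i)) = divdiff (p ` {..k}) f"
proof -
  have inj: "inj_on p {..k}" using assms(1) by (rule inj_on_subset) (use assms(2) in auto)
  have "(\<Sum>i<n. L k i * f (p i)) = (\<Sum>i\<in>{..k}. L k i * f (p i))"
    by (rule sum.mono_neutral_right) (use assms(2) in \<open>auto simp: L_def\<close>)
  also have "\<dots> = divdiff (p ` {..k}) f"
    unfolding divdiff_def by (subst sum.reindex[OF inj]) (auto simp: L_def)
  finally show ?thesis .
qed

text \<open>The lower triangular matrix of \<open>newton_row\<close> sends the values of a function to its divided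
  differences. The monomials of degree below \<open>n\<close> go to a unitriangular matrix, so the determinant of
  that matrix is the inverse of the Vandermonde determinant; hence an alternant divided by the
  Vandermonde determinant is a determinant of divided differences.\<close>

lemma alternant_newton:
  assumes "inj_on p {..<n}"
  shows "alternant n f p = alternant n monomial p * detf n (\<lambda>k j. divdiff (p ` {..k}) (f j))"
    and "alternant n monomial p = (\<Prod>j<n. \<Prod>i<j. of_real (p j - p i))"
    and "alternant n monomial p \<noteq> 0"
proof -
  define L where
    "L = (\<lambda>k i. if i \<le> k then 1 / (\<Prod>x\<in>p ` {..k} - {p i}. complex_of_real (p i - x)) else 0)"
  have row: "detf n L * alternant n g p = detf n (\<lambda>k j. divdiff (p ` {..k}) (g j))" for g
    unfolding alternant_def detf_mult[symmetric]
    by (rule detf_cong) (use newton_row[OF assms] in \<open>simp add: L_def\<close>)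
  have card: "card (p ` {..k}) = Suc k" if "k < n" for k
  proof -
    have "{..k} \<subseteq> {..<n}" using that by auto
    then show ?thesis using card_image[OF inj_on_subset[OF assms, of "{..k}"]] by simp
  qed
  have one: "detf n L * alternant n monomial p = 1"
    unfolding row by (subst detf_upper_triangular) (auto simp: divdiff_power card)
  have L: "detf n L = (\<Prod>k<n. 1 / (\<Prod>i<k. of_real (p k - p i)))"
  proof (subst detf_lower_triangular)
    have "L k k = 1 / (\<Prod>i<k. of_real (p k - p i))" if k: "k < n" for k
    proof -
      have inj: "inj_on p {..<k}" "inj_on p {..k}"
        using assms by (rule inj_on_subset; use k in auto)+
      have "p ` ({..k} - {k}) = p ` {..k} - p ` {k}"
        by (rule inj_on_image_set_diff[OF inj(2)]) auto
      moreover have "{..k} - {k} = {..<k}" by auto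
      ultimately have "p ` {..k} - {p k} = p ` {..<k}" by simp
      then show ?thesis by (simp add: L_def prod.reindex[OF inj(1)])
    qed
    then show "(\<Prod>i<n. L i i) = (\<Prod>k<n. 1 / (\<Prod>i<k. of_real (p k - p i)))"
      by (intro prod.cong) auto
  qed (simp add: L_def)
  show nz: "alternant n monomial p \<noteq> 0" using one by auto
  have "detf n L \<noteq> 0" using one by auto
  then have "alternant n monomial p = 1 / detf n L" using one by (simp add: field_simps)
  also have "\<dots> = (\<Prod>j<n. \<Prod>i<j. of_real (p j - p i))" by (simp add: L prod_dividef)
  finally show "alternant n monomial p = (\<Prod>j<n. \<Prod>i<j. of_real (p j - p i))" .
  have "alternant n monomial p * detf n (\<lambda>k j. divdiff (p ` {..k}) (f j))
      = (detf n L * alternant n monomial p) * alternant n f p"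
    by (simp add: row[symmetric])
  then show "alternant n f p = alternant n monomial p * detf n (\<lambda>k j. divdiff (p ` {..k}) (f j))"
    using one by simp
qed

text \<open>The increasing enumeration is only a convenient choice: by \<open>alternant_ratio_enumeration\<close> the ratio
  is a function of the set. For monomials of distinct degrees it is a Schur polynomial in the elements
  of \<open>X\<close>, up to sign.\<close>

definition alternant_ratio :: "(nat \<Rightarrow> real \<Rightarrow> complex) \<Rightarrow> real set \<Rightarrow> complex" where
  "alternant_ratio f X = alternant (card X) f (elt X) / alternant (card X) monomial (elt X)"

lemma bij_betw_elt: "finite X \<Longrightarrow> bij_betw (elt X) {..<card X} X"
  unfolding elt_def by (rule bij_betw_nth) auto

lemma elt_less: "finite X \<Longrightarrow> i < j \<Longrightarrow> j < card X \<Longrightarrow> elt X i < elt X j"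
  unfolding elt_def by (rule sorted_wrt_nth_less[where P = "(<)"]) auto

lemma elt_mem: "finite X \<Longrightarrow> i < card X \<Longrightarrow> elt X i \<in> X"
  using bij_betw_elt[of X] by (auto simp: bij_betw_def)

lemma vandermonde_eq_alternant:
  assumes "finite X"
  shows "alternant (card X) monomial (elt X) = of_real (vandermonde X)"
  unfolding alternant_newton(2)[OF bij_betw_imp_inj_on[OF bij_betw_elt[OF assms]]] vandermonde_def
  by simp

lemma vandermonde_pos: "finite X \<Longrightarrow> vandermonde X > 0"
  unfolding vandermonde_def by (intro prod_pos ballI) (auto simp: elt_less)

lemma vandermonde_positive: "vandermonde X > 0"
proof (cases "finite X")
  case False
  then show ?thesis by (simp add: vandermonde_def)
qed (rule vandermonde_pos)

text \<open>A change of the enumeration multiplies both alternants by the same sign.\<close>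

lemma alternant_ratio_enumeration:
  assumes "bij_betw p {..<n} X"
  shows "alternant n f p / alternant n monomial p = alternant_ratio f X"
proof -
  have fin: "finite X" using assms bij_betw_finite by blast
  have n: "card X = n" using bij_betw_same_card[OF assms] by simp
  have e: "bij_betw (elt X) {..<n} X" using bij_betw_elt[OF fin] n by simp
  define \<pi> where "\<pi> = (\<lambda>i. if i < n then inv_into {..<n} (elt X) (p i) else i)"
  have "bij_betw (inv_into {..<n} (elt X) \<circ> p) {..<n} {..<n}"
    by (rule bij_betw_trans[OF assms bij_betw_inv_into[OF e]])
  then have "bij_betw \<pi> {..<n} {..<n}"
    by (rule bij_betw_cong[THEN iffD1, rotated]) (simp add: \<pi>_def)
  then have \<pi>: "\<pi> permutes {..<n}"
    by (rule bij_imp_permutes) (simp add: \<pi>_def)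
  have p: "elt X (\<pi> i) = p i" if "i < n" for i
    using that assms bij_betw_inv_into_right[OF e] by (auto simp: \<pi>_def bij_betw_def)
  have "alternant n g p = signof \<pi> * alternant n g (elt X)" for g
    unfolding alternant_def detf_permute_rows[OF \<pi>, symmetric]
    by (rule detf_cong) (simp add: p)
  then show ?thesis by (simp add: alternant_ratio_def n sign_def)
qed

text \<open>When the first \<open>m\<close> functions are monomials of degrees \<open>0, \<dots>, m - 1\<close>, their divided differences over
  more than \<open>m\<close> points vanish, so that the determinant of size \<open>m + k\<close> collapses to one of size \<open>k\<close>.
  The enumeration puts the freely chosen points \<open>ts\<close> last; the sets over which differences are taken
  are then \<open>X\<close> without at most \<open>k - 1\<close> points, whatever the size of \<open>X\<close>.\<close>

lemma alternant_ratio_divdiff: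
  assumes X: "finite X" "card X = m + k" and ts: "distinct ts" "length ts = k" "set ts \<subseteq> X"
    and f: "\<And>j. j < m \<Longrightarrow> f j = (\<lambda>x. c j * of_real x ^ j)"
  shows "alternant_ratio f X =
    (\<Prod>j<m. c j) * detf k (\<lambda>i j. divdiff (X - set (drop (Suc i) ts)) (f (m + j)))"
proof -
  \<comment> \<open>the points of \<open>ts\<close> come last\<close>
  define p where "p = (\<lambda>i. if i < m then elt (X - set ts) i else ts ! (i - m))"
  have cm: "card (X - set ts) = m"
    using card_Diff_subset[of "set ts" X] ts X by (simp add: distinct_card)
  have e: "bij_betw (elt (X - set ts)) {..<m} (X - set ts)"
    using bij_betw_elt[of "X - set ts"] X cm by simp
  have p1: "p ` {..<m} = X - set ts" using e by (auto simp: p_def bij_betw_def)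
  have p2: "p ` {m..<m + i} = set (take i ts)" if "i \<le> k" for i
  proof -
    have "{m..<m + i} = (\<lambda>j. m + j) ` {..<i}"
      using image_add_atLeastLessThan[of m 0 i] by (simp add: atLeast0LessThan add.commute)
    then have "p ` {m..<m + i} = (\<lambda>j. p (m + j)) ` {..<i}" by (simp only: image_image)
    also have "\<dots> = (\<lambda>j. ts ! j) ` {..<i}" by (simp add: p_def)
    also have "\<dots> = set (take i ts)" using that ts(2) nth_image[of i ts] by (simp add: atLeast0LessThan)
    finally show ?thesis .
  qed
  have dt: "set (take i ts) \<inter> set (drop i ts) = {}" for i
    using ts(1) set_take_disj_set_drop_if_distinct[of ts i i] by simp
  have td: "set (take i ts) \<union> set (drop i ts) = set ts" for i
    by (metis append_take_drop_id set_append)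
  have pi: "p ` {..m + i} = X - set (drop (Suc i) ts)" if "i < k" for i
  proof -
    have "{..m + i} = {..<m} \<union> {m..<m + Suc i}" by auto
    then have "p ` {..m + i} = (X - set ts) \<union> set (take (Suc i) ts)"
      using p1 p2[of "Suc i"] that by (simp add: image_Un)
    then show ?thesis using dt[of "Suc i"] td[of "Suc i"] ts(3) by blast
  qed
  have pn: "p ` {..<m + k} = X"
  proof -
    have "{..<m + k} = {..<m} \<union> {m..<m + k}" by auto
    then have "p ` {..<m + k} = (X - set ts) \<union> set (take k ts)"
      using p1 p2[of k] by (simp add: image_Un)
    then show ?thesis using ts by auto
  qed
  have bij: "bij_betw p {..<m + k} X"
    using pn X by (simp add: bij_betw_def eq_card_imp_inj_on)
  then have inj: "inj_on p {..<m + k}" by (rule bij_betw_imp_inj_on)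
  have card: "card (p ` {..i}) = Suc i" if "i < m + k" for i
  proof -
    have "{..i} \<subseteq> {..<m + k}" using that by auto
    then show ?thesis using card_image[OF inj_on_subset[OF inj, of "{..i}"]] by simp
  qed
  let ?D = "\<lambda>i j. divdiff (p ` {..i}) (f j)"
  have D: "?D i j = (if i = j then c j else 0)" if "j < m" "j \<le> i" "i < m + k" for i j
    using that by (simp add: f divdiff_cmult divdiff_power card)
  have "alternant_ratio f X = detf (m + k) ?D"
    unfolding alternant_ratio_enumeration[OF bij, symmetric]
    using alternant_newton(1)[OF inj, of f] alternant_newton(3)[OF inj] by simp
  also have "\<dots> = detf m ?D * detf k (\<lambda>i j. ?D (m + i) (m + j))"
    by (rule detf_block_triangular) (simp add: D)
  also have "detf m ?D = (\<Prod>j<m. c j)"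
    by (subst detf_upper_triangular) (auto simp: D)
  also have "detf k (\<lambda>i j. ?D (m + i) (m + j)) = detf k (\<lambda>i j. divdiff (X - set (drop (Suc i) ts)) (f (m + j)))"
    by (rule detf_cong) (simp add: pi)
  finally show ?thesis .
qed

lemma alternant_ratio_monomials:
  assumes "finite X" "card X = n" "\<And>j. j < n \<Longrightarrow> f j = (\<lambda>x. c j * of_real x ^ j)"
  shows "alternant_ratio f X = (\<Prod>j<n. c j)"
  using alternant_ratio_divdiff[of X n 0 "[]" f c] assms by simp

lemma elt_image_strict_mono:
  fixes g :: "nat \<Rightarrow> real"
  assumes "\<And>i j. i < j \<Longrightarrow> j < n \<Longrightarrow> g i < g j" "i < n"
  shows "elt (g ` {..<n}) i = g i"
proof -
  have "sorted_wrt (<) (map g [0..<n])"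
    using assms(1) by (simp add: sorted_wrt_iff_nth_less)
  then have "sorted_list_of_set (g ` {..<n}) = map g [0..<n]"
    by (intro strict_sorted_equal) (auto simp: atLeast0LessThan)
  then show ?thesis using assms(2) by (simp add: elt_def)
qed

section \<open>Sums, kernels and limits\<close>

lemma has_sum_prod_PiE:
  fixes f :: "nat \<Rightarrow> real \<Rightarrow> complex"
  assumes "finite A" "\<And>i. i \<in> A \<Longrightarrow> countable (B i)"
    and "\<And>i. i \<in> A \<Longrightarrow> (\<lambda>y. norm (f i y)) summable_on B i" "\<And>i. i \<in> A \<Longrightarrow> (f i has_sum s i) (B i)"
  shows "((\<lambda>g. \<Prod>i\<in>A. f i (g i)) has_sum (\<Prod>i\<in>A. s i)) (PiE A B)"
proof -
  have "(\<lambda>g. norm (\<Prod>i\<in>A. f i (g i))) summable_on PiE A B"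
    by (rule abs_summable_equivalent[THEN iffD2, OF abs_summable_on_prod_PiE])
       (use assms(1,2) abs_summable_equivalent[THEN iffD1, OF assms(3)] in auto)
  then have "(\<lambda>g. \<Prod>i\<in>A. f i (g i)) summable_on PiE A B" by (rule abs_summable_summable)
  moreover have "infsum (\<lambda>g. \<Prod>i\<in>A. f i (g i)) (PiE A B) = (\<Prod>i\<in>A. infsum (f i) (B i))"
    by (rule infsum_prod_PiE_abs) (use assms in auto)
  moreover have "infsum (f i) (B i) = s i" if "i \<in> A" for i
    using assms(4)[OF that] by (rule infsumI)
  ultimately show ?thesis by (simp add: has_sum_iff)
qed

lemma has_sum_finite_sum:
  fixes f :: "'b \<Rightarrow> 'c \<Rightarrow> complex"
  assumes "finite S" "\<And>s. s \<in> S \<Longrightarrow> (f s has_sum c s) A"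
  shows "((\<lambda>x. \<Sum>s\<in>S. f s x) has_sum (\<Sum>s\<in>S. c s)) A"
  using assms by (induction S) (auto intro!: has_sum_add)

text \<open>Fubini's theorem for the composition of two stochastic kernels applied to a bounded function.\<close>

lemma kernel_composition:
  fixes P :: "'a \<Rightarrow> real" and Q :: "'a \<Rightarrow> 'b \<Rightarrow> real" and h :: "'b \<Rightarrow> complex"
  assumes P: "\<And>z. P z \<ge> 0" "(P has_sum 1) A"
    and Q: "\<And>z y. Q z y \<ge> 0" "\<And>z. z \<in> A \<Longrightarrow> (Q z has_sum 1) B"
    and h: "\<And>y. y \<in> B \<Longrightarrow> norm (h y) \<le> C"
    and E: "\<And>z. z \<in> A \<Longrightarrow> ((\<lambda>y. of_real (Q z y) * h y) has_sum E z) B"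
    and S: "((\<lambda>z. of_real (P z) * E z) has_sum S) A"
  shows "((\<lambda>y. of_real (\<Sum>\<^sub>\<infinity>z\<in>A. P z * Q z y) * h y) has_sum S) B"
    and "y \<in> B \<Longrightarrow> ((\<lambda>z. P z * Q z y) has_sum (\<Sum>\<^sub>\<infinity>z\<in>A. P z * Q z y)) A"
proof -
  have PQ: "(\<lambda>(z, y). P z * Q z y) summable_on A \<times> B"
  proof (rule summable_on_SigmaI)
    show "((\<lambda>y. case (z, y) of (z, y) \<Rightarrow> P z * Q z y) has_sum P z) B" if "z \<in> A" for z
      using has_sum_cmult_right[OF Q(2)[OF that], of "P z"] by simp
    show "P summable_on A" using P(2) has_sum_imp_summable by blast
  qed (use P Q in auto)
  have inner: "((\<lambda>z. P z * Q z y) has_sum (\<Sum>\<^sub>\<infinity>z\<in>A. P z * Q z y)) A" if "y \<in> B" for y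
  proof -
    have "(\<lambda>(y, z). P z * Q z y) summable_on B \<times> A"
      using PQ summable_on_swap[of "\<lambda>(z, y). P z * Q z y" A B] by simp
    from summable_on_SigmaD1[OF this that] show ?thesis by simp
  qed
  then show "y \<in> B \<Longrightarrow> ((\<lambda>z. P z * Q z y) has_sum (\<Sum>\<^sub>\<infinity>z\<in>A. P z * Q z y)) A" .
  have PQh: "(\<lambda>(z, y). of_real (P z * Q z y) * h y) summable_on A \<times> B"
  proof (rule abs_summable_summable, rule Infinite_Sum.abs_summable_on_comparison_test')
    show "(\<lambda>(z, y). C * (P z * Q z y)) summable_on A \<times> B"
      using summable_on_cmult_right[OF PQ, of C] by (simp add: case_prod_unfold)
    fix x assume "x \<in> A \<times> B"
    then obtain z y where x: "x = (z, y)" "y \<in> B" by auto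
    have "norm (of_real (P z * Q z y) * h y) = norm (h y) * (P z * Q z y)"
      using P(1) Q(1) by (simp add: norm_mult abs_mult)
    also have "\<dots> \<le> C * (P z * Q z y)" using P(1) Q(1) h[OF x(2)] by (intro mult_right_mono) auto
    finally show "norm (case x of (z, y) \<Rightarrow> of_real (P z * Q z y) * h y) \<le> (case x of (z, y) \<Rightarrow> C * (P z * Q z y))"
      using x by simp
  qed
  have "((\<lambda>(z, y). of_real (P z * Q z y) * h y) has_sum S) (A \<times> B)"
  proof (rule has_sum_SigmaI[OF _ S PQh])
    fix z assume "z \<in> A"
    from has_sum_cmult_right[OF E[OF this], of "of_real (P z)"]
    show "((\<lambda>y. case (z, y) of (z, y) \<Rightarrow> of_real (P z * Q z y) * h y) has_sum of_real (P z) * E z) B"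
      by (simp add: mult.assoc)
  qed
  then have "((\<lambda>(y, z). of_real (P z * Q z y) * h y) has_sum S) (B \<times> A)"
    by (subst (asm) has_sum_swap) simp
  then show "((\<lambda>y. of_real (\<Sum>\<^sub>\<infinity>z\<in>A. P z * Q z y) * h y) has_sum S) B"
  proof (rule has_sum_SigmaD)
    fix y assume "y \<in> B"
    from has_sum_cmult_left[OF has_sum_of_real[OF inner[OF this]], of "h y"]
    show "((\<lambda>z. case (y, z) of (y, z) \<Rightarrow> of_real (P z * Q z y) * h y) has_sum
        of_real (\<Sum>\<^sub>\<infinity>z\<in>A. P z * Q z y) * h y) A" by simp
  qed
qed

text \<open>Only finitely many terms carry almost all of the sum, and those stay away from \<open>0\<close>.\<close>

lemma summable_small_tail:
  fixes f :: "real \<Rightarrow> real"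
  assumes "f summable_on A" "\<And>y. y \<in> A \<Longrightarrow> 0 \<le> f y" "0 \<notin> A" "\<epsilon> > 0"
  obtains \<delta> where "\<delta> > 0" "\<And>S. finite S \<Longrightarrow> S \<subseteq> {y \<in> A. \<bar>y\<bar> < \<delta>} \<Longrightarrow> sum f S \<le> \<epsilon>"
proof -
  obtain F where F: "finite F" "F \<subseteq> A" "dist (sum f F) (infsum f A) \<le> \<epsilon>"
    using infsum_finite_approximation[OF assms(1,4)] by blast
  define \<delta> where "\<delta> = Min (insert 1 (abs ` F))"
  have \<delta>: "\<delta> > 0" unfolding \<delta>_def using F(1,2) assms(3) by (subst Min_gr_iff) auto
  show ?thesis
  proof (rule that[OF \<delta>])
    fix S assume S: "finite S" "S \<subseteq> {y \<in> A. \<bar>y\<bar> < \<delta>}"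
    have "\<delta> \<le> \<bar>y\<bar>" if "y \<in> F" for y unfolding \<delta>_def using F(1) that by (intro Min_le) auto
    then have "F \<inter> S = {}" using S(2) by fastforce
    then have "sum f F + sum f S = sum f (F \<union> S)" using F(1) S(1) by (simp add: sum.union_disjoint)
    also have "\<dots> \<le> infsum f A"
      using assms(1,2) F S by (intro finite_sum_le_infsum) auto
    finally show "sum f S \<le> \<epsilon>" using F(3) by (simp add: dist_real_def)
  qed
qed

lemma sum_UN_le:
  fixes f :: "'b \<Rightarrow> real"
  assumes "finite I" "\<And>i. i \<in> I \<Longrightarrow> finite (A i)" "\<And>x. 0 \<le> f x"
  shows "sum f (\<Union>i\<in>I. A i) \<le> (\<Sum>i\<in>I. sum f (A i))"
  using assms(1,2)
proof (induction I)
  case (insert i I)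
  let ?U = "\<Union>i\<in>I. A i"
  have "finite (A i)" "finite ?U" using insert by auto
  then have "sum f (A i \<union> ?U) + sum f (A i \<inter> ?U) = sum f (A i) + sum f ?U" by (rule sum.union_inter)
  moreover have "0 \<le> sum f (A i \<inter> ?U)" by (intro sum_nonneg assms(3))
  ultimately show ?case using insert by simp
qed simp

text \<open>The distance of a product from \<open>1\<close> is controlled by the sum of the deviations of its factors,
  uniformly in their number.\<close>

lemma prod_minus_one_bound:
  fixes f :: "'a \<Rightarrow> 'b :: {real_normed_field}"
  assumes "finite S"
  shows "norm ((\<Prod>x\<in>S. 1 + f x) - 1) \<le> exp (\<Sum>x\<in>S. norm (f x)) - 1"
    and "norm (\<Prod>x\<in>S. 1 + f x) \<le> exp (\<Sum>x\<in>S. norm (f x))"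
proof -
  have *: "norm ((\<Prod>x\<in>S. 1 + f x) - 1) \<le> exp (\<Sum>x\<in>S. norm (f x)) - 1"
    using assms
  proof (induction S)
    case (insert a S)
    let ?P = "\<Prod>x\<in>S. 1 + f x" and ?s = "\<Sum>x\<in>S. norm (f x)"
    have "norm ?P \<le> norm (?P - 1) + 1" using norm_triangle_ineq[of "?P - 1" 1] by simp
    then have P: "norm ?P \<le> exp ?s" using insert.IH by simp
    have "(1 + f a) * ?P - 1 = (?P - 1) + f a * ?P" by (simp add: algebra_simps)
    then have "norm ((1 + f a) * ?P - 1) \<le> norm (?P - 1) + norm (f a) * norm ?P"
      by (metis norm_triangle_ineq norm_mult)
    also have "\<dots> \<le> exp ?s - 1 + norm (f a) * exp ?s"
      using insert.IH P by (intro add_mono mult_left_mono) auto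
    also have "\<dots> = (1 + norm (f a)) * exp ?s - 1" by (simp add: algebra_simps)
    also have "\<dots> \<le> exp (norm (f a)) * exp ?s - 1"
      by (intro diff_right_mono mult_right_mono) auto
    finally show ?case using insert.hyps by (simp add: exp_add)
  qed simp
  then show "norm ((\<Prod>x\<in>S. 1 + f x) - 1) \<le> exp (\<Sum>x\<in>S. norm (f x)) - 1" .
  have "norm (\<Prod>x\<in>S. 1 + f x) \<le> norm ((\<Prod>x\<in>S. 1 + f x) - 1) + 1"
    using norm_triangle_ineq[of "(\<Prod>x\<in>S. 1 + f x) - 1" 1] by simp
  then show "norm (\<Prod>x\<in>S. 1 + f x) \<le> exp (\<Sum>x\<in>S. norm (f x))" using * by linarith
qed

text \<open>The reason for evaluating test functions at imaginary points: no factor \<open>1 - \<i> r\<close> is small, whatever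
  the sign of \<open>r\<close>.\<close>

lemma norm_one_minus_imaginary: "1 \<le> norm (1 - \<i> * of_real r)" "\<bar>r\<bar> \<le> norm (1 - \<i> * of_real r)"
proof -
  have "1 - \<i> * of_real r = Complex 1 (- r)" by (simp add: complex_eq_iff)
  then show "1 \<le> norm (1 - \<i> * of_real r)" "\<bar>r\<bar> \<le> norm (1 - \<i> * of_real r)"
    using complex_Re_le_cmod[of "Complex 1 (- r)"] abs_Im_le_cmod[of "Complex 1 (- r)"] by simp_all
qed

lemma decseq_limit:
  fixes f :: "nat \<Rightarrow> real"
  assumes "decseq f" "\<And>n. B \<le> f n"
  obtains l where "f \<longlonglongrightarrow> l" "B \<le> l"
proof -
  obtain l where l: "f \<longlonglongrightarrow> l" using decseq_convergent[of f B] assms by blast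
  then have "B \<le> l" using assms(2) by (intro LIMSEQ_le_const[OF l]) auto
  with l show ?thesis by (rule that)
qed

lemma tendsto_shift: "f \<longlonglongrightarrow> (l :: 'a :: topological_space) \<Longrightarrow> (\<lambda>N. f (N - k)) \<longlonglongrightarrow> l"
  by (rule LIMSEQ_offset[where k = k]) simp

lemma bounded_of_tendsto:
  fixes f :: "nat \<Rightarrow> complex"
  assumes "f \<longlonglongrightarrow> l"
  shows "\<exists>C. \<forall>n. norm (f n) \<le> C"
  using convergent_imp_Bseq[OF convergentI, OF assms] by (auto simp: Bseq_def)

lemma finite_min_abs:
  assumes "finite (A :: real set)" "0 \<notin> A"
  obtains \<delta> where "\<delta> > 0" "\<And>x. x \<in> A \<Longrightarrow> \<delta> \<le> \<bar>x\<bar>"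
proof -
  define \<delta> where "\<delta> = Min (insert 1 (abs ` A))"
  have "\<delta> > 0" unfolding \<delta>_def using assms by (subst Min_gr_iff) auto
  moreover have "\<delta> \<le> \<bar>x\<bar>" if "x \<in> A" for x unfolding \<delta>_def using assms(1) that by (intro Min_le) auto
  ultimately show ?thesis by (rule that)
qed

lemma distinct_list_in_infinite_set:
  assumes "infinite X"
  obtains ts :: "real list" where "distinct ts" "length ts = K" "set ts \<subseteq> X"
proof -
  obtain T where "T \<subseteq> X" "finite T" "card T = K"
    using infinite_arbitrarily_large[OF assms] by blast
  then show ?thesis using that[of "sorted_list_of_set T"] by simp
qed

lemma card_set_drop:
  assumes "distinct ts" "length ts = K" "i < K"
  shows "card (set (drop (Suc i) ts)) + Suc i = K"
  using assms by (simp add: distinct_card)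

text \<open>A map factors through the equivalence relation that it defines. The map on classes is given by
  an arbitrary representative.\<close>

lemma quotient_by_kernel_bij:
  assumes "\<And>x y. (x, y) \<in> r \<longleftrightarrow> x \<in> A \<and> y \<in> A \<and> s x = s y"
  shows "bij_betw (\<lambda>C. s (SOME x. x \<in> C)) (A // r) (s ` A)"
    and "C \<in> A // r \<Longrightarrow> x \<in> C \<Longrightarrow> x \<in> A \<and> s (SOME x. x \<in> C) = s x"
proof -
  have cls: "C = {y \<in> A. s y = s x}" if "C \<in> A // r" "x \<in> C" for C x
    using that assms by (auto simp: quotient_def)
  have val: "x \<in> A \<and> s (SOME x. x \<in> C) = s x" if C: "C \<in> A // r" "x \<in> C" for C x
  proof -
    have "(SOME x. x \<in> C) \<in> C" using C(2) by (rule someI)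
    then show ?thesis using cls[OF C] C(2) by auto
  qed
  then show "C \<in> A // r \<Longrightarrow> x \<in> C \<Longrightarrow> x \<in> A \<and> s (SOME x. x \<in> C) = s x" by blast
  have ne: "\<exists>x. x \<in> C" if "C \<in> A // r" for C using that assms by (auto simp: quotient_def)
  show "bij_betw (\<lambda>C. s (SOME x. x \<in> C)) (A // r) (s ` A)"
  proof (rule bij_betw_imageI)
    show "inj_on (\<lambda>C. s (SOME x. x \<in> C)) (A // r)"
    proof (rule inj_onI)
      fix C D assume C: "C \<in> A // r" and D: "D \<in> A // r" and eq: "s (SOME x. x \<in> C) = s (SOME x. x \<in> D)"
      obtain x y where xy: "x \<in> C" "y \<in> D" using ne C D by blast
      then have "s x = s y" using val[OF C xy(1)] val[OF D xy(2)] eq by simp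
      then show "C = D" using cls[OF C xy(1)] cls[OF D xy(2)] by simp
    qed
    show "(\<lambda>C. s (SOME x. x \<in> C)) ` (A // r) = s ` A"
    proof (intro equalityI subsetI)
      fix z assume "z \<in> (\<lambda>C. s (SOME x. x \<in> C)) ` (A // r)"
      then obtain C where C: "C \<in> A // r" "z = s (SOME x. x \<in> C)" by blast
      then obtain x where "x \<in> C" using ne by blast
      then show "z \<in> s ` A" using val[OF C(1)] C(2) by auto
    next
      fix z assume "z \<in> s ` A"
      then obtain x where x: "x \<in> A" "z = s x" by blast
      have C: "r `` {x} \<in> A // r" using x(1) by (rule quotientI)
      moreover have "x \<in> r `` {x}" using x(1) assms by simp
      ultimately have "z = s (SOME y. y \<in> r `` {x})" using val[OF C] x(2) by metis
      then show "z \<in> (\<lambda>C. s (SOME x. x \<in> C)) ` (A // r)" using C by blast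
    qed
  qed
qed

section \<open>Weak convergence on a countable discrete space\<close>

lemma integral_point_measure:
  fixes p :: "'a \<Rightarrow> real"
  assumes "\<And>y. 0 \<le> p y" "p summable_on A" "\<And>y. y \<in> A \<Longrightarrow> \<bar>f y\<bar> \<le> C"
  shows "(\<lambda>y. p y * f y) summable_on A"
    and "integral\<^sup>L (point_measure A (\<lambda>y. ennreal (p y))) f = infsum (\<lambda>y. p y * f y) A"
proof -
  have abs: "(\<lambda>y. norm (p y * f y)) summable_on A"
  proof (rule Infinite_Sum.abs_summable_on_comparison_test')
    show "(\<lambda>y. p y * C) summable_on A" using assms(2) by (rule summable_on_cmult_left)
    show "norm (p y * f y) \<le> p y * C" if "y \<in> A" for y
      using assms(1)[of y] assms(3)[OF that] by (auto simp: abs_mult intro!: mult_left_mono)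
  qed
  then show "(\<lambda>y. p y * f y) summable_on A" by (rule abs_summable_summable)
  have "integral\<^sup>L (point_measure A (\<lambda>y. ennreal (p y))) f = infsetsum (\<lambda>y. p y * f y) A"
    unfolding point_measure_def infsetsum_def using assms(1) by (subst integral_density) auto
  also have "\<dots> = infsum (\<lambda>y. p y * f y) A"
    by (rule infsetsum_infsum) (rule abs_summable_equivalent[THEN iffD1, OF abs])
  finally show "integral\<^sup>L (point_measure A (\<lambda>y. ennreal (p y))) f = infsum (\<lambda>y. p y * f y) A" .
qed

lemma prob_space_point_measure:
  fixes p :: "'a \<Rightarrow> real"
  assumes "\<And>y. 0 \<le> p y" "(p has_sum 1) A"
  shows "prob_space (point_measure A (\<lambda>y. ennreal (p y)))"
proof
  have "(\<lambda>y. norm (p y)) summable_on A"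
    using has_sum_imp_summable[OF assms(2)] assms(1) by simp
  then have abs: "Infinite_Set_Sum.abs_summable_on p A" by (rule abs_summable_equivalent[THEN iffD1])
  have "emeasure (point_measure A (\<lambda>y. ennreal (p y))) A = nn_integral (count_space A) (\<lambda>y. ennreal (p y))"
    unfolding point_measure_def by (subst emeasure_density) (auto intro!: nn_integral_cong simp: indicator_def)
  also have "\<dots> = ennreal (infsum p A)"
    using nn_integral_conv_infsetsum[OF abs] assms(1) infsetsum_infsum[OF abs] by simp
  finally show "emeasure (point_measure A (\<lambda>y. ennreal (p y))) (space (point_measure A (\<lambda>y. ennreal (p y)))) = 1"
    using infsumI[OF assms(2)] by (simp add: space_point_measure)
qed

lemma bounded_mean_tail:
  fixes p f :: "'a \<Rightarrow> real"
  assumes "\<And>y. 0 \<le> p y" "(p has_sum 1) A" "\<And>y. y \<in> A \<Longrightarrow> \<bar>f y\<bar> \<le> C" "finite F" "F \<subseteq> A"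
  shows "\<bar>infsum (\<lambda>y. p y * f y) A - (\<Sum>y\<in>F. p y * f y)\<bar> \<le> C * (1 - sum p F)"
proof -
  have s: "(\<lambda>y. p y * f y) summable_on A"
    using integral_point_measure(1)[of p A f C] assms has_sum_imp_summable by blast
  have "((\<lambda>y. p y * f y) has_sum (infsum (\<lambda>y. p y * f y) A - (\<Sum>y\<in>F. p y * f y))) (A - F)"
    using has_sum_Diff[OF has_sum_infsum[OF s] has_sum_finite[OF assms(4)] assms(5)] .
  moreover have "((\<lambda>y. C * p y) has_sum (C * (1 - sum p F))) (A - F)"
    using has_sum_cmult_right[OF has_sum_Diff[OF assms(2) has_sum_finite[OF assms(4)] assms(5)], of C] .
  ultimately have "norm (infsum (\<lambda>y. p y * f y) A - (\<Sum>y\<in>F. p y * f y)) \<le> C * (1 - sum p F)"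
  proof (rule norm_infsum_le)
    fix y assume "y \<in> A - F"
    then show "norm (p y * f y) \<le> C * p y"
      using assms(1)[of y] assms(3)[of y] by (auto simp: abs_mult mult.commute[of C] intro!: mult_left_mono)
  qed
  then show ?thesis by simp
qed

text \<open>Scheffe's lemma: for probability weights, pointwise convergence to probability weights is
  convergence against all bounded functions, since a finite set carries almost all of the limit and
  hence almost all of the approximating weights.\<close>

lemma bounded_mean_converges:
  fixes p :: "nat \<Rightarrow> 'a \<Rightarrow> real"
  assumes p: "\<And>N y. 0 \<le> p N y" "\<forall>\<^sub>F N in sequentially. (p N has_sum 1) A"
    and l: "\<And>y. 0 \<le> l y" "(l has_sum 1) A" "\<And>y. y \<in> A \<Longrightarrow> (\<lambda>N. p N y) \<longlonglongrightarrow> l y"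
    and f: "\<And>y. y \<in> A \<Longrightarrow> \<bar>f y\<bar> \<le> C"
  shows "(\<lambda>N. infsum (\<lambda>y. p N y * f y) A) \<longlonglongrightarrow> infsum (\<lambda>y. l y * f y) A"
proof (rule tendstoI)
  fix \<epsilon> :: real assume \<epsilon>: "\<epsilon> > 0"
  define D where "D = \<bar>C\<bar> + 1"
  have D: "D > 0" "\<And>y. y \<in> A \<Longrightarrow> \<bar>f y\<bar> \<le> D" using f by (auto simp: D_def) force
  define \<eta> where "\<eta> = \<epsilon> / (4 * D)"
  have \<eta>: "\<eta> > 0" using \<epsilon> D by (simp add: \<eta>_def)
  obtain F where F: "finite F" "F \<subseteq> A" "dist (sum l F) (infsum l A) \<le> \<eta>"
    using infsum_finite_approximation[OF has_sum_imp_summable[OF l(2)] \<eta>] by blast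
  have lF: "1 - sum l F \<le> \<eta>" using F(3) infsumI[OF l(2)] by (simp add: dist_real_def)
  have 1: "(\<lambda>N. sum (p N) F) \<longlonglongrightarrow> sum l F" by (intro tendsto_sum l(3)) (use F in auto)
  have 2: "(\<lambda>N. \<Sum>y\<in>F. p N y * f y) \<longlonglongrightarrow> (\<Sum>y\<in>F. l y * f y)"
    by (intro tendsto_sum tendsto_mult tendsto_const l(3)) (use F in auto)
  have ev1: "\<forall>\<^sub>F N in sequentially. 1 - 3 / 2 * \<eta> < sum (p N) F"
    by (rule order_tendstoD(1)[OF 1]) (use lF \<eta> in linarith)
  have ev2: "\<forall>\<^sub>F N in sequentially. dist (\<Sum>y\<in>F. p N y * f y) (\<Sum>y\<in>F. l y * f y) < \<epsilon> / 4"
    by (rule tendstoD[OF 2]) (use \<epsilon> in simp)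
  show "\<forall>\<^sub>F N in sequentially. dist (infsum (\<lambda>y. p N y * f y) A) (infsum (\<lambda>y. l y * f y) A) < \<epsilon>"
    using ev1 ev2 p(2)
  proof eventually_elim
    case (elim N)
    have "\<bar>infsum (\<lambda>y. p N y * f y) A - (\<Sum>y\<in>F. p N y * f y)\<bar> \<le> D * (1 - sum (p N) F)"
      by (rule bounded_mean_tail[OF p(1) elim(3) D(2) F(1,2)])
    also have "\<dots> \<le> D * (3 / 2 * \<eta>)" using D elim(1) by (intro mult_left_mono) auto
    finally have a: "\<bar>infsum (\<lambda>y. p N y * f y) A - (\<Sum>y\<in>F. p N y * f y)\<bar> \<le> 3 / 8 * \<epsilon>"
      using D by (simp add: \<eta>_def)
    have "\<bar>infsum (\<lambda>y. l y * f y) A - (\<Sum>y\<in>F. l y * f y)\<bar> \<le> D * (1 - sum l F)"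
      by (rule bounded_mean_tail[OF l(1,2) D(2) F(1,2)])
    also have "\<dots> \<le> D * \<eta>" using D lF by (intro mult_left_mono) auto
    finally have b: "\<bar>infsum (\<lambda>y. l y * f y) A - (\<Sum>y\<in>F. l y * f y)\<bar> \<le> \<epsilon> / 4"
      using D by (simp add: \<eta>_def)
    show ?case using a b elim(2) \<epsilon> unfolding dist_real_def by linarith
  qed
qed

lemma prob_finite_approximation:
  assumes "prob_space M" "sets M = Pow A" "countable A" "\<epsilon> > 0"
  obtains F where "finite F" "F \<subseteq> A" "1 - \<epsilon> < measure M F"
proof -
  interpret prob_space M by fact
  have space: "space M = A" using sets_eq_imp_space_eq[of M "count_space A"] assms(2) by simp
  have ne: "A \<noteq> {}" using not_empty space by simp
  define F where "F = (\<lambda>n. from_nat_into A ` {..n})"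
  have "range F \<subseteq> sets M" using from_nat_into[OF ne] by (auto simp: F_def assms(2))
  moreover have "incseq F" by (auto simp: F_def incseq_def)
  ultimately have "(\<lambda>n. measure M (F n)) \<longlonglongrightarrow> measure M (\<Union>n. F n)"
    by (rule finite_Lim_measure_incseq)
  also have "(\<Union>n. F n) = space M"
    using range_from_nat_into[OF ne assms(3)] space by (fastforce simp: F_def)
  finally have "(\<lambda>n. measure M (F n)) \<longlonglongrightarrow> 1" using prob_space by simp
  then have "\<forall>\<^sub>F n in sequentially. 1 - \<epsilon> < measure M (F n)" by (rule order_tendstoD(1)) (use assms(4) in simp)
  then obtain n where "1 - \<epsilon> < measure M (F n)" by (auto simp: eventually_sequentially)
  then show ?thesis using that[of "F n"] from_nat_into[OF ne] by (auto simp: F_def)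
qed

section \<open>The order of the variational series\<close>

lemma precedes_total: "x \<noteq> y \<Longrightarrow> precedes x y \<or> precedes y x"
  unfolding precedes_def by linarith

lemma precedes_same_sign: "precedes x y \<Longrightarrow> 0 < x * y \<Longrightarrow> \<bar>y\<bar> < \<bar>x\<bar>"
  unfolding precedes_def by (auto simp: zero_less_mult_iff abs_if split: if_splits)

lemma precedes_trans: "precedes x y \<Longrightarrow> precedes y z \<Longrightarrow> precedes x z"
  unfolding precedes_def by linarith

lemma precedes_irrefl: "\<not> precedes x x"
  unfolding precedes_def by simp

lemma precedes_abs: "precedes x y \<Longrightarrow> \<bar>y\<bar> \<le> \<bar>x\<bar>"
  unfolding precedes_def by linarith

text \<open>The position of \<open>x\<close> in the variational series of \<open>X\<close>, counted from \<open>0\<close>.\<close>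

definition rank :: "real set \<Rightarrow> real \<Rightarrow> nat" where
  "rank X x = card {y \<in> X. precedes y x}"

definition top_part :: "real set \<Rightarrow> nat \<Rightarrow> real set" where
  "top_part X k = {x \<in> X. rank X x < k}"

section \<open>Sequences of configurations\<close>

text \<open>Stabilization in terms of sets instead of sequences: outside every
  neighbourhood of \<open>0\<close> the configurations eventually coincide with \<open>X\<close>.\<close>

definition outer_converges :: "(nat \<Rightarrow> real set) \<Rightarrow> real set \<Rightarrow> bool" where
  "outer_converges Xs X \<longleftrightarrow>
     (\<forall>\<delta>>0. \<forall>\<^sub>F N in sequentially. {x \<in> Xs N. \<delta> \<le> \<bar>x\<bar>} = {x \<in> X. \<delta> \<le> \<bar>x\<bar>})"

lemma outer_converges_Diff:
  "outer_converges Xs X \<Longrightarrow> outer_converges (\<lambda>N. Xs N - D) (X - D)"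
  unfolding outer_converges_def by (auto elim!: eventually_mono)

lemma outer_converges_finite_subset:
  assumes "outer_converges Xs X" "finite D" "D \<subseteq> X" "0 \<notin> X"
  shows "\<forall>\<^sub>F N in sequentially. D \<subseteq> Xs N"
proof -
  have "\<forall>\<^sub>F N in sequentially. x \<in> Xs N" if "x \<in> D" for x
  proof -
    have "\<bar>x\<bar> > 0" using that assms by auto
    with assms(1) have "\<forall>\<^sub>F N in sequentially. {y \<in> Xs N. \<bar>x\<bar> \<le> \<bar>y\<bar>} = {y \<in> X. \<bar>x\<bar> \<le> \<bar>y\<bar>}"
      unfolding outer_converges_def by blast
    then show ?thesis by eventually_elim (use that assms in auto)
  qed
  then have "\<forall>\<^sub>F N in sequentially. \<forall>x\<in>D. x \<in> Xs N"
    using assms(2) by (simp add: eventually_ball_finite_distrib)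
  then show ?thesis by (auto elim!: eventually_mono)
qed

lemma outer_converges_bounded:
  assumes "outer_converges Xs X" "bounded X"
  obtains R where "R > 0" "\<forall>\<^sub>F N in sequentially. \<forall>x\<in>Xs N. \<bar>x\<bar> \<le> R"
proof -
  obtain R where R: "\<And>x. x \<in> X \<Longrightarrow> \<bar>x\<bar> \<le> R" using assms(2) by (auto simp: bounded_iff)
  have "\<forall>\<^sub>F N in sequentially. {x \<in> Xs N. 1 \<le> \<bar>x\<bar>} = {x \<in> X. 1 \<le> \<bar>x\<bar>}"
    using assms(1) unfolding outer_converges_def by simp
  then have "\<forall>\<^sub>F N in sequentially. \<forall>x\<in>Xs N. \<bar>x\<bar> \<le> max 1 R"
  proof eventually_elim
    case (elim N)
    have "\<bar>x\<bar> \<le> R" if "x \<in> Xs N" "1 \<le> \<bar>x\<bar>" for x using elim that R by blast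
    then show ?case by (metis max.cobounded1 max.coboundedI2 linear order_trans)
  qed
  then show ?thesis by (intro that[of "max 1 R"]) auto
qed

text \<open>Two sequences are compared by alternating between them: a statement about convergent sequences,
  applied to the merged sequence, forces both limits to agree.\<close>

definition merge :: "(nat \<Rightarrow> real set) \<Rightarrow> (nat \<Rightarrow> real set) \<Rightarrow> nat \<Rightarrow> real set" where
  "merge Xs Ys N = (if even N then Xs N else Ys N)"

lemma merge_agrees: "\<exists>N\<ge>n. Xs N = merge Xs Ys N" "\<exists>N\<ge>n. Ys N = merge Xs Ys N"
  by (rule exI[of _ "2 * n"], simp add: merge_def) (rule exI[of _ "Suc (2 * n)"], simp add: merge_def)

lemma merge_stabilizes:
  assumes "stabilizes_to Xs X" "stabilizes_to Ys X"
  shows "stabilizes_to (merge Xs Ys) X"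
  unfolding stabilizes_to_def
proof
  fix k
  obtain N1 N2 where "\<forall>N\<ge>N1. var_series (Xs N) k = var_series X k" "\<forall>N\<ge>N2. var_series (Ys N) k = var_series X k"
    using assms unfolding stabilizes_to_def by blast
  then show "\<exists>N0. \<forall>N\<ge>N0. var_series (merge Xs Ys N) k = var_series X k"
    by (intro exI[of _ "max N1 N2"]) (simp add: merge_def)
qed

section \<open>The two-sided lattice\<close>

locale two_sided_lattice =
  fixes q zm zp :: real
  assumes q: "0 < q" "q < 1" and zm: "zm < 0" and zp: "zp > 0"
begin

abbreviation lattice :: "real set" where "lattice \<equiv> qlattice q zm zp"
abbreviation configs' :: "nat \<Rightarrow> real set set" where "configs' \<equiv> configs q zm zp"
abbreviation link1 :: "nat \<Rightarrow> real set \<Rightarrow> real set \<Rightarrow> real" where "link1 \<equiv> qlink1 q zm zp"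
abbreviation link :: "nat \<Rightarrow> nat \<Rightarrow> real set \<Rightarrow> real set \<Rightarrow> real" where "link \<equiv> qlink q zm zp"

lemma lattice_cases:
  assumes "x \<in> lattice"
  obtains k where "x = zm * q powi k" "x < 0" | k where "x = zp * q powi k" "x > 0"
proof -
  have pos: "q powi k > 0" for k using q by simp
  from assms obtain k where "x = zm * q powi k \<or> x = zp * q powi k"
    unfolding qlattice_def by auto
  then show ?thesis
    using that mult_neg_pos[OF zm pos[of k]] mult_pos_pos[OF zp pos[of k]] by metis
qed

lemma lattice_nonzero: "x \<in> lattice \<Longrightarrow> x \<noteq> 0"
  by (metis lattice_cases less_irrefl)

lemma lattice_mult_powi: "x \<in> lattice \<Longrightarrow> x * q powi k \<in> lattice"
  using q by (auto simp: qlattice_def mult.assoc power_int_add[symmetric])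

lemma lattice_mult_power: "x \<in> lattice \<Longrightarrow> x * q ^ n \<in> lattice"
  using lattice_mult_powi[of x "int n"] by simp

lemma countable_lattice: "countable lattice"
  unfolding qlattice_def by simp

text \<open>On either half-line the lattice is a single geometric progression.\<close>

lemma lattice_same_sign:
  assumes "x \<in> lattice" "y \<in> lattice" "x * y > 0" "\<bar>y\<bar> \<le> \<bar>x\<bar>"
  obtains i :: nat where "y = x * q ^ i"
proof -
  obtain z j k where x: "x = z * q powi j" and y: "y = z * q powi k" and z: "z \<noteq> 0"
    using assms(1)
  proof (cases rule: lattice_cases)
    case (1 j)
    have "y < 0"
    proof (rule ccontr)
      assume "\<not> y < 0"
      then have "x * y \<le> 0" using 1 by (intro mult_nonpos_nonneg) auto
      then show False using assms(3) by simp
    qed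
    with assms(2) obtain k where "y = zm * q powi k" by (cases rule: lattice_cases) auto
    with 1 zm that show ?thesis by blast
  next
    case (2 j)
    have "y > 0"
    proof (rule ccontr)
      assume "\<not> y > 0"
      then have "x * y \<le> 0" using 2 by (intro mult_nonneg_nonpos) auto
      then show False using assms(3) by simp
    qed
    with assms(2) obtain k where "y = zp * q powi k" by (cases rule: lattice_cases) auto
    with 2 zp that show ?thesis by blast
  qed
  have "q powi k \<le> q powi j" using assms(4) z q unfolding x y by (simp add: abs_mult)
  then have jk: "j \<le> k"
    using q power_int_strict_decreasing[of k j q] by (meson linorder_not_le)
  have "y = x * q powi (k - j)" unfolding x y using q
    by (simp add: mult.assoc power_int_add[symmetric])
  also have "\<dots> = x * q ^ nat (k - j)" using jk by (simp add: power_int_def)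
  finally show ?thesis by (rule that)
qed

lemma power_strict_decreasing_q: "q ^ i < q ^ j \<longleftrightarrow> j < i"
  using q by (simp add: power_strict_decreasing_iff)

lemma power_decreasing_q: "q ^ i \<le> q ^ j \<longleftrightarrow> j \<le> i"
  using q by (simp add: power_decreasing_iff)

lemma inj_orbit: "x \<noteq> 0 \<Longrightarrow> inj_on (\<lambda>i. x * q ^ i) A"
  using power_decreasing_q by (intro inj_onI) (metis antisym mult_cancel_left order_refl)

text \<open>On the lattice the intervals of the interlacing relation are pieces of geometric progressions;
  here the half-open interval contains the end \<open>b\<close> and stops just before \<open>a\<close>.\<close>

lemma qinterval_positive:
  assumes "a \<in> lattice" "b \<in> lattice" "0 < a" "a < b"
  obtains k where "a = b * q ^ k" "qinterval q zm zp a b = (\<lambda>i. b * q ^ i) ` {..<k}"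
proof -
  obtain k where k: "a = b * q ^ k"
    using lattice_same_sign[of b a] assms by (auto simp: zero_less_mult_iff)
  have "y \<in> (\<lambda>i. b * q ^ i) ` {..<k}" if y: "a < y" "y \<le> b" "y \<in> lattice" for y
  proof -
    have "0 < y" using y assms by linarith
    then obtain i where i: "y = b * q ^ i"
      using lattice_same_sign[of b y] assms y by (auto simp: zero_less_mult_iff)
    then have "i < k" using y(1) assms unfolding i k by (simp add: power_strict_decreasing_q)
    with i show ?thesis by auto
  qed
  moreover have "b * q ^ i \<in> {a<..b} \<inter> lattice" if "i < k" for i
  proof -
    have "q ^ k < q ^ i" "q ^ i \<le> q ^ 0"
      using that power_strict_decreasing_q power_decreasing_q by blast+
    then show ?thesis using assms lattice_mult_power[of b i] unfolding k by simp
  qed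
  ultimately have "{a<..b} \<inter> lattice = (\<lambda>i. b * q ^ i) ` {..<k}" by auto
  then show ?thesis using that[OF k] assms by (simp add: qinterval_def)
qed

lemma qinterval_negative:
  assumes "a \<in> lattice" "b \<in> lattice" "a < b" "b < 0"
  obtains k where "b = a * q ^ k" "qinterval q zm zp a b = (\<lambda>i. a * q ^ i) ` {..<k}"
proof -
  obtain k where k: "b = a * q ^ k"
    using lattice_same_sign[of a b] assms by (auto simp: zero_less_mult_iff)
  have "y \<in> (\<lambda>i. a * q ^ i) ` {..<k}" if y: "a \<le> y" "y < b" "y \<in> lattice" for y
  proof -
    have "y < 0" using y assms by linarith
    then obtain i where i: "y = a * q ^ i"
      using lattice_same_sign[of a y] assms y by (auto simp: zero_less_mult_iff)
    then have "i < k" using y(2) assms unfolding i k by (simp add: power_strict_decreasing_q)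
    with i show ?thesis by auto
  qed
  moreover have "a * q ^ i \<in> {a..<b} \<inter> lattice" if "i < k" for i
  proof -
    have "q ^ k < q ^ i" "q ^ i \<le> q ^ 0"
      using that power_strict_decreasing_q power_decreasing_q by blast+
    then show ?thesis using assms lattice_mult_power[of a i] unfolding k
      by (simp add: mult_le_cancel_left1)
  qed
  ultimately have "{a..<b} \<inter> lattice = (\<lambda>i. a * q ^ i) ` {..<k}" by auto
  then show ?thesis using that[OF k] assms by (simp add: qinterval_def)
qed

lemma qinterval_mixed:
  assumes "a \<in> lattice" "b \<in> lattice" "a < 0" "0 < b"
  shows "qinterval q zm zp a b = range (\<lambda>i. a * q ^ i) \<union> range (\<lambda>i. b * q ^ i)"
proof -
  have A: "y \<in> range (\<lambda>i. a * q ^ i) \<union> range (\<lambda>i. b * q ^ i)" if y: "a \<le> y" "y \<le> b" "y \<in> lattice" for y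
  proof (cases "y < 0")
    case True
    then obtain i where "y = a * q ^ i"
      using lattice_same_sign[of a y] assms y by (auto simp: zero_less_mult_iff)
    then show ?thesis by auto
  next
    case False
    then obtain i where "y = b * q ^ i"
      using lattice_same_sign[of b y] assms y lattice_nonzero[of y] by (auto simp: zero_less_mult_iff)
    then show ?thesis by auto
  qed
  have B: "a * q ^ i \<in> {a..b} \<inter> lattice" "b * q ^ i \<in> {a..b} \<inter> lattice" for i
  proof -
    have q1: "q ^ i \<le> 1" "0 < q ^ i" using q by (auto intro: power_le_one)
    have "a * q ^ i \<le> 0" "0 \<le> b * q ^ i" "a \<le> a * q ^ i" "b * q ^ i \<le> b"
      using assms q1 by (auto simp: mult_le_0_iff mult_le_cancel_left1 mult_le_cancel_left2)
    then have "a \<le> a * q ^ i" "a * q ^ i \<le> b" "a \<le> b * q ^ i" "b * q ^ i \<le> b"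
      using assms by linarith+
    then show "a * q ^ i \<in> {a..b} \<inter> lattice" "b * q ^ i \<in> {a..b} \<inter> lattice"
      using assms lattice_mult_power[of a i] lattice_mult_power[of b i] by auto
  qed
  have "{a..b} \<inter> lattice = range (\<lambda>i. a * q ^ i) \<union> range (\<lambda>i. b * q ^ i)"
  proof (intro equalityI subsetI)
    fix x assume "x \<in> {a..b} \<inter> lattice"
    then show "x \<in> range (\<lambda>i. a * q ^ i) \<union> range (\<lambda>i. b * q ^ i)" by (intro A) simp_all
  next
    fix x assume "x \<in> range (\<lambda>i. a * q ^ i) \<union> range (\<lambda>i. b * q ^ i)"
    then show "x \<in> {a..b} \<inter> lattice" using B by (elim UnE imageE) (simp_all only:)
  qed
  then show ?thesis using assms by (simp add: qinterval_def)
qed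

section \<open>Telescoping sums over lattice intervals\<close>

text \<open>Up to the factor \<open>1 - q\<close> the first condition says that the \<open>q\<close>-derivative of \<open>\<Phi>\<close> is \<open>\<phi>\<close>. The second one
  makes \<open>\<Phi>\<close> continuous at \<open>0\<close> with the same value from both sides, which lets sums telescope across
  \<open>0\<close>; the third one gives absolute convergence there.\<close>

definition qprimitive :: "(real \<Rightarrow> complex) \<Rightarrow> (real \<Rightarrow> complex) \<Rightarrow> bool" where
  "qprimitive \<phi> \<Phi> \<longleftrightarrow>
     (\<forall>x\<in>lattice. \<Phi> x - \<Phi> (q * x) = of_real x * \<phi> x) \<and>
     (\<exists>c. \<forall>x\<in>lattice. (\<lambda>n. \<Phi> (x * q ^ n)) \<longlonglongrightarrow> c) \<and>
     (\<forall>x\<in>lattice. \<exists>C. \<forall>n. norm (\<phi> (x * q ^ n)) \<le> C)"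

lemma qprimitive_step:
  assumes "qprimitive \<phi> \<Phi>" "x \<in> lattice"
  shows "of_real \<bar>x * q ^ i\<bar> * \<phi> (x * q ^ i) = of_real (sgn x) * (\<Phi> (x * q ^ i) - \<Phi> (x * q ^ Suc i))"
proof -
  have "\<Phi> (x * q ^ i) - \<Phi> (q * (x * q ^ i)) = of_real (x * q ^ i) * \<phi> (x * q ^ i)"
    using assms lattice_mult_power unfolding qprimitive_def by blast
  moreover have "complex_of_real \<bar>x * q ^ i\<bar> = of_real (sgn x) * of_real (x * q ^ i)"
    using q by (simp add: abs_mult sgn_if)
  ultimately show ?thesis by (simp add: mult_ac)
qed

lemma qprimitive_sum:
  assumes "qprimitive \<phi> \<Phi>" "x \<in> lattice"
  shows "(\<Sum>i<k. of_real \<bar>x * q ^ i\<bar> * \<phi> (x * q ^ i)) = of_real (sgn x) * (\<Phi> x - \<Phi> (x * q ^ k))"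
  unfolding qprimitive_step[OF assms] sum_distrib_left[symmetric]
  using sum_lessThan_telescope'[of "\<lambda>i. \<Phi> (x * q ^ i)" k] by simp

text \<open>Along \<open>x q\<^sup>i\<close> the terms telescope. The sign accounts for the two orientations: towards \<open>0\<close> is
  upwards on the negative half-line and downwards on the positive one.\<close>

lemma qprimitive_orbit:
  assumes "qprimitive \<phi> \<Phi>" "x \<in> lattice" "(\<lambda>n. \<Phi> (x * q ^ n)) \<longlonglongrightarrow> c"
  shows "((\<lambda>y. of_real \<bar>y\<bar> * \<phi> y) has_sum (of_real (sgn x) * (\<Phi> x - c))) (range (\<lambda>i. x * q ^ i))"
    and "(\<lambda>y. norm (of_real \<bar>y\<bar> * \<phi> y)) summable_on (range (\<lambda>i. x * q ^ i))"
proof -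
  let ?f = "\<lambda>i. of_real \<bar>x * q ^ i\<bar> * \<phi> (x * q ^ i)"
  have inj: "inj (\<lambda>i. x * q ^ i)" using lattice_nonzero[OF assms(2)] by (rule inj_orbit)
  obtain C where C: "\<And>n. norm (\<phi> (x * q ^ n)) \<le> C"
    using assms(1,2) unfolding qprimitive_def by blast
  have sm: "summable (\<lambda>i. norm (?f i))"
  proof (rule summable_comparison_test')
    show "summable (\<lambda>i. \<bar>x\<bar> * q ^ i * C)"
      using q by (intro summable_mult2 summable_mult summable_geometric) auto
    have "norm (?f i) = \<bar>x\<bar> * q ^ i * norm (\<phi> (x * q ^ i))" for i
      using q by (simp only: norm_mult norm_of_real abs_abs) (simp add: abs_mult)
    then show "norm (norm (?f i)) \<le> \<bar>x\<bar> * q ^ i * C" for i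
      using q C[of i] by (auto intro!: mult_left_mono)
  qed
  have "?f sums (of_real (sgn x) * (\<Phi> x - c))"
    unfolding qprimitive_step[OF assms(1,2)]
    using sums_mult[OF telescope_sums'[OF assms(3)], of "of_real (sgn x)"] by simp
  from norm_summable_imp_has_sum[OF sm this]
  show "((\<lambda>y. of_real \<bar>y\<bar> * \<phi> y) has_sum (of_real (sgn x) * (\<Phi> x - c))) (range (\<lambda>i. x * q ^ i))"
    by (subst has_sum_reindex[OF inj]) (simp add: o_def)
  have "(\<lambda>i. norm (?f i)) summable_on UNIV"
    by (rule norm_summable_imp_summable_on) (use sm in simp)
  then show "(\<lambda>y. norm (of_real \<bar>y\<bar> * \<phi> y)) summable_on (range (\<lambda>i. x * q ^ i))"
    by (subst summable_on_reindex[OF inj]) (simp add: o_def)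
qed

text \<open>The asymmetric choice of the end points in the definition of the intervals is exactly what makes
  the three cases agree: the sum is always the increment of the primitive.\<close>

lemma qprimitive_interval:
  assumes P: "qprimitive \<phi> \<Phi>" and ab: "a \<in> lattice" "b \<in> lattice" "a < b"
  shows "((\<lambda>y. of_real \<bar>y\<bar> * \<phi> y) has_sum (\<Phi> b - \<Phi> a)) (qinterval q zm zp a b)"
    and "(\<lambda>y. norm (of_real \<bar>y\<bar> * \<phi> y)) summable_on (qinterval q zm zp a b)"
proof -
  let ?f = "\<lambda>y. of_real \<bar>y\<bar> * \<phi> y"
  let ?I = "qinterval q zm zp a b"
  consider "b < 0" | "a < 0" "0 < b" | "0 < a"
    using ab lattice_nonzero by (metis less_trans linorder_cases)
  then have "(?f has_sum (\<Phi> b - \<Phi> a)) ?I \<and> (\<lambda>y. norm (?f y)) summable_on ?I"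
  proof cases
    case 1
    obtain k where k: "b = a * q ^ k" "?I = (\<lambda>i. a * q ^ i) ` {..<k}"
      using qinterval_negative[OF ab 1] .
    have "sum ?f ?I = of_real (sgn a) * (\<Phi> a - \<Phi> b)"
      unfolding k(2) using inj_orbit[OF lattice_nonzero[OF ab(1)]] k(1)
      by (subst sum.reindex) (auto simp: qprimitive_sum[OF P ab(1)])
    then show ?thesis using 1 ab k(2) by (intro conjI has_sum_finiteI summable_on_finite) auto
  next
    case 2
    obtain c where c: "\<And>x. x \<in> lattice \<Longrightarrow> (\<lambda>n. \<Phi> (x * q ^ n)) \<longlonglongrightarrow> c"
      using P unfolding qprimitive_def by blast
    have disj: "range (\<lambda>i. a * q ^ i) \<inter> range (\<lambda>i. b * q ^ i) = {}"
    proof -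
      have "a * q ^ i < b * q ^ j" for i j
        using 2 q by (meson less_trans mult_neg_pos mult_pos_pos zero_less_power)
      then have "a * q ^ i \<noteq> b * q ^ j" for i j by (metis less_irrefl)
      then show ?thesis by blast
    qed
    have "(?f has_sum (of_real (sgn a) * (\<Phi> a - c) + of_real (sgn b) * (\<Phi> b - c))) ?I"
      unfolding qinterval_mixed[OF ab(1,2) 2]
      by (intro has_sum_Un_disjoint qprimitive_orbit[OF P] ab c disj)
    moreover have "(\<lambda>y. norm (?f y)) summable_on ?I"
      unfolding qinterval_mixed[OF ab(1,2) 2]
      by (intro summable_on_Un_disjoint qprimitive_orbit[OF P _ c] ab disj)
    ultimately show ?thesis using 2 by simp
  next
    case 3
    obtain k where k: "a = b * q ^ k" "?I = (\<lambda>i. b * q ^ i) ` {..<k}"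
      using qinterval_positive[OF ab(1,2) 3 ab(3)] .
    have "sum ?f ?I = of_real (sgn b) * (\<Phi> b - \<Phi> a)"
      unfolding k(2) using inj_orbit[OF lattice_nonzero[OF ab(2)]] k(1)
      by (subst sum.reindex) (auto simp: qprimitive_sum[OF P ab(2)])
    then show ?thesis using 3 ab k(2) by (intro conjI has_sum_finiteI summable_on_finite) auto
  qed
  then show "(?f has_sum (\<Phi> b - \<Phi> a)) ?I" "(\<lambda>y. norm (?f y)) summable_on ?I" by auto
qed

section \<open>Interlacing configurations\<close>

lemma configs_memD:
  assumes "X \<in> configs' n"
  shows "X \<subseteq> lattice" "finite X" "card X = n"
  using assms by (auto simp: configs_def)

lemma configs_elt:
  assumes "X \<in> configs' n" "i < n"
  shows "elt X i \<in> X" "elt X i \<in> lattice"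
  using assms elt_mem[of X i] by (auto simp: configs_def)

lemma qinterval_bounds:
  assumes "y \<in> qinterval q zm zp a b"
  shows "a \<le> y" "y \<le> b" "y \<in> lattice" "b < 0 \<Longrightarrow> y < b" "0 < a \<Longrightarrow> a < b \<Longrightarrow> a < y"
  using assms by (auto simp: qinterval_def split: if_splits)

abbreviation below :: "real set \<Rightarrow> nat \<Rightarrow> real set" where
  "below X i \<equiv> qinterval q zm zp (elt X i) (elt X (Suc i))"

lemma qinterval_separated:
  assumes X: "X \<in> configs' (Suc n)" and ij: "i < j" "j < n"
    and y: "y \<in> below X i" and y': "y' \<in> below X j"
  shows "y < y'"
proof -
  have fin: "finite X" and card: "card X = Suc n" using configs_memD[OF X] by auto
  have c: "elt X (Suc i) \<in> lattice" using configs_elt[OF X] ij by auto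
  have le: "elt X (Suc i) \<le> elt X j"
    using elt_less[OF fin, of "Suc i" j] ij card by (cases "Suc i = j") (auto intro: less_imp_le)
  have lt: "elt X j < elt X (Suc j)" using elt_less[OF fin] ij card by auto
  show ?thesis
  proof (cases "elt X (Suc i) < 0")
    case True
    then show ?thesis using qinterval_bounds[OF y] qinterval_bounds[OF y'] le by auto
  next
    case False
    then have "elt X j > 0" using lattice_nonzero[OF c] le by auto
    then show ?thesis using qinterval_bounds[OF y] qinterval_bounds[OF y'] le lt by auto
  qed
qed

text \<open>The intervals between consecutive elements of \<open>X\<close> are disjoint and ordered, so an interlacing
  configuration amounts to an independent choice of one lattice point in each of them.\<close>

lemma interlacing_bij:
  assumes X: "X \<in> configs' (Suc n)"
  shows "bij_betw (\<lambda>Z. restrict (elt Z) {..<n}) {Z \<in> configs' n. interlaces q zm zp Z X} (PiE {..<n} (below X))"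
proof (rule bij_betw_byWitness[where f' = "\<lambda>g. g ` {..<n}"])
  show "\<forall>Z\<in>{Z \<in> configs' n. interlaces q zm zp Z X}. (restrict (elt Z) {..<n}) ` {..<n} = Z"
  proof
    fix Z assume "Z \<in> {Z \<in> configs' n. interlaces q zm zp Z X}"
    then have "finite Z" "card Z = n" by (auto simp: configs_def)
    then show "(restrict (elt Z) {..<n}) ` {..<n} = Z"
      using bij_betw_elt[of Z] by (simp add: bij_betw_def)
  qed
  show "(\<lambda>Z. restrict (elt Z) {..<n}) ` {Z \<in> configs' n. interlaces q zm zp Z X} \<subseteq> PiE {..<n} (below X)"
    by (clarsimp simp only: restrict_PiE_iff image_subset_iff interlaces_def configs_def)
  have mono: "g i < g j" if "g \<in> PiE {..<n} (below X)" "i < j" "j < n" for g i j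
    by (rule qinterval_separated[OF X that(2,3)]) (use that PiE_mem[OF that(1)] in auto)
  then have elt: "elt (g ` {..<n}) i = g i" if "g \<in> PiE {..<n} (below X)" "i < n" for g i
    using that elt_image_strict_mono[of n g i] by blast
  show "\<forall>g\<in>PiE {..<n} (below X). restrict (elt (g ` {..<n})) {..<n} = g"
  proof
    fix g assume g: "g \<in> PiE {..<n} (below X)"
    show "restrict (elt (g ` {..<n})) {..<n} = g"
    proof
      fix i show "restrict (elt (g ` {..<n})) {..<n} i = g i"
        using elt[OF g, of i] PiE_arb[OF g, of i] by (cases "i < n") auto
    qed
  qed
  show "(\<lambda>g. g ` {..<n}) ` PiE {..<n} (below X) \<subseteq> {Z \<in> configs' n. interlaces q zm zp Z X}"
  proof clarify
    fix g assume g: "g \<in> PiE {..<n} (below X)"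
    have "inj_on g {..<n}"
      using mono[OF g] by (intro strict_mono_on_imp_inj_on) (auto simp: strict_mono_on_def)
    then have card: "card (g ` {..<n}) = n" by (simp add: card_image)
    have "g ` {..<n} \<in> configs' n"
      using card qinterval_bounds(3)[OF PiE_mem[OF g]] by (auto simp: configs_def)
    moreover have "interlaces q zm zp (g ` {..<n}) X"
      unfolding interlaces_def card using elt[OF g] PiE_mem[OF g] by simp
    ultimately show "g ` {..<n} \<in> configs' n \<and> interlaces q zm zp (g ` {..<n}) X" by simp
  qed
qed

text \<open>Expanding the determinant and summing each variable over its own interval replaces the functions
  by increments of their primitives; \<open>detf_bordered\<close> turns these into an alternant with one more
  point, whose additional function is the constant \<open>1\<close>.\<close>

lemma interlacing_alternant_sum:
  assumes X: "X \<in> configs' (Suc n)"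
    and g0: "g 0 = (\<lambda>_. 1)" and g: "\<And>j. j < n \<Longrightarrow> qprimitive (f j) (g (Suc j))"
  shows "((\<lambda>Z. (\<Prod>i<n. of_real \<bar>elt Z i\<bar>) * alternant n f (elt Z)) has_sum alternant (Suc n) g (elt X))
           {Z \<in> configs' n. interlaces q zm zp Z X}"
proof -
  have fin: "finite X" and card: "card X = Suc n" using configs_memD[OF X] by auto
  let ?w = "\<lambda>i y. of_real \<bar>y\<bar> :: complex"
  let ?\<Delta> = "\<lambda>i j. g (Suc j) (elt X (Suc i)) - g (Suc j) (elt X i)"
  have step: "((\<lambda>y. of_real \<bar>y\<bar> * f j y) has_sum ?\<Delta> i j) (below X i)"
             "(\<lambda>y. norm (of_real \<bar>y\<bar> * f j y)) summable_on (below X i)" if "i < n" "j < n" for i j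
    using qprimitive_interval[OF g[OF that(2)], of "elt X i" "elt X (Suc i)"] configs_elt[OF X] that
      elt_less[OF fin, of i "Suc i"] card by auto
  have "((\<lambda>z. \<Prod>i<n. of_real \<bar>z i\<bar> * f (\<pi> i) (z i)) has_sum (\<Prod>i<n. ?\<Delta> i (\<pi> i))) (PiE {..<n} (below X))"
    if "\<pi> permutes {..<n}" for \<pi>
    using step permutes_in_image[OF that] countable_lattice
    by (intro has_sum_prod_PiE) (auto simp: qinterval_def)
  then have "((\<lambda>z. \<Sum>\<pi> | \<pi> permutes {..<n}. signof \<pi> * (\<Prod>i<n. of_real \<bar>z i\<bar> * f (\<pi> i) (z i))) has_sum
              (\<Sum>\<pi> | \<pi> permutes {..<n}. signof \<pi> * (\<Prod>i<n. ?\<Delta> i (\<pi> i)))) (PiE {..<n} (below X))"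
    by (intro has_sum_finite_sum has_sum_cmult_right) (auto simp: finite_permutations)
  also have "(\<Sum>\<pi> | \<pi> permutes {..<n}. signof \<pi> * (\<Prod>i<n. ?\<Delta> i (\<pi> i))) = alternant (Suc n) g (elt X)"
    unfolding alternant_def by (subst detf_bordered) (auto simp: detf_def g0)
  also have "(\<lambda>z. \<Sum>\<pi> | \<pi> permutes {..<n}. signof \<pi> * (\<Prod>i<n. of_real \<bar>z i\<bar> * f (\<pi> i) (z i)))
      = (\<lambda>z. (\<Prod>i<n. of_real \<bar>z i\<bar>) * alternant n f z)"
    by (simp add: alternant_def detf_def prod.distrib sum_distrib_left mult_ac)
  finally have *: "((\<lambda>z. (\<Prod>i<n. of_real \<bar>z i\<bar>) * alternant n f z) has_sum alternant (Suc n) g (elt X))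
     (PiE {..<n} (below X))" .
  have alt: "alternant n f (restrict (elt Z) {..<n}) = alternant n f (elt Z)" for Z
    unfolding alternant_def by (rule detf_cong) simp
  have "((\<lambda>Z. (\<Prod>i<n. of_real \<bar>restrict (elt Z) {..<n} i\<bar>) * alternant n f (restrict (elt Z) {..<n}))
      has_sum alternant (Suc n) g (elt X)) {Z \<in> configs' n. interlaces q zm zp Z X}"
    using has_sum_reindex_bij_betw[OF interlacing_bij[OF X], THEN iffD2, OF *] .
  then show ?thesis by (simp add: alt)
qed

section \<open>The links as sums of alternants\<close>

definition qfact :: "nat \<Rightarrow> real" where "qfact n = (\<Prod>i=1..n. 1 - q ^ i)"

lemma qfact_0 [simp]: "qfact 0 = 1" by (simp add: qfact_def)

lemma qfact_Suc: "qfact (Suc n) = qfact n * (1 - q ^ Suc n)"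
  by (simp add: qfact_def)

lemma one_minus_power_q: "0 < n \<Longrightarrow> 0 < 1 - q ^ n" "1 - q ^ n \<le> 1"
  using q power_strict_decreasing_q[of n 0] by auto

lemma qfact_pos: "0 < qfact n" "qfact n \<noteq> 0"
proof -
  show "0 < qfact n" unfolding qfact_def by (intro prod_pos) (use one_minus_power_q(1) in force)
  then show "qfact n \<noteq> 0" by simp
qed

lemma qfact_le_1: "qfact n \<le> 1"
  unfolding qfact_def by (intro prod_le_1) (use q in \<open>auto simp: power_le_one\<close>)

lemma link1_nonneg: "link1 n X Z \<ge> 0"
proof -
  have "0 \<le> (\<Prod>i<n. \<bar>elt Z i\<bar>) * qfact n * (vandermonde Z / vandermonde X)"
    using qfact_pos(1)[of n] vandermonde_positive[of X] vandermonde_positive[of Z]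
    by (intro mult_nonneg_nonneg prod_nonneg divide_nonneg_nonneg) auto
  then show ?thesis by (simp add: qlink1_def qfact_def)
qed

lemma alternant_monomial_configs:
  "X \<in> configs' n \<Longrightarrow> alternant n monomial (elt X) = of_real (vandermonde X)"
  using vandermonde_eq_alternant configs_memD by metis

text \<open>In the weight of a link the factor \<open>vandermonde Z\<close> cancels the denominator of the ratio, so a link
  acts on ratios of alternants by taking primitives and adding the constant function.\<close>

lemma link1_alternant_ratio:
  assumes X: "X \<in> configs' (Suc n)"
    and g0: "g 0 = (\<lambda>_. 1)" and g: "\<And>j. j < n \<Longrightarrow> qprimitive (f j) (g (Suc j))"
  shows "((\<lambda>Z. of_real (link1 n X Z) * alternant_ratio f Z) has_sum of_real (qfact n) * alternant_ratio g X) (configs' n)"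
proof -
  let ?c = "of_real (qfact n / vandermonde X) :: complex"
  have "((\<lambda>Z. ?c * ((\<Prod>i<n. of_real \<bar>elt Z i\<bar>) * alternant n f (elt Z))) has_sum ?c * alternant (Suc n) g (elt X))
           {Z \<in> configs' n. interlaces q zm zp Z X}"
    by (intro has_sum_cmult_right interlacing_alternant_sum assms)
  also have "?c * alternant (Suc n) g (elt X) = of_real (qfact n) * alternant_ratio g X"
    using configs_memD(3)[OF X] alternant_monomial_configs[OF X] by (simp add: alternant_ratio_def)
  also have "((\<lambda>Z. ?c * ((\<Prod>i<n. of_real \<bar>elt Z i\<bar>) * alternant n f (elt Z))) has_sum of_real (qfact n) * alternant_ratio g X)
           {Z \<in> configs' n. interlaces q zm zp Z X} \<longleftrightarrow>
     ((\<lambda>Z. of_real (link1 n X Z) * alternant_ratio f Z) has_sum of_real (qfact n) * alternant_ratio g X) (configs' n)"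
  proof (rule has_sum_cong_neutral)
    fix Z assume "Z \<in> {Z \<in> configs' n. interlaces q zm zp Z X} \<inter> configs' n"
    then have Z: "Z \<in> configs' n" "interlaces q zm zp Z X" by auto
    have "alternant_ratio f Z = alternant n f (elt Z) / of_real (vandermonde Z)"
      using configs_memD(3)[OF Z(1)] alternant_monomial_configs[OF Z(1)] by (simp add: alternant_ratio_def)
    moreover have "link1 n X Z = (\<Prod>i<n. \<bar>elt Z i\<bar>) * qfact n * (vandermonde Z / vandermonde X)"
      using Z(2) by (simp add: qlink1_def qfact_def)
    moreover have "vandermonde Z \<noteq> 0" using vandermonde_positive[of Z] by simp
    ultimately show "?c * ((\<Prod>i<n. of_real \<bar>elt Z i\<bar>) * alternant n f (elt Z)) =
        of_real (link1 n X Z) * alternant_ratio f Z"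
      by (simp add: field_simps)
  qed (auto simp: qlink1_def)
  finally show ?thesis .
qed

lemma tendsto_orbit: "(\<lambda>n. x * q ^ n) \<longlonglongrightarrow> 0"
  using tendsto_mult_right_zero[OF LIMSEQ_power_zero[of q], of x] q by simp

lemma qprimitiveI:
  assumes "\<And>x. x \<in> lattice \<Longrightarrow> \<Phi> x - \<Phi> (q * x) = of_real x * \<phi> x"
    and "\<And>x. x \<in> lattice \<Longrightarrow> (\<lambda>n. \<Phi> (x * q ^ n)) \<longlonglongrightarrow> c"
    and "\<And>x. x \<in> lattice \<Longrightarrow> (\<lambda>n. \<phi> (x * q ^ n)) \<longlonglongrightarrow> d"
  shows "qprimitive \<phi> \<Phi>"
  unfolding qprimitive_def
proof (intro conjI exI[of _ c] ballI assms)
  fix x assume "x \<in> lattice"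
  from convergent_imp_Bseq[OF convergentI, OF assms(3)[OF this]]
  show "\<exists>C. \<forall>n. norm (\<phi> (x * q ^ n)) \<le> C" by (auto simp: Bseq_def)
qed

text \<open>With this normalization the constant functions that are added level by level become the columns
  \<open>x\<^sup>j / qfact j\<close> after \<open>j\<close> further steps.\<close>

lemma qprimitive_monomial:
  "qprimitive (\<lambda>x. of_real x ^ j / of_real (qfact j)) (\<lambda>x. of_real x ^ Suc j / of_real (qfact (Suc j)))"
proof (rule qprimitiveI)
  fix x :: real
  have "1 - q ^ Suc j \<noteq> 0" using one_minus_power_q(1)[OF zero_less_Suc[of j]] by linarith
  then have nz: "complex_of_real (qfact j) \<noteq> 0" "complex_of_real (1 - q ^ Suc j) \<noteq> 0"
    using qfact_pos(2) by (simp_all only: of_real_eq_0_iff not_False_eq_True)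
  have "complex_of_real x ^ Suc j - of_real (q * x) ^ Suc j = of_real x * of_real x ^ j * of_real (1 - q ^ Suc j)"
    by (simp add: algebra_simps power_mult_distrib)
  then show "complex_of_real x ^ Suc j / of_real (qfact (Suc j)) - of_real (q * x) ^ Suc j / of_real (qfact (Suc j)) =
     of_real x * (of_real x ^ j / of_real (qfact j))"
    using nz by (simp only: diff_divide_distrib[symmetric] qfact_Suc of_real_mult) (simp del: of_real_diff power_Suc)
  have lim: "(\<lambda>n. complex_of_real (x * q ^ n)) \<longlonglongrightarrow> of_real 0"
    by (intro tendsto_of_real tendsto_orbit)
  show "(\<lambda>n. complex_of_real (x * q ^ n) ^ Suc j / of_real (qfact (Suc j))) \<longlonglongrightarrow> of_real 0 ^ Suc j / of_real (qfact (Suc j))"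
    by (intro tendsto_intros lim) (simp add: qfact_pos)
  show "(\<lambda>n. complex_of_real (x * q ^ n) ^ j / of_real (qfact j)) \<longlonglongrightarrow> of_real 0 ^ j / of_real (qfact j)"
    by (intro tendsto_intros lim) (simp add: qfact_pos)
qed

text \<open>The normalized monomials at level \<open>n\<close> have as primitives the normalized monomials at level \<open>n + 1\<close>,
  and for them both ratios of alternants are constants.\<close>

lemma link1_has_sum:
  assumes X: "X \<in> configs' (Suc n)"
  shows "(link1 n X has_sum 1) (configs' n)"
proof -
  \<comment> \<open>the same functions serve at both levels, the constant included\<close>
  define f :: "nat \<Rightarrow> real \<Rightarrow> complex" where "f = (\<lambda>j x. of_real x ^ j / of_real (qfact j))"
  let ?p = "(\<Prod>j<n. 1 / of_real (qfact j)) :: complex"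
  have nz: "?p \<noteq> 0" by (simp add: qfact_pos)
  have r: "alternant_ratio f Z = (\<Prod>j<k. 1 / of_real (qfact j))" if "Z \<in> configs' k" for Z k
    using configs_memD[OF that] by (intro alternant_ratio_monomials) (auto simp: f_def)
  have "((\<lambda>Z. of_real (link1 n X Z) * alternant_ratio f Z) has_sum of_real (qfact n) * alternant_ratio f X) (configs' n)"
    by (rule link1_alternant_ratio[OF X]) (use qprimitive_monomial in \<open>auto simp: f_def fun_eq_iff simp del: power_Suc\<close>)
  also have "of_real (qfact n) * alternant_ratio f X = ?p"
    using r[OF X] qfact_pos(2)[of n] by simp
  also have "((\<lambda>Z. of_real (link1 n X Z) * alternant_ratio f Z) has_sum ?p) (configs' n) \<longleftrightarrow>
     ((\<lambda>Z. of_real (link1 n X Z) * ?p) has_sum (1 * ?p)) (configs' n)"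
    by (simp only: mult_1_left, intro has_sum_cong) (simp add: r)
  finally have "((\<lambda>Z. complex_of_real (link1 n X Z)) has_sum of_real 1) (configs' n)"
    unfolding has_sum_cmult_left_iff[OF nz] using nz by simp
  then show ?thesis by (simp only: has_sum_of_real_iff)
qed

lemma link_nonneg: "link N K X Y \<ge> 0"
proof (induction N arbitrary: X)
  case (Suc N)
  then show ?case by (auto intro!: infsum_nonneg mult_nonneg_nonneg link1_nonneg)
qed simp

lemma link_diag: "link K K X Y = (if X = Y then 1 else 0)"
  by (cases K) auto

lemma link_Suc: "K \<le> N \<Longrightarrow>
   link (Suc N) K X Y = (\<Sum>\<^sub>\<infinity>Z\<in>configs' N. link1 N X Z * link N K Z Y)"
  by simp

declare qlink.simps [simp del]

lemma link_has_sum: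
  assumes "K \<le> N" "X \<in> configs' N"
  shows "(link N K X has_sum 1) (configs' K)"
  using assms
proof (induction N arbitrary: X rule: dec_induct)
  case base
  then show ?case
    by (intro has_sum_finite_neutralI[of "{X}"]) (auto simp: link_diag)
next
  case (step N)
  have "((\<lambda>Y. complex_of_real (\<Sum>\<^sub>\<infinity>Z\<in>configs' N. link1 N X Z * link N K Z Y) * 1) has_sum 1) (configs' K)"
  proof (rule kernel_composition(1))
    show "((\<lambda>Y. complex_of_real (link N K Z Y) * 1) has_sum 1) (configs' K)" if "Z \<in> configs' N" for Z
      using has_sum_of_real[OF step.IH[OF that]] by simp
    show "((\<lambda>Z. complex_of_real (link1 N X Z) * 1) has_sum 1) (configs' N)"
      using has_sum_of_real[OF link1_has_sum[OF step.prems]] by simp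
  qed (use link1_nonneg link1_has_sum[OF step.prems] link_nonneg step.IH in auto)
  then have "((\<lambda>Y. complex_of_real (link (Suc N) K X Y)) has_sum of_real 1) (configs' K)"
    using step.hyps by (simp add: link_Suc)
  then show ?case by (simp only: has_sum_of_real_iff)
qed

lemma link_Suc_has_sum:
  assumes "K \<le> N" "X \<in> configs' (Suc N)" "Y \<in> configs' K"
  shows "((\<lambda>Z. link1 N X Z * link N K Z Y) has_sum link (Suc N) K X Y) (configs' N)"
  unfolding link_Suc[OF assms(1)]
  by (rule kernel_composition(2)[where B = "configs' K" and h = "\<lambda>_. 0" and C = 0 and E = "\<lambda>_. 0" and S = "0::complex"])
     (use assms link1_nonneg link1_has_sum link_nonneg link_has_sum in auto)

text \<open>The recursion peels off links at the top; by associativity they may also be peeled off at the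
  bottom.\<close>

lemma link_coherent:
  assumes "Suc K \<le> N" "X \<in> configs' N" "Z \<in> configs' K"
  shows "((\<lambda>Y. link N (Suc K) X Y * link1 K Y Z) has_sum link N K X Z) (configs' (Suc K))"
  using assms
proof (induction N arbitrary: X rule: dec_induct)
  case base
  have "link (Suc K) K X Z = (\<Sum>\<^sub>\<infinity>W\<in>configs' K. link1 K X W * link K K W Z)" by (simp add: link_Suc)
  also have "\<dots> = (\<Sum>\<^sub>\<infinity>W\<in>{Z}. link1 K X W * link K K W Z)"
    by (rule infsum_cong_neutral) (use base in \<open>auto simp: link_diag\<close>)
  finally have "link (Suc K) K X Z = link1 K X Z" by (simp add: link_diag)
  then show ?case
    by (intro has_sum_finite_neutralI[of "{X}"]) (use base in \<open>auto simp: link_diag\<close>)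
next
  case (step N)
  have KN: "K \<le> N" using step.hyps by simp
  have Z1: "link1 K Y Z \<le> 1" if "Y \<in> configs' (Suc K)" for Y
    using finite_sum_le_has_sum[OF link1_has_sum[OF that], of "{Z}"] step.prems link1_nonneg by auto
  have "((\<lambda>Y. complex_of_real (\<Sum>\<^sub>\<infinity>W\<in>configs' N. link1 N X W * link N (Suc K) W Y) * of_real (link1 K Y Z))
       has_sum of_real (link (Suc N) K X Z)) (configs' (Suc K))"
  proof (rule kernel_composition(1)[where C = 1 and E = "\<lambda>W. of_real (link N K W Z)"])
    show "((\<lambda>Y. complex_of_real (link N (Suc K) W Y) * of_real (link1 K Y Z)) has_sum of_real (link N K W Z)) (configs' (Suc K))"
      if "W \<in> configs' N" for W
      unfolding of_real_mult[symmetric] has_sum_of_real_iff by (rule step.IH[OF that step.prems(2)])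
    show "((\<lambda>W. complex_of_real (link1 N X W) * of_real (link N K W Z)) has_sum of_real (link (Suc N) K X Z)) (configs' N)"
      unfolding of_real_mult[symmetric] has_sum_of_real_iff by (rule link_Suc_has_sum[OF KN step.prems])
  qed (use Z1 link1_nonneg link_nonneg link1_has_sum[OF step.prems(1)] link_has_sum[OF step.hyps(1)] in auto)
  then have "((\<lambda>Y. complex_of_real (link (Suc N) (Suc K) X Y * link1 K Y Z)) has_sum of_real (link (Suc N) K X Z)) (configs' (Suc K))"
    using step.hyps by (simp add: link_Suc)
  then show ?case by (simp only: has_sum_of_real_iff)
qed

text \<open>The functions in the alternant at level \<open>K + m\<close>, when \<open>\<psi> j i\<close> is the \<open>i\<close>-th primitive of the function
  \<open>\<psi> j 0\<close> at level \<open>K\<close>: the \<open>m\<close> constants added on the way have turned into monomials.\<close>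

definition chain :: "(nat \<Rightarrow> nat \<Rightarrow> real \<Rightarrow> complex) \<Rightarrow> nat \<Rightarrow> nat \<Rightarrow> real \<Rightarrow> complex" where
  "chain \<psi> m j = (if j < m then (\<lambda>x. 1 / of_real (qfact j) * of_real x ^ j) else \<psi> (j - m) m)"

lemma link_alternant_ratio:
  assumes "X \<in> configs' (K + m)"
    and "\<And>i j. i < m \<Longrightarrow> j < K \<Longrightarrow> qprimitive (\<psi> j i) (\<psi> j (Suc i))"
    and C: "\<And>Y. Y \<in> configs' K \<Longrightarrow> norm (alternant_ratio (\<lambda>j. \<psi> j 0) Y) \<le> C"
  shows "((\<lambda>Y. of_real (link (K + m) K X Y) * alternant_ratio (\<lambda>j. \<psi> j 0) Y) has_sum
           (\<Prod>i<m. of_real (qfact (K + i))) * alternant_ratio (chain \<psi> m) X) (configs' K)"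
  using assms(1,2)
proof (induction m arbitrary: X)
  case 0
  have "chain \<psi> 0 = (\<lambda>j. \<psi> j 0)" by (simp add: chain_def fun_eq_iff)
  then show ?case using 0
    by (intro has_sum_finite_neutralI[of "{X}"]) (auto simp: link_diag)
next
  case (Suc m)
  let ?h = "alternant_ratio (\<lambda>j. \<psi> j 0)"
  let ?c = "(\<Prod>i<m. of_real (qfact (K + i))) :: complex"
  have X: "X \<in> configs' (Suc (K + m))" using Suc.prems by simp
  have g0: "chain \<psi> (Suc m) 0 = (\<lambda>_. 1)" by (simp add: chain_def)
  have g: "qprimitive (chain \<psi> m j) (chain \<psi> (Suc m) (Suc j))" if "j < K + m" for j
  proof (cases "j < m")
    case True
    then show ?thesis using qprimitive_monomial[of j] by (simp add: chain_def)
  next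
    case False
    then show ?thesis using Suc.prems(2)[of m "j - m"] that by (simp add: chain_def)
  qed
  have "((\<lambda>Y. of_real (\<Sum>\<^sub>\<infinity>Z\<in>configs' (K + m). link1 (K + m) X Z * link (K + m) K Z Y) * ?h Y)
      has_sum (?c * (of_real (qfact (K + m)) * alternant_ratio (chain \<psi> (Suc m)) X))) (configs' K)"
  proof (rule kernel_composition(1)[where C = C])
    show "((\<lambda>Y. of_real (link (K + m) K Z Y) * ?h Y) has_sum (?c * alternant_ratio (chain \<psi> m) Z)) (configs' K)"
      if "Z \<in> configs' (K + m)" for Z
      by (rule Suc.IH[OF that]) (use Suc.prems(2) in auto)
    have "((\<lambda>Z. ?c * (of_real (link1 (K + m) X Z) * alternant_ratio (chain \<psi> m) Z)) has_sum
        (?c * (of_real (qfact (K + m)) * alternant_ratio (chain \<psi> (Suc m)) X))) (configs' (K + m))"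
      by (intro has_sum_cmult_right link1_alternant_ratio[OF X] g0 g)
    then show "((\<lambda>Z. of_real (link1 (K + m) X Z) * (?c * alternant_ratio (chain \<psi> m) Z)) has_sum
        (?c * (of_real (qfact (K + m)) * alternant_ratio (chain \<psi> (Suc m)) X))) (configs' (K + m))"
      by (simp add: mult.left_commute)
  qed (use C link1_nonneg link_nonneg link1_has_sum[OF X] link_has_sum in auto)
  then show ?case by (simp add: link_Suc mult_ac)
qed

text \<open>The normalizing factors \<open>qfact (K + i)\<close> of the links, divided by the leading coefficients of the
  monomials in \<open>chain\<close>.\<close>

definition link_const :: "nat \<Rightarrow> nat \<Rightarrow> real" where
  "link_const K m = (\<Prod>i<m. qfact (K + i) / qfact i)"

text \<open>The central identity. The mean of a ratio of alternants at level \<open>K\<close> under the link from level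
  \<open>K + m\<close> is a determinant whose size does not grow with \<open>m\<close>.\<close>

lemma link_divdiff:
  assumes X: "X \<in> configs' (K + m)" and ts: "distinct ts" "length ts = K" "set ts \<subseteq> X"
    and \<psi>: "\<And>i j. i < m \<Longrightarrow> j < K \<Longrightarrow> qprimitive (\<psi> j i) (\<psi> j (Suc i))"
    and C: "\<And>Y. Y \<in> configs' K \<Longrightarrow> norm (alternant_ratio (\<lambda>j. \<psi> j 0) Y) \<le> C"
  shows "((\<lambda>Y. of_real (link (K + m) K X Y) * alternant_ratio (\<lambda>j. \<psi> j 0) Y) has_sum
           of_real (link_const K m) * detf K (\<lambda>i j. divdiff (X - set (drop (Suc i) ts)) (\<psi> j m))) (configs' K)"
proof -
  have "alternant_ratio (chain \<psi> m) X = (\<Prod>j<m. 1 / of_real (qfact j)) *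
      detf K (\<lambda>i j. divdiff (X - set (drop (Suc i) ts)) (chain \<psi> m (m + j)))"
    using configs_memD[OF X] by (intro alternant_ratio_divdiff ts) (auto simp: chain_def add.commute)
  then have "(\<Prod>i<m. of_real (qfact (K + i))) * alternant_ratio (chain \<psi> m) X =
      of_real (link_const K m) * detf K (\<lambda>i j. divdiff (X - set (drop (Suc i) ts)) (\<psi> j m))"
    by (simp add: chain_def link_const_def prod_dividef)
  then show ?thesis using link_alternant_ratio[OF X \<psi> C] by simp
qed

section \<open>Entries of the links\<close>

text \<open>The \<open>m\<close>-th primitive of the point mass at \<open>b\<close>, normalized to vanish near \<open>0\<close>. On the lattice it lives
  on the points \<open>b q\<^sup>-\<^sup>i\<close>, which are described here by their sign and absolute value.\<close>

definition delta_chain :: "real \<Rightarrow> nat \<Rightarrow> real \<Rightarrow> real" where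
  "delta_chain b m x =
     (if m = 0 then of_bool (x = b)
      else if 0 < x * b \<and> \<bar>b\<bar> \<le> \<bar>x\<bar> then b * (\<Prod>k=1..<m. x - b * q ^ k) / qfact (m - 1) else 0)"

lemma delta_chain_outside: "\<not> (0 < x * b \<and> \<bar>b\<bar> \<le> \<bar>x\<bar>) \<Longrightarrow> b \<noteq> 0 \<Longrightarrow> delta_chain b m x = 0"
  by (auto simp: delta_chain_def zero_less_mult_iff)

text \<open>At \<open>x = b\<close> the point \<open>q x\<close> has just left the support; elsewhere on the support the equation is an
  identity between products, because \<open>x \<mapsto> q x\<close> shifts their factors by one.\<close>

lemma delta_chain_step:
  assumes "x \<in> lattice" "b \<in> lattice"
  shows "delta_chain b (Suc m) x - delta_chain b (Suc m) (q * x) = x * delta_chain b m x"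
proof (cases "0 < x * b \<and> \<bar>b\<bar> \<le> \<bar>x\<bar>")
  case False
  have "\<bar>q * x\<bar> \<le> \<bar>x\<bar>" using q by (simp add: abs_mult mult_left_le_one_le)
  moreover have "0 < q * x * b \<longleftrightarrow> 0 < x * b" using q by (simp add: mult.assoc zero_less_mult_iff)
  ultimately have "\<not> (0 < q * x * b \<and> \<bar>b\<bar> \<le> \<bar>q * x\<bar>)" using False by linarith
  then show ?thesis using False lattice_nonzero[OF assms(2)] by (simp add: delta_chain_outside)
next
  case True
  then obtain i where i: "b = x * q ^ i"
    using lattice_same_sign[OF assms] by auto
  have qx: "0 < q * x * b" using True q by (simp add: mult.assoc)
  have inq: "(0 < q * x * b \<and> \<bar>b\<bar> \<le> \<bar>q * x\<bar>) \<longleftrightarrow> x \<noteq> b"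
  proof -
    have "\<bar>b\<bar> \<le> \<bar>q * x\<bar> \<longleftrightarrow> q ^ i \<le> q ^ 1"
      using lattice_nonzero[OF assms(1)] q unfolding i by (simp add: abs_mult mult.commute)
    also have "\<dots> \<longleftrightarrow> i \<ge> 1" by (rule power_decreasing_q)
    also have "\<dots> \<longleftrightarrow> q ^ i \<noteq> 1"
      using power_strict_decreasing_q[of i 0] by (cases i) auto
    also have "\<dots> \<longleftrightarrow> x \<noteq> b" using lattice_nonzero[OF assms(1)] unfolding i by auto
    finally show ?thesis using qx by simp
  qed
  show ?thesis
  proof (cases m)
    case 0
    then show ?thesis using True inq by (auto simp: delta_chain_def)
  next
    case (Suc n)
    let ?P = "\<Prod>k=1..<m. x - b * q ^ k"
    have a: "delta_chain b (Suc m) x = b * (?P * (x - b * q ^ m)) / qfact m"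
      using True Suc by (simp add: delta_chain_def)
    have "(\<Prod>k=1..<Suc m. q * x - b * q ^ k) = (\<Prod>k<m. q * x - b * q ^ Suc k)"
      using prod.atLeast_Suc_lessThan_Suc_shift[of "\<lambda>k. q * x - b * q ^ k" 0 m]
      by (simp add: atLeast0LessThan)
    also have "\<dots> = (\<Prod>k<m. q * (x - b * q ^ k))" by (simp add: algebra_simps)
    also have "\<dots> = q ^ m * (\<Prod>k<m. x - b * q ^ k)" by (simp add: prod.distrib)
    also have "(\<Prod>k<m. x - b * q ^ k) = (x - b) * ?P"
      using Suc by (simp add: atLeast0LessThan[symmetric] prod.atLeast_Suc_lessThan)
    finally have b: "delta_chain b (Suc m) (q * x) = b * (q ^ m * ((x - b) * ?P)) / qfact m"
      using inq by (auto simp: delta_chain_def)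
    have c: "delta_chain b m x = b * ?P / qfact n" using True Suc by (simp add: delta_chain_def)
    have f: "qfact m = qfact n * (1 - q ^ m)" using Suc by (simp add: qfact_Suc)
    have nz: "1 - q ^ m \<noteq> 0" "qfact n \<noteq> 0" using one_minus_power_q(1)[of m] Suc qfact_pos by auto
    have "delta_chain b (Suc m) x - delta_chain b (Suc m) (q * x) = b * ?P * x * (1 - q ^ m) / qfact m"
      unfolding a b by (simp add: diff_divide_distrib[symmetric] algebra_simps)
    then show ?thesis unfolding c f using nz by simp
  qed
qed

lemma qprimitive_delta_chain:
  assumes "b \<in> lattice"
  shows "qprimitive (\<lambda>x. of_real (delta_chain b m x)) (\<lambda>x. of_real (delta_chain b (Suc m) x))"
proof (rule qprimitiveI)
  have lim: "(\<lambda>n. complex_of_real (delta_chain b m (x * q ^ n))) \<longlonglongrightarrow> 0" for m x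
  proof (rule tendsto_eventually)
    have "(\<lambda>n. \<bar>x * q ^ n\<bar>) \<longlonglongrightarrow> \<bar>0\<bar>" by (intro tendsto_rabs tendsto_orbit)
    then have "\<forall>\<^sub>F n in sequentially. \<bar>x * q ^ n\<bar> < \<bar>b\<bar>"
      using lattice_nonzero[OF assms] by (intro order_tendstoD(2)) auto
    then show "\<forall>\<^sub>F n in sequentially. complex_of_real (delta_chain b m (x * q ^ n)) = 0"
      by eventually_elim (use lattice_nonzero[OF assms] in \<open>auto intro!: delta_chain_outside\<close>)
  qed
  fix x assume "x \<in> lattice"
  from delta_chain_step[OF this assms]
  show "complex_of_real (delta_chain b (Suc m) x) - of_real (delta_chain b (Suc m) (q * x)) = of_real x * of_real (delta_chain b m x)"
    by (metis of_real_diff of_real_mult)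
  show "(\<lambda>n. complex_of_real (delta_chain b (Suc m) (x * q ^ n))) \<longlonglongrightarrow> 0"
    "(\<lambda>n. complex_of_real (delta_chain b m (x * q ^ n))) \<longlonglongrightarrow> 0" by (rule lim)+
qed

text \<open>With point masses at the elements of \<open>B\<close>, a configuration of the same size that is different from
  \<open>B\<close> misses an element of \<open>B\<close> and produces a zero column.\<close>

lemma alternant_ratio_delta:
  assumes b: "bij_betw b {..<K} B" and Y: "finite Y" "card Y = K"
  shows "alternant_ratio (\<lambda>j x. of_real (delta_chain (b j) 0 x)) Y =
           (if Y = B then 1 / alternant K monomial b else 0)"
proof (cases "Y = B")
  case True
  have "b i \<noteq> b j" if "i < j" "j < K" for i j
    using bij_betw_imp_inj_on[OF b] that by (auto simp: inj_on_def)
  then have "alternant K (\<lambda>j x. of_real (delta_chain (b j) 0 x)) b = 1"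
    unfolding alternant_def by (subst detf_lower_triangular) (auto simp: delta_chain_def)
  then show ?thesis using True alternant_ratio_enumeration[OF b] by metis
next
  case False
  have B: "finite B" "card B = K" using bij_betw_finite[OF b] bij_betw_same_card[OF b] by auto
  have "\<not> B \<subseteq> Y" using card_subset_eq[OF Y(1)] B Y False by auto
  then obtain x where x: "x \<in> B" "x \<notin> Y" by auto
  then obtain j where j: "j < K" "b j \<notin> Y" using b by (auto simp: bij_betw_def)
  have "alternant K (\<lambda>j x. of_real (delta_chain (b j) 0 x)) (elt Y) = 0"
    unfolding alternant_def
  proof (rule detf_zero_column[OF j(1)])
    fix i assume "i < K"
    then have "elt Y i \<in> Y" using elt_mem[OF Y(1)] Y(2) by simp
    then have "elt Y i \<noteq> b j" using j by auto
    then show "complex_of_real (delta_chain (b j) 0 (elt Y i)) = 0" by (simp add: delta_chain_def)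
  qed
  then show ?thesis using False Y by (simp add: alternant_ratio_def)
qed

text \<open>Every single entry of a link is thus a determinant of size \<open>K\<close>. Its coefficients are finite sums
  over those elements of \<open>X\<close> that are at least as far from \<open>0\<close> as an element of \<open>B\<close>, which is why they
  behave well when only the part of \<open>X\<close> near \<open>0\<close> varies.\<close>

lemma link_entry:
  assumes B: "B \<in> configs' K" and b: "bij_betw b {..<K} B" and X: "X \<in> configs' (K + m)"
    and ts: "distinct ts" "length ts = K" "set ts \<subseteq> X"
  shows "of_real (link (K + m) K X B) = alternant K monomial b * of_real (link_const K m) *
     detf K (\<lambda>i j. divdiff (X - set (drop (Suc i) ts)) (\<lambda>x. of_real (delta_chain (b j) m x)))"
proof -
  define \<psi> :: "nat \<Rightarrow> nat \<Rightarrow> real \<Rightarrow> complex" where "\<psi> = (\<lambda>j i x. of_real (delta_chain (b j) i x))"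
  let ?V = "alternant K monomial b"
  let ?D = "of_real (link_const K m) * detf K (\<lambda>i j. divdiff (X - set (drop (Suc i) ts)) (\<psi> j m))"
  have h: "alternant_ratio (\<lambda>j. \<psi> j 0) Y = (if Y = B then 1 / ?V else 0)" if "Y \<in> configs' K" for Y
    using alternant_ratio_delta[OF b configs_memD(2,3)[OF that]] by (simp add: \<psi>_def)
  have bL: "b j \<in> lattice" if "j < K" for j
    using b configs_memD(1)[OF B] that by (auto simp: bij_betw_def)
  have "((\<lambda>Y. of_real (link (K + m) K X Y) * alternant_ratio (\<lambda>j. \<psi> j 0) Y) has_sum ?D) (configs' K)"
    by (rule link_divdiff[OF X ts, where C = "norm (1 / ?V)"])
       (use bL qprimitive_delta_chain h in \<open>auto simp: \<psi>_def\<close>)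
  moreover have "((\<lambda>Y. of_real (link (K + m) K X Y) * alternant_ratio (\<lambda>j. \<psi> j 0) Y) has_sum
      of_real (link (K + m) K X B) / ?V) (configs' K)"
    by (rule has_sum_finite_neutralI[of "{B}"]) (use B h in auto)
  ultimately have "of_real (link (K + m) K X B) / ?V = ?D" by (rule has_sum_unique[rotated])
  moreover have "?V \<noteq> 0" by (rule alternant_newton(3)[OF bij_betw_imp_inj_on[OF b]])
  ultimately show ?thesis by (simp add: field_simps \<psi>_def)
qed

section \<open>Products over configurations\<close>

lemma sum_same_sign:
  assumes "finite S" "S \<subseteq> lattice" "\<And>x y. x \<in> S \<Longrightarrow> y \<in> S \<Longrightarrow> x * y > 0" "\<And>x. x \<in> S \<Longrightarrow> \<bar>x\<bar> \<le> r" "0 \<le> r"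
  shows "(\<Sum>x\<in>S. \<bar>x\<bar>) \<le> r / (1 - q)"
proof (cases "S = {}")
  case True
  then show ?thesis using assms(5) q by simp
next
  case False
  have "Max (abs ` S) \<in> abs ` S" using assms(1) False by (intro Max_in) auto
  then obtain M where M: "M \<in> S" "\<bar>M\<bar> = Max (abs ` S)" by auto
  have "\<exists>i. x = M * q ^ i" if "x \<in> S" for x
  proof -
    have "\<bar>x\<bar> \<le> \<bar>M\<bar>" using that assms(1) unfolding M(2) by (intro Max_ge) auto
    then show ?thesis using lattice_same_sign[of M x] assms(2,3) M(1) that by blast
  qed
  then obtain e where e: "\<And>x. x \<in> S \<Longrightarrow> x = M * q ^ e x" by metis
  have inj: "inj_on e S" using e by (metis inj_onI)
  have "(\<Sum>x\<in>S. \<bar>x\<bar>) = (\<Sum>x\<in>S. \<bar>M\<bar> * q ^ e x)"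
    using q by (intro sum.cong refl) (subst e, auto simp: abs_mult)
  also have "\<dots> = \<bar>M\<bar> * (\<Sum>i\<in>e ` S. q ^ i)"
    by (simp add: sum.reindex[OF inj] sum_distrib_left)
  also have "\<dots> \<le> r * (1 / (1 - q))"
  proof (intro mult_mono)
    have "(\<Sum>i\<in>e ` S. q ^ i) \<le> (\<Sum>i. q ^ i)"
      using q assms(1) by (intro sum_le_suminf summable_geometric) auto
    then show "(\<Sum>i\<in>e ` S. q ^ i) \<le> 1 / (1 - q)" using q by (simp add: suminf_geometric)
    show "\<bar>M\<bar> \<le> r" using assms(4)[OF M(1)] .
  qed (use assms(5) q in \<open>auto intro!: sum_nonneg\<close>)
  finally show ?thesis by simp
qed

text \<open>Two geometric series, one for each sign.\<close>

lemma lattice_sum_bound: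
  assumes "finite S" "S \<subseteq> lattice" "\<And>x. x \<in> S \<Longrightarrow> \<bar>x\<bar> \<le> r" "0 \<le> r"
  shows "(\<Sum>x\<in>S. \<bar>x\<bar>) \<le> 2 * r / (1 - q)"
proof -
  have S: "S = {x \<in> S. x > 0} \<union> {x \<in> S. x < 0}"
    using assms(2) lattice_nonzero by (force simp: not_less)
  have "(\<Sum>x\<in>S. \<bar>x\<bar>) = (\<Sum>x\<in>{x \<in> S. x > 0}. \<bar>x\<bar>) + (\<Sum>x\<in>{x \<in> S. x < 0}. \<bar>x\<bar>)"
    by (subst S, rule sum.union_disjoint) (use assms(1) in auto)
  also have "\<dots> \<le> r / (1 - q) + r / (1 - q)"
  proof (intro add_mono sum_same_sign)
    show "\<bar>x\<bar> \<le> r" if "x \<in> {x \<in> S. x > 0}" for x using assms(3) that by blast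
    show "\<bar>x\<bar> \<le> r" if "x \<in> {x \<in> S. x < 0}" for x using assms(3) that by blast
  qed (use assms(1,2,4) in \<open>auto intro: mult_neg_neg\<close>)
  finally show ?thesis by simp
qed

text \<open>A corollary of the bound on sums: every finite subset has a bounded number of elements.\<close>

lemma finite_annulus:
  assumes "0 < \<delta>"
  shows "finite {x \<in> lattice. \<delta> \<le> \<bar>x\<bar> \<and> \<bar>x\<bar> \<le> R}"
proof (rule conjunct1[OF finite_if_finite_subsets_card_bdd[where C = "nat \<lceil>2 * max R 0 / (1 - q) / \<delta>\<rceil>"]])
  fix S assume S: "S \<subseteq> {x \<in> lattice. \<delta> \<le> \<bar>x\<bar> \<and> \<bar>x\<bar> \<le> R}" "finite S"
  have "real (card S) * \<delta> = (\<Sum>x\<in>S. \<delta>)" by simp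
  also have "\<dots> \<le> (\<Sum>x\<in>S. \<bar>x\<bar>)" using S by (intro sum_mono) auto
  also have "\<dots> \<le> 2 * max R 0 / (1 - q)" using S by (intro lattice_sum_bound) auto
  finally have "real (card S) \<le> 2 * max R 0 / (1 - q) / \<delta>" using assms by (simp only: pos_le_divide_eq)
  then show "card S \<le> nat \<lceil>2 * max R 0 / (1 - q) / \<delta>\<rceil>" by linarith
qed

lemma small_prod_bound:
  assumes "finite S" "S \<subseteq> lattice" "\<And>x. x \<in> S \<Longrightarrow> \<bar>x\<bar> \<le> r" "0 \<le> r"
  shows "\<bar>(\<Prod>x\<in>S. 1 - x / a) - 1\<bar> \<le> exp (2 * r / (1 - q) / \<bar>a\<bar>) - 1"
    and "\<bar>\<Prod>x\<in>S. 1 - x / a\<bar> \<le> exp (2 * r / (1 - q) / \<bar>a\<bar>)"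
proof -
  have "(\<Sum>x\<in>S. norm (- (x / a))) = (\<Sum>x\<in>S. \<bar>x\<bar>) / \<bar>a\<bar>"
    by (simp add: sum_divide_distrib)
  also have "\<dots> \<le> 2 * r / (1 - q) / \<bar>a\<bar>" by (intro divide_right_mono lattice_sum_bound assms) auto
  finally have *: "exp (\<Sum>x\<in>S. norm (- (x / a))) \<le> exp (2 * r / (1 - q) / \<bar>a\<bar>)"
    by (simp only: exp_le_cancel_iff)
  have eq: "(\<Prod>x\<in>S. 1 - x / a) = (\<Prod>x\<in>S. 1 + - (x / a))" by simp
  show "\<bar>(\<Prod>x\<in>S. 1 - x / a) - 1\<bar> \<le> exp (2 * r / (1 - q) / \<bar>a\<bar>) - 1"
    using prod_minus_one_bound(1)[OF assms(1), of "\<lambda>x. - (x / a)"] * unfolding eq real_norm_def by linarith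
  show "\<bar>\<Prod>x\<in>S. 1 - x / a\<bar> \<le> exp (2 * r / (1 - q) / \<bar>a\<bar>)"
    using prod_minus_one_bound(2)[OF assms(1), of "\<lambda>x. - (x / a)"] * unfolding eq real_norm_def by linarith
qed

lemma small_exp_radius:
  assumes "0 < \<epsilon>"
  obtains \<delta> :: real where "0 < \<delta>" "exp (2 * \<delta> / (1 - q) / c) - 1 < \<epsilon>"
proof -
  have "((\<lambda>\<delta>. exp (2 * \<delta> / (1 - q) / c) - 1) \<longlongrightarrow> exp (2 * 0 / (1 - q) / c) - 1) (at_right 0)"
    unfolding divide_inverse by (intro tendsto_intros)
  then have "\<forall>\<^sub>F \<delta> in at_right 0. exp (2 * \<delta> / (1 - q) / c) - 1 < \<epsilon>"
    by (rule order_tendstoD(2)) (use assms in simp)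
  then obtain b where "b > 0" "\<And>y. 0 < y \<Longrightarrow> y < b \<Longrightarrow> exp (2 * y / (1 - q) / c) - 1 < \<epsilon>"
    unfolding eventually_at_right_field by auto
  moreover from this have "0 < b / 2" "b / 2 < b" by auto
  ultimately have "0 < b / 2" "exp (2 * (b / 2) / (1 - q) / c) - 1 < \<epsilon>" by blast+
  then show ?thesis by (rule that)
qed

text \<open>The factors with \<open>\<bar>x\<bar> \<ge> \<delta>\<close> are eventually constant, and the remaining ones change the product by a
  factor that is close to \<open>1\<close> uniformly in \<open>N\<close>. So the products form a Cauchy sequence, and the limit
  inherits from the constant part that it does not vanish.\<close>

lemma outer_prod_converges:
  assumes Xs: "\<forall>\<^sub>F N in sequentially. finite (Xs N) \<and> Xs N \<subseteq> lattice"
    and X: "X \<subseteq> lattice" "bounded X" and conv: "outer_converges Xs X"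
    and a: "a \<notin> X" "a \<noteq> 0"
  obtains l where "l \<noteq> 0" "(\<lambda>N. \<Prod>x\<in>Xs N. 1 - x / a) \<longlonglongrightarrow> l"
proof -
  let ?P = "\<lambda>N. \<Prod>x\<in>Xs N. 1 - x / a"
  let ?O = "\<lambda>\<delta>. \<Prod>x\<in>{x \<in> X. \<delta> \<le> \<bar>x\<bar>}. 1 - x / a"
  let ?I = "\<lambda>\<delta> N. \<Prod>x\<in>{x \<in> Xs N. \<bar>x\<bar> < \<delta>}. 1 - x / a"
  obtain R where R: "R > 0" "\<forall>\<^sub>F N in sequentially. \<forall>x\<in>Xs N. \<bar>x\<bar> \<le> R"
    using outer_converges_bounded[OF conv X(2)] .
  define E where "E = exp (2 * R / (1 - q) / \<bar>a\<bar>)"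
  have E: "E > 0" by (simp add: E_def)
  have split: "\<forall>\<^sub>F N in sequentially. ?P N = ?O \<delta> * ?I \<delta> N \<and> \<bar>?O \<delta>\<bar> \<le> E \<and>
      \<bar>?I \<delta> N - 1\<bar> \<le> exp (2 * \<delta> / (1 - q) / \<bar>a\<bar>) - 1" if \<delta>: "\<delta> > 0" for \<delta>
  proof -
    have "\<forall>\<^sub>F N in sequentially. {x \<in> Xs N. \<delta> \<le> \<bar>x\<bar>} = {x \<in> X. \<delta> \<le> \<bar>x\<bar>}"
      using conv \<delta> unfolding outer_converges_def by blast
    with Xs R(2) show ?thesis
    proof eventually_elim
      case (elim N)
      have e: "{x \<in> X. \<delta> \<le> \<bar>x\<bar>} \<union> {x \<in> Xs N. \<bar>x\<bar> < \<delta>} = Xs N"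
        unfolding elim(3)[symmetric] by auto
      have "finite {x \<in> X. \<delta> \<le> \<bar>x\<bar>}" unfolding elim(3)[symmetric] using elim(1) by simp
      then have "(\<Prod>x\<in>{x \<in> X. \<delta> \<le> \<bar>x\<bar>} \<union> {x \<in> Xs N. \<bar>x\<bar> < \<delta>}. 1 - x / a) = ?O \<delta> * ?I \<delta> N"
        by (intro prod.union_disjoint) (use elim(1) in auto)
      then have "?P N = ?O \<delta> * ?I \<delta> N" unfolding e .
      moreover have "\<bar>?O \<delta>\<bar> \<le> E" unfolding E_def elim(3)[symmetric]
        using elim(1,2) R(1) by (intro small_prod_bound) auto
      moreover have "\<bar>?I \<delta> N - 1\<bar> \<le> exp (2 * \<delta> / (1 - q) / \<bar>a\<bar>) - 1"
        using elim(1) \<delta> by (intro small_prod_bound) auto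
      ultimately show ?case by blast
    qed
  qed
  have "Cauchy ?P"
  proof (rule metric_CauchyI)
    fix \<epsilon> :: real assume \<epsilon>: "\<epsilon> > 0"
    then have "\<epsilon> / (2 * E) > 0" using E by simp
    then obtain \<delta> where \<delta>: "\<delta> > 0" "exp (2 * \<delta> / (1 - q) / \<bar>a\<bar>) - 1 < \<epsilon> / (2 * E)"
      using small_exp_radius by blast
    obtain M where M: "\<And>N. N \<ge> M \<Longrightarrow> ?P N = ?O \<delta> * ?I \<delta> N \<and> \<bar>?O \<delta>\<bar> \<le> E \<and>
      \<bar>?I \<delta> N - 1\<bar> \<le> exp (2 * \<delta> / (1 - q) / \<bar>a\<bar>) - 1"
      using split[OF \<delta>(1)] unfolding eventually_sequentially by blast
    show "\<exists>M. \<forall>m\<ge>M. \<forall>n\<ge>M. dist (?P m) (?P n) < \<epsilon>"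
    proof (intro exI[of _ M] allI impI)
      fix m n assume mn: "M \<le> m" "M \<le> n"
      have "\<bar>?I \<delta> m - ?I \<delta> n\<bar> < \<epsilon> / E"
      proof -
        have "\<bar>?I \<delta> m - ?I \<delta> n\<bar> \<le> \<bar>?I \<delta> m - 1\<bar> + \<bar>?I \<delta> n - 1\<bar>" by linarith
        also have "\<dots> < \<epsilon> / (2 * E) + \<epsilon> / (2 * E)" using M[OF mn(1)] M[OF mn(2)] \<delta>(2) by linarith
        finally show ?thesis by simp
      qed
      then have "E * \<bar>?I \<delta> m - ?I \<delta> n\<bar> < \<epsilon>" using E by (simp add: field_simps)
      moreover have "\<bar>?P m - ?P n\<bar> = \<bar>?O \<delta>\<bar> * \<bar>?I \<delta> m - ?I \<delta> n\<bar>"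
        using M[OF mn(1)] M[OF mn(2)] by (simp add: abs_mult right_diff_distrib[symmetric])
      moreover have "\<bar>?O \<delta>\<bar> * \<bar>?I \<delta> m - ?I \<delta> n\<bar> \<le> E * \<bar>?I \<delta> m - ?I \<delta> n\<bar>"
        using M[OF mn(1)] by (intro mult_right_mono) auto
      ultimately show "dist (?P m) (?P n) < \<epsilon>" by (simp add: dist_real_def)
    qed
  qed
  then obtain l where l: "?P \<longlonglongrightarrow> l" using Cauchy_convergent_iff convergent_def by blast
  obtain \<delta> where \<delta>: "\<delta> > 0" "exp (2 * \<delta> / (1 - q) / \<bar>a\<bar>) - 1 < 1 / 2"
    using small_exp_radius[of "1 / 2" "\<bar>a\<bar>"] by auto
  have O: "?O \<delta> \<noteq> 0"
  proof -
    have "finite {x \<in> X. \<delta> \<le> \<bar>x\<bar>}"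
    proof -
      obtain B where "\<And>x. x \<in> X \<Longrightarrow> \<bar>x\<bar> \<le> B" using X(2) by (auto simp: bounded_iff)
      then show ?thesis
        by (intro finite_subset[OF _ finite_annulus[OF \<delta>(1), of B]]) (use X(1) in auto)
    qed
    then show ?thesis using a by auto
  qed
  have "\<forall>\<^sub>F N in sequentially. \<bar>?O \<delta>\<bar> / 2 \<le> \<bar>?P N\<bar>"
    using split[OF \<delta>(1)]
  proof eventually_elim
    case (elim N)
    then have "1 / 2 \<le> \<bar>?I \<delta> N\<bar>" using \<delta>(2) by linarith
    then have "\<bar>?O \<delta>\<bar> * (1 / 2) \<le> \<bar>?O \<delta>\<bar> * \<bar>?I \<delta> N\<bar>" by (intro mult_left_mono) auto
    then show ?case using elim by (simp add: abs_mult)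
  qed
  then have "\<bar>?O \<delta>\<bar> / 2 \<le> \<bar>l\<bar>"
    by (intro tendsto_lowerbound[OF tendsto_rabs[OF l]]) auto
  then have "l \<noteq> 0" using O by auto
  then show ?thesis using l that by blast
qed

section \<open>Convergence of the entries\<close>

lemma qfact_antimono: "decseq qfact"
  by (rule decseq_SucI) (use qfact_pos(1) one_minus_power_q(2) in \<open>auto simp: qfact_Suc mult_left_le simp del: power_Suc\<close>)

text \<open>The bound comes from \<open>1 / (1 - x) \<le> exp (x / (1 - x))\<close> and a geometric series.\<close>

lemma qfact_lower_bound:
  obtains c where "c > 0" "c \<le> 1" "\<And>n. c \<le> qfact n"
proof -
  let ?c = "exp (- (1 / (1 - q) ^ 2))"
  have "?c \<le> qfact n" for n
  proof -
    have 1: "exp (- (q ^ k / (1 - q))) \<le> 1 - q ^ k" if "k \<in> {1..n}" for k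
    proof -
      have k: "q ^ k \<le> q" "0 < 1 - q ^ k" using that q power_decreasing_q[of k 1] one_minus_power_q(1)[of k] by auto
      have "1 / (1 - q ^ k) = 1 + q ^ k / (1 - q ^ k)" using k by (simp add: field_simps)
      also have "\<dots> \<le> 1 + q ^ k / (1 - q)" using k q by (intro add_left_mono divide_left_mono) auto
      also have "\<dots> \<le> exp (q ^ k / (1 - q))" by simp
      finally show ?thesis using k by (simp add: exp_minus field_simps)
    qed
    have "(\<Sum>k=1..n. q ^ k) \<le> (\<Sum>k. q ^ k)" using q by (intro sum_le_suminf summable_geometric) auto
    also have "\<dots> = 1 / (1 - q)" using q by (simp add: suminf_geometric)
    finally have g: "(\<Sum>k=1..n. q ^ k) \<le> 1 / (1 - q)" .
    have "(\<Sum>k=1..n. q ^ k / (1 - q)) \<le> 1 / (1 - q) ^ 2"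
    proof -
      from g have "(\<Sum>k=1..n. q ^ k) / (1 - q) \<le> 1 / (1 - q) / (1 - q)"
        using q by (intro divide_right_mono) auto
      then show ?thesis by (simp add: sum_divide_distrib power2_eq_square)
    qed
    then have "?c \<le> exp (\<Sum>k=1..n. - (q ^ k / (1 - q)))" by (simp add: sum_negf)
    also have "\<dots> = (\<Prod>k=1..n. exp (- (q ^ k / (1 - q))))" by (simp add: exp_sum)
    also have "\<dots> \<le> qfact n" unfolding qfact_def by (intro prod_mono) (use 1 in auto)
    finally show ?thesis .
  qed
  then show ?thesis by (intro that[of ?c]) auto
qed

lemma qfact_limit: obtains l where "l \<noteq> 0" "qfact \<longlonglongrightarrow> l"
proof -
  obtain c where c: "c > 0" "\<And>n. c \<le> qfact n" using qfact_lower_bound by blast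
  obtain l where "qfact \<longlonglongrightarrow> l" "c \<le> l" using decseq_limit[OF qfact_antimono c(2)] .
  moreover from this c(1) have "l \<noteq> 0" by linarith
  ultimately show ?thesis using that by blast
qed

lemma link_const_Suc: "link_const K (Suc m) = link_const K m * (qfact (K + m) / qfact m)"
  by (simp add: link_const_def)

lemma link_const_pos: "link_const K m > 0"
  unfolding link_const_def by (intro prod_pos) (use qfact_pos in auto)

text \<open>Passing from \<open>K\<close> to \<open>K + 1\<close> multiplies the constant by a quotient that is at least some \<open>qfact n\<close>.\<close>

lemma link_const_lower_bound: obtains c where "c > 0" "\<And>m. c \<le> link_const K m"
proof -
  obtain c where c: "c > 0" "c \<le> 1" "\<And>n. c \<le> qfact n" using qfact_lower_bound by blast
  have "c ^ K \<le> link_const K m" for m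
  proof (induction K)
    case 0
    have "link_const 0 m = 1" unfolding link_const_def by (intro prod.neutral) (use qfact_pos in auto)
    then show ?case by simp
  next
    case (Suc K)
    have shift: "(\<Prod>i<m. 1 - q ^ Suc (K + i)) = qfact (K + m) / qfact K"
      by (induction m) (use qfact_pos(2) in \<open>auto simp: qfact_Suc simp del: power_Suc\<close>)
    have "link_const (Suc K) m = link_const K m * (\<Prod>i<m. 1 - q ^ Suc (K + i))"
      unfolding link_const_def prod.distrib[symmetric]
      by (intro prod.cong) (auto simp: qfact_Suc simp del: power_Suc)
    also have "\<dots> \<ge> c ^ K * c"
    proof (intro mult_mono Suc)
      have "qfact (K + m) \<le> qfact (K + m) / qfact K"
        using qfact_pos[of K] qfact_pos[of "K + m"] qfact_le_1[of K] by (simp add: field_simps)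
      then show "c \<le> (\<Prod>i<m. 1 - q ^ Suc (K + i))" using c(3)[of "K + m"] unfolding shift by linarith
    qed (use c link_const_pos[of K m] in auto)
    finally show ?case by (simp add: mult.commute)
  qed
  then show ?thesis using that[of "c ^ K"] c(1) by simp
qed

lemma link_const_limit: obtains l where "link_const K \<longlonglongrightarrow> l"
proof -
  have "decseq (link_const K)"
  proof (rule decseq_SucI)
    fix m
    have "qfact (K + m) \<le> qfact m" using qfact_antimono by (simp add: decseq_def)
    then have "qfact (K + m) / qfact m \<le> 1" using qfact_pos[of m] by (simp add: field_simps)
    then show "link_const K (Suc m) \<le> link_const K m"
      unfolding link_const_Suc using link_const_pos[of K m] by (intro mult_left_le) auto
  qed
  then show ?thesis using decseq_limit[of "link_const K" 0] link_const_pos that by (metis less_imp_le)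
qed

text \<open>All powers of \<open>a\<close> except \<open>a\<^sup>-\<^sup>i\<^sup>-\<^sup>1\<close> cancel, and what remains are products that converge as \<open>m\<close> grows.\<close>

lemma delta_chain_term:
  assumes "0 < a * b" "\<bar>b\<bar> \<le> \<bar>a\<bar>" "0 < m" "finite S" "a \<in> S" "card S = m + i + 1"
  shows "delta_chain b m a / (\<Prod>x\<in>S - {a}. a - x) =
     b / a ^ Suc i * (\<Prod>k=1..<m. 1 - b / a * q ^ k) / qfact (m - 1) / (\<Prod>x\<in>S - {a}. 1 - x / a)"
proof -
  have a: "a \<noteq> 0" using assms(1) by auto
  have 1: "(\<Prod>k=1..<m. a - b * q ^ k) = a ^ (m - 1) * (\<Prod>k=1..<m. 1 - b / a * q ^ k)"
  proof -
    have "(\<Prod>k=1..<m. a - b * q ^ k) = (\<Prod>k=1..<m. a * (1 - b / a * q ^ k))"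
      using a by (intro prod.cong) (auto simp: field_simps)
    then show ?thesis by (simp add: prod.distrib)
  qed
  have 2: "(\<Prod>x\<in>S - {a}. a - x) = a ^ (m + i) * (\<Prod>x\<in>S - {a}. 1 - x / a)"
  proof -
    have "(\<Prod>x\<in>S - {a}. a - x) = (\<Prod>x\<in>S - {a}. a * (1 - x / a))"
      using a by (intro prod.cong) (auto simp: field_simps)
    then show ?thesis using assms(4-6) by (simp add: prod.distrib)
  qed
  have 3: "a ^ (m + i) = a ^ (m - 1) * a ^ Suc i" using assms(3) by (simp only: power_add[symmetric]) (simp add: add_ac)
  have d: "delta_chain b m a = b * (\<Prod>k=1..<m. a - b * q ^ k) / qfact (m - 1)"
    using assms(1-3) by (simp add: delta_chain_def)
  have "a ^ (m - 1) \<noteq> 0" using a by simp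
  moreover have "b * (u * P) / f / (u * w * Q) = b / w * P / f / Q" if "u \<noteq> 0" for u P f w Q :: real
    using that by (cases "w = 0"; cases "Q = 0"; cases "f = 0") (simp_all add: field_simps)
  ultimately show ?thesis unfolding d 1 2 3 by blast
qed

lemma lattice_zero_notin: "0 \<notin> lattice"
  using lattice_nonzero by blast

text \<open>The elements \<open>a\<close> of \<open>Xs N\<close> that contribute are eventually those of \<open>X\<close>, a fixed finite set; each of their
  terms converges by \<open>delta_chain_term\<close> and \<open>outer_prod_converges\<close>.\<close>

lemma entry_converges:
  assumes X: "X \<subseteq> lattice" "bounded X" and conv: "outer_converges Xs X"
    and Xs: "\<And>N. 1 \<le> N \<Longrightarrow> Xs N \<in> configs' N"
    and D: "finite D" "D \<subseteq> X" "card D + Suc i = K" and b: "b \<in> lattice"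
  obtains l where "(\<lambda>N. divdiff (Xs N - D) (\<lambda>x. of_real (delta_chain b (N - K) x))) \<longlonglongrightarrow> l"
proof -
  define A where "A = {a \<in> X - D. 0 < a * b \<and> \<bar>b\<bar> \<le> \<bar>a\<bar>}"
  have b0: "\<bar>b\<bar> > 0" "b \<noteq> 0" using lattice_nonzero[OF b] by auto
  have finA: "finite A"
  proof -
    obtain B where "\<And>x. x \<in> X \<Longrightarrow> \<bar>x\<bar> \<le> B" using X(2) by (auto simp: bounded_iff)
    then show ?thesis unfolding A_def
      by (intro finite_subset[OF _ finite_annulus[OF b0(1), of B]]) (use X(1) in auto)
  qed
  \<comment> \<open>the terms of \<open>delta_chain_term\<close> for \<open>m = N - K\<close>, which is positive as soon as \<open>N > K\<close>\<close>
  let ?t = "\<lambda>N a. b / a ^ Suc i * (\<Prod>k=1..<Suc (N - Suc K). 1 - b / a * q ^ k) / qfact (N - Suc K) / (\<Prod>x\<in>Xs N - D - {a}. 1 - x / a)"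
  have fin: "\<forall>\<^sub>F N in sequentially. finite (Xs N) \<and> Xs N \<subseteq> lattice"
    using eventually_ge_at_top[of 1] by eventually_elim (use Xs configs_memD in blast)
  have conv_t: "\<exists>l. (\<lambda>N. ?t N a) \<longlonglongrightarrow> l" if a: "a \<in> A" for a
  proof -
    have a': "a \<in> X" "a \<notin> D" "0 < a * b" "\<bar>b\<bar> \<le> \<bar>a\<bar>" using a by (auto simp: A_def)
    have a0: "a \<noteq> 0" using a' by auto
    have ba: "0 < b / a" "b / a \<le> 1"
    proof -
      show "0 < b / a" using a'(3) by (auto simp: zero_less_mult_iff zero_less_divide_iff)
      then have "b / a = \<bar>b\<bar> / \<bar>a\<bar>"
        using abs_of_pos[of "b / a"] abs_divide[of b a] by linarith
      also have "\<dots> \<le> 1" using a'(4) a0 by simp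
      finally show "b / a \<le> 1" .
    qed
    let ?g = "\<lambda>n. \<Prod>k=1..<Suc n. 1 - b / a * q ^ k"
    have f: "0 \<le> 1 - b / a * q ^ k" "1 - b / a * q ^ k \<le> 1" for k
    proof -
      have "b / a * q ^ k \<le> 1 * 1" using ba q by (intro mult_mono) (auto intro: power_le_one)
      then show "0 \<le> 1 - b / a * q ^ k" by simp
      have "0 \<le> b / a * q ^ k" by (intro mult_nonneg_nonneg) (use ba q in auto)
      then show "1 - b / a * q ^ k \<le> 1" by linarith
    qed
    have nn: "0 \<le> ?g n" for n by (intro prod_nonneg) (use f in auto)
    have "decseq ?g"
    proof (rule decseq_SucI)
      fix n
      have "?g (Suc n) = ?g n * (1 - b / a * q ^ Suc n)" by (simp only: prod.atLeastLessThan_Suc)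
      also have "\<dots> \<le> ?g n" by (rule mult_left_le[OF f(2) nn])
      finally show "?g (Suc n) \<le> ?g n" .
    qed
    then obtain g where g: "?g \<longlonglongrightarrow> g" using nn decseq_limit[of ?g 0] by blast
    obtain f where f: "f \<noteq> 0" "qfact \<longlonglongrightarrow> f" by (rule qfact_limit)
    have fin': "\<forall>\<^sub>F N in sequentially. finite (Xs N - insert a D) \<and> Xs N - insert a D \<subseteq> lattice"
      using fin by eventually_elim auto
    have "bounded (X - insert a D)" using X(2) by (rule bounded_subset) auto
    then obtain p where p: "p \<noteq> 0" "(\<lambda>N. \<Prod>x\<in>Xs N - insert a D. 1 - x / a) \<longlonglongrightarrow> p"
      using outer_prod_converges[OF fin' _ _ outer_converges_Diff[OF conv], of a] X(1) a0 by blast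
    have "(\<lambda>N. ?t N a) \<longlonglongrightarrow> b / a ^ Suc i * g / f / p"
    proof (intro tendsto_intros tendsto_shift[OF g] tendsto_shift[OF f(2)])
      have "Xs N - D - {a} = Xs N - insert a D" for N by auto
      then show "(\<lambda>N. \<Prod>x\<in>Xs N - D - {a}. 1 - x / a) \<longlonglongrightarrow> p" using p(2) by simp
    qed (use f(1) p(1) in auto)
    then show ?thesis by blast
  qed
  define l where "l = (\<lambda>a. lim (\<lambda>N. ?t N a))"
  have l: "(\<lambda>N. ?t N a) \<longlonglongrightarrow> l a" if "a \<in> A" for a
    unfolding l_def by (rule convergent_LIMSEQ_iff[THEN iffD1], unfold convergent_def, rule conv_t[OF that])
  have sub: "\<forall>\<^sub>F N in sequentially. D \<subseteq> Xs N"
    by (rule outer_converges_finite_subset[OF conv D(1,2)]) (use X(1) lattice_zero_notin in blast)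
  have "\<forall>\<^sub>F N in sequentially. {x \<in> Xs N. \<bar>b\<bar> \<le> \<bar>x\<bar>} = {x \<in> X. \<bar>b\<bar> \<le> \<bar>x\<bar>}"
    using conv b0(1) unfolding outer_converges_def by blast
  with sub eventually_ge_at_top[of "Suc K"]
  have ev: "\<forall>\<^sub>F N in sequentially. of_real (\<Sum>a\<in>A. ?t N a) = divdiff (Xs N - D) (\<lambda>x. of_real (delta_chain b (N - K) x))"
  proof eventually_elim
    case (elim N)
    have XN: "finite (Xs N)" "card (Xs N) = N" using Xs[of N] elim(2) configs_memD by auto
    have card: "card (Xs N - D) = (N - K) + i + 1"
      using card_Diff_subset[OF D(1) elim(1)] XN D(3) elim(2) by simp
    have A: "A = {a \<in> Xs N - D. 0 < a * b \<and> \<bar>b\<bar> \<le> \<bar>a\<bar>}" using elim(3) by (auto simp: A_def)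
    have m: "N - K = Suc (N - Suc K)" using elim(2) by simp
    have "(\<Sum>a\<in>Xs N - D. delta_chain b (N - K) a / (\<Prod>x\<in>Xs N - D - {a}. a - x)) =
          (\<Sum>a\<in>A. delta_chain b (N - K) a / (\<Prod>x\<in>Xs N - D - {a}. a - x))"
    proof (rule sum.mono_neutral_right)
      show "\<forall>a\<in>Xs N - D - A. delta_chain b (N - K) a / (\<Prod>x\<in>Xs N - D - {a}. a - x) = 0"
        using delta_chain_outside[OF _ b0(2)] by (auto simp: A)
    qed (use XN in \<open>auto simp: A\<close>)
    also have "\<dots> = (\<Sum>a\<in>A. ?t N a)"
    proof (rule sum.cong[OF refl])
      fix a assume "a \<in> A"
      then have a: "0 < a * b" "\<bar>b\<bar> \<le> \<bar>a\<bar>" "a \<in> Xs N - D" by (auto simp: A)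
      from delta_chain_term[OF a(1,2) _ _ a(3) card]
      show "delta_chain b (N - K) a / (\<Prod>x\<in>Xs N - D - {a}. a - x) = ?t N a"
        using XN(1) m by simp
    qed
    finally show ?case by (simp add: divdiff_real)
  qed
  have "(\<lambda>N. complex_of_real (\<Sum>a\<in>A. ?t N a)) \<longlonglongrightarrow> of_real (\<Sum>a\<in>A. l a)"
    by (intro tendsto_of_real tendsto_sum l)
  from Lim_transform_eventually[OF this ev] show ?thesis by (rule that)
qed

text \<open>In \<open>link_entry\<close> the auxiliary points \<open>ts\<close> can be chosen once and for all in the limit \<open>X\<close>, since they
  eventually belong to every \<open>Xs N\<close>.\<close>

lemma link_converges:
  assumes X: "X \<in> inf_configs q zm zp" and conv: "outer_converges Xs X"
    and Xs: "\<And>N. 1 \<le> N \<Longrightarrow> Xs N \<in> configs' N" and B: "B \<in> configs' K"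
  obtains l where "(\<lambda>N. link N K (Xs N) B) \<longlonglongrightarrow> l"
proof -
  have X': "X \<subseteq> lattice" "infinite X" "bounded X" using X by (auto simp: inf_configs_def)
  obtain ts where ts: "distinct ts" "length ts = K" "set ts \<subseteq> X"
    using distinct_list_in_infinite_set[OF X'(2)] .
  let ?e = "\<lambda>N i j. divdiff (Xs N - set (drop (Suc i) ts)) (\<lambda>x. of_real (delta_chain (elt B j) (N - K) x))"
  have conv_e: "\<exists>l. (\<lambda>N. ?e N i j) \<longlonglongrightarrow> l" if ij: "i < K" "j < K" for i j
  proof -
    have sub: "set (drop (Suc i) ts) \<subseteq> X" using ts(3) set_drop_subset by fast
    show ?thesis
      using entry_converges[OF X'(1,3) conv Xs _ sub card_set_drop[OF ts(1,2) ij(1)] configs_elt(2)[OF B ij(2)]]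
      by blast
  qed
  define e where "e = (\<lambda>i j. lim (\<lambda>N. ?e N i j))"
  have e: "(\<lambda>N. ?e N i j) \<longlonglongrightarrow> e i j" if "i < K" "j < K" for i j
    unfolding e_def by (rule convergent_LIMSEQ_iff[THEN iffD1], unfold convergent_def, rule conv_e[OF that])
  obtain c where c: "link_const K \<longlonglongrightarrow> c" by (rule link_const_limit)
  let ?V = "alternant K monomial (elt B)"
  have bij: "bij_betw (elt B) {..<K} B" using bij_betw_elt[of B] configs_memD[OF B] by auto
  have lim: "(\<lambda>N. ?V * of_real (link_const K (N - K)) * detf K (?e N)) \<longlonglongrightarrow> ?V * of_real c * detf K e"
    by (intro tendsto_intros tendsto_detf e tendsto_shift[OF c])
  have "\<forall>\<^sub>F N in sequentially. set ts \<subseteq> Xs N"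
    by (rule outer_converges_finite_subset[OF conv _ ts(3)]) (use X'(1) lattice_zero_notin in auto)
  with eventually_ge_at_top[of "max 1 K"]
  have "\<forall>\<^sub>F N in sequentially. ?V * of_real (link_const K (N - K)) * detf K (?e N) = of_real (link N K (Xs N) B)"
  proof eventually_elim
    case (elim N)
    have "Xs N \<in> configs' (K + (N - K))" using Xs[of N] elim(1) by simp
    from link_entry[OF B bij this ts(1,2) elim(2)] show ?case using elim(1) by simp
  qed
  from Lim_transform_eventually[OF lim this]
  have "(\<lambda>N. Re (of_real (link N K (Xs N) B))) \<longlonglongrightarrow> Re (?V * of_real c * detf K e)"
    by (rule tendsto_Re)
  then show ?thesis using that by simp
qed

section \<open>The outermost elements\<close>

lemma delta_chain_self: "b \<noteq> 0 \<Longrightarrow> delta_chain b m b = b ^ m"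
proof (cases m)
  case (Suc n)
  assume b: "b \<noteq> 0"
  have "(\<Prod>k=1..<m. b - b * q ^ k) = (\<Prod>k=1..n. b * (1 - q ^ k))"
    using Suc by (intro prod.cong) (auto simp: algebra_simps)
  also have "\<dots> = b ^ n * qfact n" by (simp add: prod.distrib qfact_def)
  finally show ?thesis using Suc b qfact_pos(2)[of n] zero_less_mult_iff[of b b] 
    by (auto simp: delta_chain_def)
qed (simp add: delta_chain_def)

text \<open>For the outermost points \<open>ts\<close>, listed in increasing order of precedence, a primitive of the point
  mass at \<open>ts ! j\<close> vanishes at all points of \<open>X\<close> that come after \<open>ts ! j\<close> in the variational series. The
  determinant of \<open>link_entry\<close> is therefore triangular.\<close>

lemma link_outermost:
  assumes X: "X \<in> configs' (K + m)" and ts: "distinct ts" "length ts = K" "set ts \<subseteq> X"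
    and outer: "\<And>t x. t \<in> set ts \<Longrightarrow> x \<in> X - set ts \<Longrightarrow> precedes t x"
    and sorted: "\<And>i j. i < j \<Longrightarrow> j < K \<Longrightarrow> precedes (ts ! j) (ts ! i)"
  shows "of_real (link (K + m) K X (set ts)) =
     (of_real (link_const K m / (\<Prod>i<K. \<Prod>x\<in>X - set ts. 1 - x / ts ! i)) :: complex)"
proof -
  have finX: "finite X" and XL: "X \<subseteq> lattice" and cX: "card X = K + m" using configs_memD[OF X] by auto
  have B: "set ts \<in> configs' K" using ts XL by (auto simp: configs_def distinct_card)
  have bij: "bij_betw ((!) ts) {..<K} (set ts)" using bij_betw_nth[OF ts(1)] ts(2) by auto
  let ?S = "\<lambda>i. X - set (drop (Suc i) ts)"
  let ?f = "\<lambda>j x. complex_of_real (delta_chain (ts ! j) m x)"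
  have t0: "ts ! i \<noteq> 0" "ts ! i \<in> X" if "i < K" for i
  proof -
    have "ts ! i \<in> set ts" using that ts(2) by simp
    then show "ts ! i \<in> X" using ts(3) by blast
    then show "ts ! i \<noteq> 0" using XL lattice_nonzero by blast
  qed
  have drop: "ts ! k \<in> set (drop (Suc i) ts) \<longleftrightarrow> i < k" if "k < K" for i k
  proof
    assume "i < k"
    then show "ts ! k \<in> set (drop (Suc i) ts)" using that ts(2)
      by (auto simp: set_conv_nth intro!: exI[of _ "k - Suc i"])
  next
    assume "ts ! k \<in> set (drop (Suc i) ts)"
    then obtain l where "l < K - Suc i" "ts ! k = ts ! (Suc i + l)" using ts(2) by (auto simp: set_conv_nth)
    then show "i < k" using nth_eq_iff_index_eq[OF ts(1), of k "Suc i + l"] that ts(2) by auto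
  qed
  have zero: "delta_chain (ts ! j) m a = 0" if a: "a \<in> ?S i" "j < K" "i \<le> j" "\<not> (i = j \<and> a = ts ! j)" for i j a
  proof (rule delta_chain_outside)
    show "\<not> (0 < a * ts ! j \<and> \<bar>ts ! j\<bar> \<le> \<bar>a\<bar>)"
    proof
      assume *: "0 < a * ts ! j \<and> \<bar>ts ! j\<bar> \<le> \<bar>a\<bar>"
      have "\<not> precedes (ts ! j) a" using precedes_same_sign[of "ts ! j" a] * by (auto simp: mult.commute)
      then have "a \<in> set ts" using outer[of "ts ! j" a] a(1,2) ts(2) by auto
      then obtain k where k: "k < K" "a = ts ! k" using ts(2) by (auto simp: set_conv_nth)
      then have "k \<le> i" using a(1) drop[OF k(1), of i] by auto
      then have "k < j \<or> k = j" using a by auto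
      then show False
      proof
        assume "k < j"
        then show False using sorted[of k j] a(2) \<open>\<not> precedes (ts ! j) a\<close> k by simp
      next
        assume "k = j"
        then show False using a k \<open>k \<le> i\<close> by auto
      qed
    qed
  qed (use t0 a in auto)
  have upper: "divdiff (?S i) (?f j) = 0" if "i < j" "j < K" for i j
    unfolding divdiff_def using zero[of _ i j] that by (intro sum.neutral ballI) auto
  have diag: "divdiff (?S i) (?f i) = of_real (1 / (\<Prod>x\<in>X - set ts. 1 - x / ts ! i)) / (\<Prod>l<i. of_real (ts ! i - ts ! l))"
    if i: "i < K" for i
  proof -
    let ?t = "ts ! i"
    have S: "?S i - {?t} = (X - set ts) \<union> (\<lambda>l. ts ! l) ` {..<i}"
    proof -
      have "x \<in> ?S i - {?t} \<longleftrightarrow> x \<in> (X - set ts) \<union> (\<lambda>l. ts ! l) ` {..<i}" for x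
      proof (cases "x \<in> set ts")
        case True
        then obtain k where k: "k < K" "x = ts ! k" using ts(2) by (auto simp: set_conv_nth)
        have "x \<in> ?S i - {?t} \<longleftrightarrow> k \<le> i \<and> k \<noteq> i"
          using k drop[OF k(1), of i] t0(2)[OF k(1)] i nth_eq_iff_index_eq[OF ts(1), of k i] ts(2) by auto
        also have "\<dots> \<longleftrightarrow> k < i" by auto
        also have "\<dots> \<longleftrightarrow> x \<in> (\<lambda>l. ts ! l) ` {..<i}"
          using k i nth_eq_iff_index_eq[OF ts(1)] ts(2) by (auto simp: image_iff)
        finally show ?thesis using True by auto
      next
        case False
        then show ?thesis using i ts(2) set_drop_subset[of "Suc i" ts] by auto
      qed
      then show ?thesis by blast
    qed
    have inj: "inj_on ((!) ts) {..<i}" using ts i by (auto simp: inj_on_def nth_eq_iff_index_eq)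
    have "(\<Prod>x\<in>?S i - {?t}. complex_of_real (?t - x)) =
          (\<Prod>x\<in>X - set ts. of_real (?t - x)) * (\<Prod>l<i. of_real (?t - ts ! l))"
      unfolding S
      by (subst prod.union_disjoint) (use finX ts i in \<open>auto simp: prod.reindex[OF inj]\<close>)
    also have "(\<Prod>x\<in>X - set ts. complex_of_real (?t - x)) = of_real (?t ^ m * (\<Prod>x\<in>X - set ts. 1 - x / ?t))"
    proof -
      have "card (X - set ts) = m" using card_Diff_subset[OF _ ts(3)] cX ts by (simp add: distinct_card)
      moreover have "(\<Prod>x\<in>X - set ts. ?t - x) = (\<Prod>x\<in>X - set ts. ?t * (1 - x / ?t))"
        using t0(1)[OF i] by (intro prod.cong) (auto simp: field_simps)
      ultimately have "(\<Prod>x\<in>X - set ts. ?t - x) = ?t ^ m * (\<Prod>x\<in>X - set ts. 1 - x / ?t)"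
        by (simp add: prod.distrib)
      then show ?thesis by (metis of_real_prod)
    qed
    finally have P: "(\<Prod>x\<in>?S i - {?t}. complex_of_real (?t - x)) =
       of_real (?t ^ m * (\<Prod>x\<in>X - set ts. 1 - x / ?t)) * (\<Prod>l<i. of_real (?t - ts ! l))" .
    have tS: "?t \<in> ?S i" using drop[OF i, of i] t0(2)[OF i] by auto
    have "divdiff (?S i) (?f i) = (\<Sum>a\<in>{?t}. ?f i a / (\<Prod>x\<in>?S i - {a}. of_real (a - x)))"
      unfolding divdiff_def
      by (rule sum.mono_neutral_right) (use finX tS zero[of _ i i] i in auto)
    then show ?thesis unfolding P[symmetric] using t0(1)[OF i] P
      by (simp add: delta_chain_self)
  qed
  have V: "alternant K monomial ((!) ts) \<noteq> 0" "alternant K monomial ((!) ts) = (\<Prod>j<K. \<Prod>i<j. of_real (ts ! j - ts ! i))"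
    by (rule alternant_newton[OF bij_betw_imp_inj_on[OF bij]])+
  have "detf K (\<lambda>i j. divdiff (?S i) (?f j)) = (\<Prod>i<K. divdiff (?S i) (?f i))"
    by (rule detf_lower_triangular) (rule upper)
  also have "\<dots> = of_real (1 / (\<Prod>i<K. \<Prod>x\<in>X - set ts. 1 - x / ts ! i)) / alternant K monomial ((!) ts)"
    unfolding V(2) by (simp add: diag prod_dividef prod.distrib del: of_real_diff)
  finally have D: "detf K (\<lambda>i j. divdiff (?S i) (?f j)) =
     of_real (1 / (\<Prod>i<K. \<Prod>x\<in>X - set ts. 1 - x / ts ! i)) / alternant K monomial ((!) ts)" .
  show ?thesis unfolding link_entry[OF B bij X ts] D using V(1) by simp
qed

section \<open>Ranks in the variational series\<close>

text \<open>What finite configurations and infinite bounded ones have in common; it makes all sets of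
  predecessors finite, so that ranks are meaningful.\<close>

definition tame :: "real set \<Rightarrow> bool" where
  "tame X \<longleftrightarrow> X \<subseteq> lattice \<and> bounded X"

lemma tame_configs: "X \<in> configs' n \<Longrightarrow> tame X"
  using configs_memD finite_imp_bounded by (auto simp: tame_def)

lemma tame_inf_configs: "X \<in> inf_configs q zm zp \<Longrightarrow> tame X"
  by (auto simp: tame_def inf_configs_def)

lemma finite_outer:
  assumes "tame X" "0 < \<delta>"
  shows "finite {x \<in> X. \<delta> \<le> \<bar>x\<bar>}"
proof -
  obtain B where "\<And>x. x \<in> X \<Longrightarrow> \<bar>x\<bar> \<le> B" using assms(1) by (auto simp: tame_def bounded_iff)
  then show ?thesis
    by (intro finite_subset[OF _ finite_annulus[OF assms(2), of B]]) (use assms(1) in \<open>auto simp: tame_def\<close>)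
qed

lemma finite_predecessors:
  assumes "tame X" "x \<noteq> 0"
  shows "finite {y \<in> X. precedes y x}"
  by (rule finite_subset[OF _ finite_outer[OF assms(1), of "\<bar>x\<bar>"]]) (use assms(2) precedes_abs in auto)

lemma tame_nonzero: "tame X \<Longrightarrow> x \<in> X \<Longrightarrow> x \<noteq> 0"
  using lattice_nonzero by (auto simp: tame_def)

lemma rank_less:
  assumes "tame X" "x \<in> X" "y \<noteq> 0" "precedes x y"
  shows "rank X x < rank X y"
  unfolding rank_def
proof (rule psubset_card_mono[OF finite_predecessors[OF assms(1,3)]])
  show "{z \<in> X. precedes z x} \<subset> {z \<in> X. precedes z y}"
    using assms precedes_trans precedes_irrefl by blast
qed

lemma rank_less_iff:
  assumes "tame X" "x \<in> X" "y \<in> X"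
  shows "rank X x < rank X y \<longleftrightarrow> precedes x y"
proof
  assume "rank X x < rank X y"
  then show "precedes x y"
    using rank_less[OF assms(1,3) tame_nonzero[OF assms(1,2)]] precedes_total[of x y] by fastforce
qed (rule rank_less[OF assms(1,2) tame_nonzero[OF assms(1,3)]])

lemma rank_inj:
  assumes "tame X" "x \<in> X" "y \<in> X" "rank X x = rank X y"
  shows "x = y"
  using rank_less_iff[OF assms(1,2,3)] rank_less_iff[OF assms(1,3,2)] precedes_total[of x y] assms(4) by auto

text \<open>The \<open>rank X x + 1\<close> elements up to \<open>x\<close> have distinct ranks, all of them at most \<open>rank X x\<close>; so these
  ranks exhaust the initial segment.\<close>

lemma rank_attained_below:
  assumes "tame X" "x \<in> X" "j \<le> rank X x"
  obtains y where "y \<in> X" "rank X y = j"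
proof -
  let ?S = "insert x {y \<in> X. precedes y x}"
  have fin: "finite {y \<in> X. precedes y x}" by (rule finite_predecessors[OF assms(1) tame_nonzero[OF assms(1,2)]])
  have card: "card ?S = Suc (rank X x)" using fin precedes_irrefl[of x] by (simp add: rank_def)
  have inj: "inj_on (rank X) ?S" using rank_inj[OF assms(1)] assms(2) by (auto simp: inj_on_def)
  have sub: "rank X ` ?S \<subseteq> {..rank X x}" using rank_less_iff[OF assms(1)] assms(2) by (auto simp: less_imp_le)
  have "card (rank X ` ?S) = card {..rank X x}" unfolding card_image[OF inj] card by simp
  then have "rank X ` ?S = {..rank X x}" using card_subset_eq[OF _ sub] by simp
  then have "j \<in> rank X ` ?S" using assms(3) by simp
  then show ?thesis using that assms(2) by auto
qed

lemma rank_attained: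
  assumes "tame X" "F \<subseteq> X" "finite F" "k < card F"
  obtains y where "y \<in> X" "rank X y = k"
proof -
  have inj: "inj_on (rank X) F" using rank_inj[OF assms(1)] assms(2) by (auto simp: inj_on_def)
  have "\<exists>x\<in>F. k \<le> rank X x"
  proof (rule ccontr)
    assume "\<not> (\<exists>x\<in>F. k \<le> rank X x)"
    then have "rank X ` F \<subseteq> {..<k}" by auto
    then have "card (rank X ` F) \<le> k" using card_mono[of "{..<k}"] by fastforce
    then show False using assms(4) by (simp add: card_image[OF inj])
  qed
  then obtain x where "x \<in> X" "k \<le> rank X x" using assms(2) by blast
  then show ?thesis using rank_attained_below[OF assms(1)] that by blast
qed

lemma var_series_eq_iff:
  assumes "tame X" "x \<noteq> 0"
  shows "var_series X k = x \<longleftrightarrow> x \<in> X \<and> rank X x = k"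
proof -
  let ?P = "\<lambda>x. x \<in> X \<and> finite {y \<in> X. precedes y x} \<and> card {y \<in> X. precedes y x} = k"
  have P: "?P x \<longleftrightarrow> x \<in> X \<and> rank X x = k" for x
    using finite_predecessors[OF assms(1)] tame_nonzero[OF assms(1)] by (auto simp: rank_def)
  show ?thesis
  proof (cases "\<exists>x. ?P x")
    case True
    then obtain z where z: "?P z" by blast
    have "(THE x. ?P x) = z"
    proof (rule the_equality)
      show "?P z" by (rule z)
      fix x assume "?P x"
      then show "x = z" using z rank_inj[OF assms(1), of x z] unfolding P by simp
    qed
    then have "var_series X k = z" using z by (auto simp: var_series_def)
    then show ?thesis using z rank_inj[OF assms(1), of x z] unfolding P by auto
  next
    case False
    then have "var_series X k = 0" by (auto simp: var_series_def)
    then show ?thesis using False assms(2) unfolding P by auto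
  qed
qed

lemma var_series_rank: "tame X \<Longrightarrow> x \<in> X \<Longrightarrow> var_series X (rank X x) = x"
  using var_series_eq_iff tame_nonzero by blast

lemma bij_betw_rank_top_part:
  assumes "tame X" "F \<subseteq> X" "finite F" "k \<le> card F"
  shows "bij_betw (rank X) (top_part X k) {..<k}"
proof (rule bij_betw_imageI)
  show "inj_on (rank X) (top_part X k)"
    using rank_inj[OF assms(1)] by (auto simp: inj_on_def top_part_def)
  have "j \<in> rank X ` top_part X k" if "j < k" for j
  proof -
    have "j < card F" using that assms(4) by simp
    from rank_attained[OF assms(1-3) this] obtain y where "y \<in> X" "rank X y = j" .
    then show ?thesis using that by (auto simp: top_part_def)
  qed
  then show "rank X ` top_part X k = {..<k}" by (auto simp: top_part_def)
qed

lemma top_part_config: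
  assumes "X \<in> configs' N" "k \<le> N"
  shows "top_part X k \<in> configs' k"
proof -
  have X: "finite X" "card X = N" "X \<subseteq> lattice" using configs_memD[OF assms(1)] by auto
  have "bij_betw (rank X) (top_part X k) {..<k}"
    by (rule bij_betw_rank_top_part[OF tame_configs[OF assms(1)] order_refl]) (use X assms(2) in auto)
  then show ?thesis using X bij_betw_same_card by (fastforce simp: configs_def top_part_def)
qed

text \<open>An element of \<open>X\<close> closer to \<open>0\<close> than \<open>\<delta>\<close> exists because \<open>X\<close> is infinite. If its rank is \<open>k\<close>, then all
  points at distance at least \<open>\<delta>\<close> from \<open>0\<close>, in \<open>X\<close> as in \<open>Xs N\<close>, are among the first \<open>k\<close> members of the
  respective variational series.\<close>

lemma stabilizes_imp_outer_converges:
  assumes X: "X \<in> inf_configs q zm zp" and Xs: "\<And>N. 1 \<le> N \<Longrightarrow> Xs N \<in> configs' N"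
    and st: "stabilizes_to Xs X"
  shows "outer_converges Xs X"
  unfolding outer_converges_def
proof (intro allI impI)
  fix \<delta> :: real assume \<delta>: "\<delta> > 0"
  have tX: "tame X" and inf: "infinite X" using X tame_inf_configs by (auto simp: inf_configs_def)
  have "infinite (X - {x \<in> X. \<delta> \<le> \<bar>x\<bar>})" using inf finite_outer[OF tX \<delta>] by simp
  then have "X - {x \<in> X. \<delta> \<le> \<bar>x\<bar>} \<noteq> {}" by (rule infinite_imp_nonempty)
  then obtain \<xi> where \<xi>: "\<xi> \<in> X" "\<bar>\<xi>\<bar> < \<delta>" by force
  define k where "k = rank X \<xi>"
  have "\<forall>\<^sub>F N in sequentially. var_series (Xs N) j = var_series X j" for j
    using st by (simp add: stabilizes_to_def eventually_sequentially)
  then have "\<forall>\<^sub>F N in sequentially. \<forall>j\<in>{..k}. var_series (Xs N) j = var_series X j"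
    by (intro eventually_ball_finite) auto
  with eventually_ge_at_top[of 1]
  show "\<forall>\<^sub>F N in sequentially. {x \<in> Xs N. \<delta> \<le> \<bar>x\<bar>} = {x \<in> X. \<delta> \<le> \<bar>x\<bar>}"
  proof eventually_elim
    case (elim N)
    have tN: "tame (Xs N)" using Xs[OF elim(1)] tame_configs by blast
    have v: "var_series (Xs N) j = var_series X j" if "j \<le> k" for j using elim(2) that by blast
    have "var_series (Xs N) k = \<xi>" using v[of k] var_series_rank[OF tX \<xi>(1)] by (simp add: k_def)
    then have \<xi>N: "\<xi> \<in> Xs N" "rank (Xs N) \<xi> = k"
      using var_series_eq_iff[OF tN tame_nonzero[OF tX \<xi>(1)]] by auto
    have pre: "precedes x \<xi>" if "\<delta> \<le> \<bar>x\<bar>" for x using that \<xi>(2) by (simp add: precedes_def)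
    have "x \<in> Xs N \<longleftrightarrow> x \<in> X" if x: "\<delta> \<le> \<bar>x\<bar>" for x
    proof
      assume xN: "x \<in> Xs N"
      then have r: "rank (Xs N) x < k" using rank_less_iff[OF tN xN \<xi>N(1)] pre[OF x] \<xi>N(2) by simp
      then have "var_series X (rank (Xs N) x) = x" using v var_series_rank[OF tN xN] by simp
      then show "x \<in> X" using var_series_eq_iff[OF tX tame_nonzero[OF tN xN]] by blast
    next
      assume xX: "x \<in> X"
      then have r: "rank X x < k" using rank_less_iff[OF tX xX \<xi>(1)] pre[OF x] by (simp add: k_def)
      then have "var_series (Xs N) (rank X x) = x" using v var_series_rank[OF tX xX] by simp
      then show "x \<in> Xs N" using var_series_eq_iff[OF tN tame_nonzero[OF tX xX]] by blast
    qed
    then show ?case by blast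
  qed
qed

lemma stabilizes_unique:
  assumes "X \<in> inf_configs q zm zp" "Y \<in> inf_configs q zm zp" "stabilizes_to Xs X" "stabilizes_to Xs Y"
  shows "X = Y"
proof -
  have "var_series X k = var_series Y k" for k
  proof -
    obtain N1 N2 where "\<forall>N\<ge>N1. var_series (Xs N) k = var_series X k" "\<forall>N\<ge>N2. var_series (Xs N) k = var_series Y k"
      using assms(3,4) unfolding stabilizes_to_def by blast
    then show ?thesis by (metis linear)
  qed
  then have eq: "{x. x \<noteq> 0 \<and> (\<exists>k. var_series X k = x)} = {x. x \<noteq> 0 \<and> (\<exists>k. var_series Y k = x)}" by simp
  have elements: "Z = {x. x \<noteq> 0 \<and> (\<exists>k. var_series Z k = x)}" if "Z \<in> inf_configs q zm zp" for Z
    using var_series_eq_iff[OF tame_inf_configs[OF that]] tame_nonzero[OF tame_inf_configs[OF that]] by blast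
  show ?thesis using elements[OF assms(1)] eq elements[OF assms(2)] by (rule trans[OF trans[OF _ _] sym])
qed

section \<open>The outermost elements carry mass bounded below\<close>

text \<open>In the product formula of \<open>link_outermost\<close> all quotients satisfy \<open>\<bar>x / t\<bar> \<le> 1\<close>, and their sum over the
  lattice is bounded by \<open>2 / (1 - q)\<close>. It matters that the bound depends on \<open>K\<close> alone: no information on
  \<open>X\<close> is available when a regular sequence is shown to stabilize.\<close>

lemma link_top_part_lower_bound:
  obtains c where "c > 0" "\<And>X N. X \<in> configs' N \<Longrightarrow> K \<le> N \<Longrightarrow> c \<le> link N K X (top_part X K)"
proof -
  obtain c where c: "c > 0" "\<And>m. c \<le> link_const K m" using link_const_lower_bound[where K = K] by blast
  define E where "E = exp (2 / (1 - q))"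
  have E: "E > 0" by (simp add: E_def)
  have "c / E ^ K \<le> link N K X (top_part X K)" if X: "X \<in> configs' N" and KN: "K \<le> N" for X N
  proof -
    have tX: "tame X" using tame_configs[OF X] .
    have fX: "finite X" "card X = N" using configs_memD[OF X] by auto
    have bij: "bij_betw (rank X) (top_part X K) {..<K}"
      by (rule bij_betw_rank_top_part[OF tX order_refl fX(1)]) (use fX KN in simp)
    \<comment> \<open>the outer part in increasing order of precedence, as \<open>link_outermost\<close> wants it\<close>
    define ts where "ts = map (\<lambda>i. var_series X (K - Suc i)) [0..<K]"
    have len: "length ts = K" by (simp add: ts_def)
    have nth: "ts ! i \<in> X" "rank X (ts ! i) = K - Suc i" if "i < K" for i
    proof -
      have "K - Suc i \<in> rank X ` top_part X K" using bij that by (auto simp: bij_betw_def)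
      then obtain x where x: "x \<in> X" "rank X x = K - Suc i" by (auto simp: top_part_def)
      then have "ts ! i = x" using that var_series_rank[OF tX x(1)] by (simp add: ts_def)
      then show "ts ! i \<in> X" "rank X (ts ! i) = K - Suc i" using x by auto
    qed
    have dist: "distinct ts"
      unfolding distinct_conv_nth len
    proof (intro allI impI)
      fix i j assume ij: "i < K" "j < K" "i \<noteq> j"
      then have "K - Suc i \<noteq> K - Suc j" by linarith
      then show "ts ! i \<noteq> ts ! j" using nth(2)[OF ij(1)] nth(2)[OF ij(2)] by auto
    qed
    have sub: "set ts \<subseteq> X" using nth(1) len by (auto simp: in_set_conv_nth)
    have "set ts \<subseteq> top_part X K" using nth len by (fastforce simp: in_set_conv_nth top_part_def)
    moreover have "finite (top_part X K)" "card (top_part X K) = card (set ts)"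
      using bij_betw_same_card[OF bij] fX(1) distinct_card[OF dist] len by (auto simp: top_part_def)
    ultimately have ts: "set ts = top_part X K" by (intro card_subset_eq) auto
    have outer: "precedes t x" if "t \<in> set ts" "x \<in> X - set ts" for t x
    proof -
      have "rank X t < rank X x" using that unfolding ts by (auto simp: top_part_def)
      then show ?thesis using rank_less_iff[OF tX] that sub by blast
    qed
    have sorted: "precedes (ts ! j) (ts ! i)" if "i < j" "j < K" for i j
    proof -
      have "rank X (ts ! j) < rank X (ts ! i)" using nth(2)[of i] nth(2)[of j] that by auto
      then show ?thesis using rank_less_iff[OF tX] nth(1)[of i] nth(1)[of j] that by auto
    qed
    let ?p = "\<Prod>i<K. \<Prod>x\<in>X - set ts. 1 - x / ts ! i"
    have XK: "X \<in> configs' (K + (N - K))" using X KN by simp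
    have "complex_of_real (link (K + (N - K)) K X (set ts)) = of_real (link_const K (N - K) / ?p)"
      by (rule link_outermost[OF XK dist len sub outer sorted])
    then have eq: "link N K X (top_part X K) = link_const K (N - K) / ?p"
      unfolding of_real_eq_iff using KN ts by simp
    have "\<bar>?p\<bar> = (\<Prod>i<K. \<bar>\<Prod>x\<in>X - set ts. 1 - x / ts ! i\<bar>)" by (simp add: abs_prod)
    also have "\<dots> \<le> (\<Prod>i<K. E)"
    proof (intro prod_mono conjI abs_ge_zero)
      fix i assume "i \<in> {..<K}"
      then have i: "i < K" by simp
      have "ts ! i \<noteq> 0" using tame_nonzero[OF tX nth(1)[OF i]] .
      then have "exp (2 * \<bar>ts ! i\<bar> / (1 - q) / \<bar>ts ! i\<bar>) = E" by (simp add: E_def)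
      moreover have "\<bar>\<Prod>x\<in>X - set ts. 1 - x / ts ! i\<bar> \<le> exp (2 * \<bar>ts ! i\<bar> / (1 - q) / \<bar>ts ! i\<bar>)"
      proof (rule small_prod_bound(2))
        show "\<bar>x\<bar> \<le> \<bar>ts ! i\<bar>" if "x \<in> X - set ts" for x
          using outer[of "ts ! i" x] that i len precedes_abs by simp
      qed (use fX tX in \<open>auto simp: tame_def\<close>)
      ultimately show "\<bar>\<Prod>x\<in>X - set ts. 1 - x / ts ! i\<bar> \<le> E" by simp
    qed
    finally have p: "\<bar>?p\<bar> \<le> E ^ K" by simp
    have l: "link N K X (top_part X K) = link_const K (N - K) / \<bar>?p\<bar>"
      using link_nonneg[of N K X "top_part X K"] link_const_pos[of K "N - K"] unfolding eq
      by (metis abs_divide abs_of_nonneg abs_of_pos)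
    have "?p \<noteq> 0"
    proof
      assume "?p = 0"
      then obtain i x where ix: "i < K" "x \<in> X - set ts" "1 - x / ts ! i = 0" using fX by auto
      then have "x = ts ! i" using tame_nonzero[OF tX nth(1)[OF ix(1)]] by (simp add: field_simps)
      then show False using ix len by auto
    qed
    then have "0 < \<bar>?p\<bar>" by linarith
    with p show ?thesis
      unfolding l using link_const_pos[of K "N - K"] c(2)[of "N - K"] by (intro frac_le) auto
  qed
  then show ?thesis using that[of "c / E ^ K"] c(1) E by simp
qed

section \<open>Supports\<close>

lemma link1_nonzero_interlaces: "link1 n X Z \<noteq> 0 \<Longrightarrow> interlaces q zm zp Z X"
  by (auto simp: qlink1_def split: if_splits)

lemma interlaces_bounds:
  assumes "interlaces q zm zp Z X" "Z \<in> configs' n" "i < n"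
  shows "elt X i \<le> elt Z i" "elt Z i \<le> elt X (Suc i)"
  using assms qinterval_bounds(1,2)[of "elt Z i"] configs_memD[OF assms(2)] by (auto simp: interlaces_def)

lemma config_nth:
  assumes "X \<in> configs' n" "x \<in> X"
  obtains i where "i < n" "x = elt X i"
  using bij_betw_elt[of X] configs_memD[OF assms(1)] assms(2) by (auto simp: bij_betw_def)

text \<open>Element number \<open>i\<close> of \<open>Z\<close> lies between the elements number \<open>i\<close> and \<open>i + 1\<close> of \<open>X\<close>, which gives injections
  between the sets that are counted.\<close>

lemma interlaces_count:
  assumes X: "X \<in> configs' (Suc n)" and Z: "Z \<in> configs' n" and int: "interlaces q zm zp Z X"
  shows "card {z \<in> Z. a \<le> z} \<le> card {x \<in> X. a \<le> x}" "card {z \<in> Z. z \<le> a} \<le> card {x \<in> X. x \<le> a}"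
proof -
  have fX: "finite X" and eX: "inj_on (elt X) {..<Suc n}"
    using configs_memD[OF X] bij_betw_imp_inj_on[OF bij_betw_elt[of X]] by auto
  have eZ: "inj_on (elt Z) {..<n}"
    using configs_memD[OF Z] bij_betw_imp_inj_on[OF bij_betw_elt[of Z]] by auto
  have 1: "card {z \<in> Z. P z} = card {i. i < n \<and> P (elt Z i)}" for P
  proof -
    have "{z \<in> Z. P z} = elt Z ` {i. i < n \<and> P (elt Z i)}"
      using config_nth[OF Z] configs_elt(1)[OF Z] by blast
    moreover have "inj_on (elt Z) {i. i < n \<and> P (elt Z i)}" by (rule inj_on_subset[OF eZ]) auto
    ultimately show ?thesis by (simp add: card_image)
  qed
  have "card {i. i < n \<and> a \<le> elt Z i} \<le> card {x \<in> X. a \<le> x}"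
  proof (rule card_inj_on_le[where f = "\<lambda>i. elt X (Suc i)"])
    show "inj_on (\<lambda>i. elt X (Suc i)) {i. i < n \<and> a \<le> elt Z i}" using eX by (auto simp: inj_on_def)
    show "(\<lambda>i. elt X (Suc i)) ` {i. i < n \<and> a \<le> elt Z i} \<subseteq> {x \<in> X. a \<le> x}"
      using interlaces_bounds(2)[OF int Z] configs_elt(1)[OF X] by force
  qed (use fX in simp)
  then show "card {z \<in> Z. a \<le> z} \<le> card {x \<in> X. a \<le> x}" by (simp add: 1)
  have "card {i. i < n \<and> elt Z i \<le> a} \<le> card {x \<in> X. x \<le> a}"
  proof (rule card_inj_on_le[where f = "elt X"])
    show "inj_on (elt X) {i. i < n \<and> elt Z i \<le> a}" using eX by (auto simp: inj_on_def)
    show "elt X ` {i. i < n \<and> elt Z i \<le> a} \<subseteq> {x \<in> X. x \<le> a}"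
      using interlaces_bounds(1)[OF int Z] configs_elt(1)[OF X] by force
  qed (use fX in simp)
  then show "card {z \<in> Z. z \<le> a} \<le> card {x \<in> X. x \<le> a}" by (simp add: 1)
qed

lemma link_count:
  assumes "K \<le> N" "X \<in> configs' N" "Y \<in> configs' K" "link N K X Y \<noteq> 0"
  shows "card {y \<in> Y. a \<le> y} \<le> card {x \<in> X. a \<le> x} \<and> card {y \<in> Y. y \<le> a} \<le> card {x \<in> X. x \<le> a}"
  using assms
proof (induction N arbitrary: X rule: dec_induct)
  case base
  then show ?case by (auto simp: link_diag split: if_splits)
next
  case (step N)
  have "\<exists>Z\<in>configs' N. link1 N X Z * link N K Z Y \<noteq> 0"
  proof (rule ccontr)
    assume "\<not> ?thesis"
    then have "(\<Sum>\<^sub>\<infinity>Z\<in>configs' N. link1 N X Z * link N K Z Y) = 0" by (intro infsum_0) blast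
    then show False using step.prems step.hyps by (simp add: link_Suc)
  qed
  then obtain Z where Z: "Z \<in> configs' N" "link1 N X Z \<noteq> 0" "link N K Z Y \<noteq> 0" by auto
  have "card {z \<in> Z. a \<le> z} \<le> card {x \<in> X. a \<le> x}" "card {z \<in> Z. z \<le> a} \<le> card {x \<in> X. x \<le> a}"
    using interlaces_count[OF step.prems(1) Z(1) link1_nonzero_interlaces[OF Z(2)]] by auto
  then show ?case using step.IH[OF Z(1) step.prems(2) Z(3)] by linarith
qed

text \<open>Counting the elements above and below \<open>y\<close> places \<open>y\<close> between two elements of \<open>X\<close>.\<close>

lemma link_support_bounded:
  assumes "K \<le> N" "X \<in> configs' N" "Y \<in> configs' K" "link N K X Y \<noteq> 0"
    and "\<And>x. x \<in> X \<Longrightarrow> \<bar>x\<bar> \<le> R" "y \<in> Y"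
  shows "\<bar>y\<bar> \<le> R"
proof -
  have fin: "finite Y" using configs_memD[OF assms(3)] by auto
  have "card {z \<in> Y. y \<le> z} > 0" "card {z \<in> Y. z \<le> y} > 0"
    using fin assms(6) by (auto simp: card_gt_0_iff)
  then have "card {x \<in> X. y \<le> x} > 0" "card {x \<in> X. x \<le> y} > 0"
    using link_count[OF assms(1-4), of y] by linarith+
  then obtain x x' where "x \<in> X" "y \<le> x" "x' \<in> X" "x' \<le> y" by (auto simp: card_gt_0_iff)
  then show ?thesis using assms(5)[of x] assms(5)[of x'] by linarith
qed

text \<open>Two points near \<open>0\<close> include two neighbours, and the interlacing element between them is trapped.\<close>

lemma two_small_points:
  assumes Y: "Y \<in> configs' (Suc K)" and Z: "Z \<in> configs' K" and "link1 K Y Z \<noteq> 0"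
    and uv: "u \<in> Y" "v \<in> Y" "u \<noteq> v" "\<bar>u\<bar> < \<delta>" "\<bar>v\<bar> < \<delta>"
  obtains z where "z \<in> Z" "\<bar>z\<bar> < \<delta>"
proof -
  have *: "\<exists>z\<in>Z. \<bar>z\<bar> < \<delta>" if "i < j" "j < Suc K" "\<bar>elt Y i\<bar> < \<delta>" "\<bar>elt Y j\<bar> < \<delta>" for i j
  proof -
    have "elt Y (Suc i) \<le> elt Y j"
      using elt_less[of Y "Suc i" j] configs_memD[OF Y] that by (cases "Suc i = j") auto
    moreover have "elt Y i \<le> elt Z i" "elt Z i \<le> elt Y (Suc i)"
      using interlaces_bounds[OF link1_nonzero_interlaces[OF assms(3)] Z, of i] that by auto
    moreover have "elt Z i \<in> Z" using configs_elt(1)[OF Z, of i] that by simp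
    ultimately show ?thesis using that by (intro bexI[of _ "elt Z i"]) auto
  qed
  obtain i j where "i < Suc K" "u = elt Y i" "j < Suc K" "v = elt Y j"
    using config_nth[OF Y uv(1)] config_nth[OF Y uv(2)] by metis
  then show ?thesis using *[of i j] *[of j i] uv that by (metis linorder_neqE_nat)
qed

section \<open>A test function that detects mass escaping to zero\<close>

text \<open>The \<open>q\<close>-Pochhammer symbol \<open>(u y; q)\<^sub>n\<close>.\<close>

definition qpoch :: "complex \<Rightarrow> nat \<Rightarrow> real \<Rightarrow> complex" where
  "qpoch u n y = (\<Prod>k<n. 1 - u * of_real y * of_real q ^ k)"

lemma qpoch_factor: "1 - (\<i> * of_real v) * of_real y * of_real q ^ k = 1 - \<i> * of_real (v * y * q ^ k)"
  by simp

lemma norm_qpoch: "1 \<le> norm (qpoch (\<i> * of_real v) n y)"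
  unfolding qpoch_def prod_norm[symmetric] qpoch_factor
  by (rule prod_ge_1) (rule norm_one_minus_imaginary)

lemma qpoch_nonzero: "qpoch (\<i> * of_real v) n y \<noteq> 0"
  using norm_qpoch[of v n y] by auto

lemma norm_qpoch_ge: "0 < n \<Longrightarrow> \<bar>v * y\<bar> \<le> norm (qpoch (\<i> * of_real v) n y)"
proof -
  assume "0 < n"
  then obtain m where n: "n = Suc m" using gr0_implies_Suc by blast
  have "\<bar>v * y\<bar> * 1 \<le> norm (1 - \<i> * of_real (v * y * q ^ 0)) * (\<Prod>k<m. norm (1 - \<i> * of_real (v * y * q ^ Suc k)))"
    using norm_one_minus_imaginary by (intro mult_mono prod_ge_1) (auto simp del: of_real_mult power_Suc)
  also have "\<dots> = norm (qpoch (\<i> * of_real v) n y)"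
    unfolding qpoch_def n prod_norm[symmetric] qpoch_factor by (simp only: prod.lessThan_Suc_shift)
  finally show ?thesis by simp
qed

lemma qpoch_near_1:
  assumes "0 \<le> v"
  shows "norm (1 / qpoch (\<i> * of_real v) n y - 1) \<le> exp (v * \<bar>y\<bar> / (1 - q)) - 1"
proof -
  let ?P = "qpoch (\<i> * of_real v) n y"
  have "1 / ?P - 1 = (1 - ?P) / ?P" using qpoch_nonzero[of v n y] by (simp add: field_simps)
  then have "norm (1 / ?P - 1) = norm (?P - 1) / norm ?P" by (simp add: norm_divide norm_minus_commute)
  also have "\<dots> \<le> norm (?P - 1) / 1" using norm_qpoch[of v n y] by (intro divide_left_mono) auto
  also have "\<dots> \<le> exp (\<Sum>k<n. norm (- (\<i> * of_real v * of_real y * of_real q ^ k))) - 1"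
    using prod_minus_one_bound(1)[of "{..<n}" "\<lambda>k. - (\<i> * of_real v * of_real y * of_real q ^ k)"]
    by (simp add: qpoch_def)
  also have "(\<Sum>k<n. norm (- (\<i> * of_real v * of_real y * of_real q ^ k))) = v * \<bar>y\<bar> * (\<Sum>k<n. q ^ k)"
    using assms q by (simp add: norm_mult norm_power sum_distrib_left)
  also have "exp \<dots> \<le> exp (v * \<bar>y\<bar> * (1 / (1 - q)))"
  proof -
    have "(\<Sum>k<n. q ^ k) \<le> (\<Sum>k. q ^ k)" using q by (intro sum_le_suminf summable_geometric) auto
    then have "(\<Sum>k<n. q ^ k) \<le> 1 / (1 - q)" using q by (simp add: suminf_geometric)
    then show ?thesis using assms by (simp only: exp_le_cancel_iff) (intro mult_left_mono, auto)
  qed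
  finally show ?thesis by simp
qed

text \<open>The primitives of \<open>y \<mapsto> 1 / (u y; q)\<^sub>M\<^sub>+\<^sub>1\<close>: each step shortens the product by one factor, up to a constant,
  and after \<open>M\<close> steps a single factor is left. The starting function depends on the number \<open>M\<close> of steps
  that are to be taken.\<close>

definition test_chain :: "complex \<Rightarrow> nat \<Rightarrow> nat \<Rightarrow> real \<Rightarrow> complex" where
  "test_chain u M i y = (\<Prod>l<i. 1 / (u * of_real (1 - q ^ (M - l)))) / qpoch u (Suc M - i) y"

lemma qprimitive_test_chain:
  assumes "i < M" "v > 0"
  shows "qprimitive (test_chain (\<i> * of_real v) M i) (test_chain (\<i> * of_real v) M (Suc i))"
proof -
  let ?u = "\<i> * of_real v"
  obtain n where n: "Suc M - i = Suc n" "Suc M - Suc i = n" "M - i = n" "0 < n"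
    using assms(1) by (metis Suc_diff_le diff_Suc_Suc less_imp_le zero_less_diff)
  let ?c = "\<Prod>l<i. 1 / (?u * of_real (1 - q ^ (M - l)))"
  have lim: "(\<lambda>k. qpoch ?u m (x * q ^ k)) \<longlonglongrightarrow> (\<Prod>k<m. 1 - ?u * of_real 0 * of_real q ^ k)" for m x
    unfolding qpoch_def by (intro tendsto_intros tendsto_of_real tendsto_orbit)
  have nz: "(\<Prod>k<m. 1 - ?u * of_real 0 * of_real q ^ k) \<noteq> 0" for m by simp
  show ?thesis
  proof (rule qprimitiveI)
    fix x
    have r: "1 - q ^ n \<noteq> 0" using one_minus_power_q(1)[OF n(4)] by simp
    have u0: "?u \<noteq> 0" using assms(2) by simp
    have p1: "qpoch ?u (Suc n) x = qpoch ?u n x * (1 - ?u * of_real x * of_real q ^ n)" by (simp add: qpoch_def)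
    have p2: "qpoch ?u (Suc n) x = (1 - ?u * of_real x) * qpoch ?u n (q * x)"
      unfolding qpoch_def by (simp only: prod.lessThan_Suc_shift) (simp add: mult_ac)
    have e1: "1 / qpoch ?u n x = (1 - ?u * of_real x * of_real q ^ n) / qpoch ?u (Suc n) x"
      using qpoch_nonzero[of v "Suc n" x] unfolding p1 by simp
    have e2: "1 / qpoch ?u n (q * x) = (1 - ?u * of_real x) / qpoch ?u (Suc n) x"
      using qpoch_nonzero[of v "Suc n" x] unfolding p2 by simp
    have "1 / qpoch ?u n x - 1 / qpoch ?u n (q * x) = of_real x * (?u * of_real (1 - q ^ n)) / qpoch ?u (Suc n) x"
      unfolding e1 e2 diff_divide_distrib[symmetric] by (simp add: algebra_simps)
    moreover have "test_chain ?u M (Suc i) x - test_chain ?u M (Suc i) (q * x) =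
        ?c * (1 / (?u * of_real (1 - q ^ n))) * (1 / qpoch ?u n x - 1 / qpoch ?u n (q * x))"
      unfolding test_chain_def n(2) prod.lessThan_Suc n(3)
      by (simp only: right_diff_distrib mult_1_right times_divide_eq_right)
    ultimately have "test_chain ?u M (Suc i) x - test_chain ?u M (Suc i) (q * x) =
        ?c * (1 / (?u * of_real (1 - q ^ n))) * (of_real x * (?u * of_real (1 - q ^ n)) / qpoch ?u (Suc n) x)" by simp
    also have "\<dots> = of_real x * (?c / qpoch ?u (Suc n) x)"
    proof -
      have "complex_of_real (1 - q ^ n) \<noteq> 0" using r by (simp only: of_real_eq_0_iff not_False_eq_True)
      then have "?u * complex_of_real (1 - q ^ n) \<noteq> 0" using u0 by simp
      then have "c * (1 / w) * (z * w / p) = z * (c / p)" if "w = ?u * complex_of_real (1 - q ^ n)" for c w z p :: complex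
        using that by simp
      then show ?thesis by blast
    qed
    finally show "test_chain ?u M (Suc i) x - test_chain ?u M (Suc i) (q * x) = of_real x * test_chain ?u M i x"
      unfolding test_chain_def n(1) .
    show "(\<lambda>k. test_chain ?u M (Suc i) (x * q ^ k)) \<longlonglongrightarrow>
       (\<Prod>l<Suc i. 1 / (?u * of_real (1 - q ^ (M - l)))) / (\<Prod>k<Suc M - Suc i. 1 - ?u * of_real 0 * of_real q ^ k)"
      unfolding test_chain_def by (intro tendsto_divide tendsto_const lim nz)
    show "(\<lambda>k. test_chain ?u M i (x * q ^ k)) \<longlonglongrightarrow>
       ?c / (\<Prod>k<Suc M - i. 1 - ?u * of_real 0 * of_real q ^ k)"
      unfolding test_chain_def by (intro tendsto_divide tendsto_const lim nz)
  qed
qed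

text \<open>This function has divided differences in closed form, by \<open>divdiff_geometric\<close>.\<close>

lemma test_chain_last: "test_chain u M M x = 1 / (u ^ M * of_real (qfact M)) * (1 / (1 - u * of_real x))"
proof -
  have "(\<Prod>l<M. 1 - q ^ (M - l)) = qfact M"
    unfolding qfact_def by (rule prod.reindex_bij_witness[where i = "\<lambda>k. M - k" and j = "\<lambda>k. M - k"]) auto
  then have "(\<Prod>l<M. 1 / (u * of_real (1 - q ^ (M - l)))) = 1 / (u ^ M * of_real (qfact M))"
    by (simp add: prod_dividef prod.distrib del: of_real_diff flip: of_real_prod)
  then show ?thesis unfolding test_chain_def by (simp add: qpoch_def)
qed

lemma divdiff_test_chain:
  assumes "finite S" "card S = M + i + 1" "v > 0"
  shows "norm (divdiff S (test_chain (\<i> * of_real v) M M)) = v ^ i / (qfact M * (\<Prod>x\<in>S. norm (1 - \<i> * of_real (v * x))))"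
proof -
  let ?u = "\<i> * complex_of_real v"
  have nz: "1 - ?u * of_real x \<noteq> 0" for x
  proof
    assume "1 - ?u * of_real x = 0"
    then have "norm (1 - \<i> * of_real (v * x)) = 0" by (simp add: mult.assoc)
    then show False using norm_one_minus_imaginary(1)[of "v * x"] by linarith
  qed
  have "S \<noteq> {}" using assms(2) by auto
  then have "divdiff S (test_chain ?u M M) = 1 / (?u ^ M * of_real (qfact M)) * (?u ^ (M + i) / (\<Prod>x\<in>S. 1 - ?u * of_real x))"
    unfolding ext[of "test_chain ?u M M", OF test_chain_last] divdiff_cmult
    using divdiff_geometric[OF assms(1) _ nz] assms(2) by simp
  also have "norm \<dots> = 1 / (v ^ M * qfact M) * (v ^ (M + i) / (\<Prod>x\<in>S. norm (1 - ?u * of_real x)))"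
    using assms(3) qfact_pos(1)[of M] by (simp add: norm_mult norm_divide norm_power prod_norm)
  also have "\<dots> = v ^ i / (qfact M * (\<Prod>x\<in>S. norm (1 - ?u * of_real x)))"
    using assms(3) by (simp add: power_add)
  finally show ?thesis by (simp add: mult.assoc)
qed

section \<open>No mass escapes\<close>

text \<open>The quotient of two different lattice points of the same sign is a power of \<open>q\<close> other than \<open>1\<close>.\<close>

lemma lattice_gap:
  assumes "y \<in> lattice" "b \<in> lattice" "y \<noteq> b"
  shows "(1 - q) * \<bar>b\<bar> \<le> \<bar>y - b\<bar>"
proof (cases "y * b > 0")
  case False
  then have "\<bar>b\<bar> \<le> \<bar>y - b\<bar>" by (auto simp: not_less mult_le_0_iff abs_if split: if_splits)
  moreover have "(1 - q) * \<bar>b\<bar> \<le> 1 * \<bar>b\<bar>" using q by (intro mult_right_mono) auto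
  ultimately show ?thesis by simp
next
  case True
  have gap: "(1 - q) * \<bar>x\<bar> \<le> \<bar>x - z\<bar>" if "z = x * q ^ i" "z \<noteq> x" for x z i
  proof -
    have "q ^ i \<le> q ^ 1" using that by (subst power_decreasing_q) (cases i, auto)
    then have "1 - q \<le> 1 - q ^ i" "0 \<le> 1 - q ^ i" using q by auto
    then have "(1 - q) * \<bar>x\<bar> \<le> \<bar>1 - q ^ i\<bar> * \<bar>x\<bar>" by (intro mult_right_mono) auto
    also have "\<dots> = \<bar>x - z\<bar>" unfolding that(1) by (simp add: algebra_simps flip: abs_mult)
    finally show ?thesis .
  qed
  show ?thesis
  proof (cases "\<bar>y\<bar> \<le> \<bar>b\<bar>")
    case True
    then obtain i where "y = b * q ^ i"
      using lattice_same_sign[OF assms(2,1)] \<open>y * b > 0\<close> by (metis mult.commute)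
    from gap[OF this assms(3)] show ?thesis by (simp add: abs_minus_commute)
  next
    case False
    then obtain i where "b = y * q ^ i"
      using lattice_same_sign[OF assms(1,2) \<open>y * b > 0\<close>] by auto
    from gap[OF this assms(3)[symmetric]] have "(1 - q) * \<bar>y\<bar> \<le> \<bar>y - b\<bar>" .
    moreover have "(1 - q) * \<bar>b\<bar> \<le> (1 - q) * \<bar>y\<bar>" using False q by (intro mult_left_mono) auto
    ultimately show ?thesis by linarith
  qed
qed

text \<open>The inverse of the Vandermonde product of \<open>insert y B\<close>, with the new point taken last.\<close>

definition insertion_weight :: "real set \<Rightarrow> real \<Rightarrow> real" where
  "insertion_weight B y = 1 / (vandermonde B * (\<Prod>b\<in>B. y - b))"

lemma insertion_weight_bounded:
  assumes "B \<in> configs' k"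
  obtains C where "C > 0" "\<And>y. y \<in> lattice - B \<Longrightarrow> \<bar>insertion_weight B y\<bar> \<le> C"
proof -
  let ?p = "\<Prod>b\<in>B. (1 - q) * \<bar>b\<bar>"
  have p: "?p > 0" using configs_memD(1)[OF assms] lattice_nonzero q by (intro prod_pos) auto
  have V: "vandermonde B > 0" by (rule vandermonde_positive)
  have "\<bar>insertion_weight B y\<bar> \<le> 1 / (vandermonde B * ?p)" if y: "y \<in> lattice - B" for y
  proof -
    have "?p \<le> (\<Prod>b\<in>B. \<bar>y - b\<bar>)"
      by (intro prod_mono) (use lattice_gap y configs_memD(1)[OF assms] q in auto)
    then have "vandermonde B * ?p \<le> vandermonde B * (\<Prod>b\<in>B. \<bar>y - b\<bar>)" using V by (intro mult_left_mono) auto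
    then have "1 / (vandermonde B * (\<Prod>b\<in>B. \<bar>y - b\<bar>)) \<le> 1 / (vandermonde B * ?p)"
      using V p by (intro divide_left_mono) (auto intro: mult_pos_pos less_le_trans)
    then show ?thesis using V by (simp add: insertion_weight_def abs_mult abs_prod)
  qed
  then show ?thesis using that[of "1 / (vandermonde B * ?p)"] p V by simp
qed

text \<open>Replacing one point mass by a general function \<open>\<phi>\<close> selects the configurations that contain \<open>B\<close> and
  evaluates \<open>\<phi>\<close> at their one remaining point. In this way the general theory yields information on
  a single variable.\<close>

lemma alternant_ratio_insertion:
  fixes \<phi> :: "real \<Rightarrow> complex"
  assumes B: "B \<in> configs' k" and f: "f = (\<lambda>j. if j < k then (\<lambda>x. of_real (delta_chain (elt B j) 0 x)) else \<phi>)"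
  shows "y \<notin> B \<Longrightarrow> alternant_ratio f (insert y B) = of_real (insertion_weight B y) * \<phi> y"
    and "finite Y \<Longrightarrow> card Y = Suc k \<Longrightarrow> \<not> B \<subseteq> Y \<Longrightarrow> alternant_ratio f Y = 0"
proof -
  have fB: "finite B" "card B = k" using configs_memD[OF B] by auto
  have e: "bij_betw (elt B) {..<k} B" using bij_betw_elt[OF fB(1)] fB by simp
  {
    assume y: "y \<notin> B"
    define p where "p = (\<lambda>i. if i < k then elt B i else y)"
    have "bij_betw p {..<k} B" using e by (rule bij_betw_cong[THEN iffD1, rotated]) (simp add: p_def)
    moreover have "p k = y" by (simp add: p_def)
    ultimately have bij: "bij_betw p {..<Suc k} (insert y B)"
      using y notIn_Un_bij_betw[of k "{..<k}" p B] by (simp add: lessThan_Suc)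
    have "alternant (Suc k) f p = (\<Prod>i<Suc k. f i (p i))"
      unfolding alternant_def
    proof (rule detf_upper_triangular)
      fix i j assume ij: "j < i" "i < Suc k"
      then have "elt B j \<in> B" using e by (auto simp: bij_betw_def)
      moreover have "i < k \<Longrightarrow> elt B i \<noteq> elt B j" using ij inj_on_eq_iff[OF bij_betw_imp_inj_on[OF e], of i j] by simp
      ultimately show "f j (p i) = 0" using ij y by (auto simp: f p_def delta_chain_def)
    qed
    also have "\<dots> = \<phi> y" by (simp add: f p_def delta_chain_def)
    finally have num: "alternant (Suc k) f p = \<phi> y" .
    have "alternant (Suc k) monomial p = (\<Prod>j<Suc k. \<Prod>i<j. of_real (p j - p i))"
      by (rule alternant_newton(2)[OF bij_betw_imp_inj_on[OF bij]])
    also have "\<dots> = (\<Prod>j<k. \<Prod>i<j. of_real (elt B j - elt B i)) * (\<Prod>i<k. of_real (y - elt B i))"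
      by (simp add: p_def)
    also have "(\<Prod>j<k. \<Prod>i<j. complex_of_real (elt B j - elt B i)) = of_real (vandermonde B)"
      by (simp add: vandermonde_def fB)
    also have "(\<Prod>i<k. complex_of_real (y - elt B i)) = of_real (\<Prod>b\<in>B. y - b)"
      using prod.reindex_bij_betw[OF e, of "\<lambda>b. y - b"] by (metis (no_types, lifting) of_real_prod prod.cong)
    finally show "alternant_ratio f (insert y B) = of_real (insertion_weight B y) * \<phi> y"
      unfolding alternant_ratio_enumeration[OF bij, symmetric] num by (simp add: insertion_weight_def)
  }
  {
    assume Y: "finite Y" "card Y = Suc k" "\<not> B \<subseteq> Y"
    then obtain x where x: "x \<in> B" "x \<notin> Y" by auto
    then have "x \<in> elt B ` {..<k}" using e by (simp add: bij_betw_def)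
    then obtain j where j: "j < k" "elt B j \<notin> Y" using x by auto
    have "alternant (Suc k) f (elt Y) = 0"
      unfolding alternant_def
    proof (rule detf_zero_column)
      fix i assume "i < Suc k"
      then have "elt Y i \<in> Y" using elt_mem[OF Y(1)] Y(2) by simp
      then have "elt Y i \<noteq> elt B j" using j by auto
      then show "f j (elt Y i) = 0" using j by (simp add: f delta_chain_def)
    qed (use j in simp)
    then show "alternant_ratio f Y = 0" using Y by (simp add: alternant_ratio_def)
  }
qed

lemma insertions:
  assumes B: "B \<in> configs' k"
  shows "inj_on (\<lambda>y. insert y B) (lattice - B)"
    and "(\<lambda>y. insert y B) ` (lattice - B) = {Y \<in> configs' (Suc k). B \<subseteq> Y}"
proof -
  have fB: "finite B" "card B = k" "B \<subseteq> lattice" using configs_memD[OF B] by auto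
  show "inj_on (\<lambda>y. insert y B) (lattice - B)" by (auto simp: inj_on_def)
  show "(\<lambda>y. insert y B) ` (lattice - B) = {Y \<in> configs' (Suc k). B \<subseteq> Y}"
  proof (intro equalityI subsetI)
    fix Y assume "Y \<in> (\<lambda>y. insert y B) ` (lattice - B)"
    then show "Y \<in> {Y \<in> configs' (Suc k). B \<subseteq> Y}" using fB by (auto simp: configs_def)
  next
    fix Y assume "Y \<in> {Y \<in> configs' (Suc k). B \<subseteq> Y}"
    then have Y: "finite Y" "card Y = Suc k" "Y \<subseteq> lattice" "B \<subseteq> Y" using configs_memD by auto
    then have "card (Y - B) = 1" using card_Diff_subset[OF fB(1) Y(4)] fB(2) by simp
    then obtain y where "Y - B = {y}" by (auto simp: card_1_singleton_iff)
    then have "Y = insert y B" "y \<in> lattice - B" using Y by auto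
    then show "Y \<in> (\<lambda>y. insert y B) ` (lattice - B)" by blast
  qed
qed

lemma link_insertions_summable:
  assumes B: "B \<in> configs' k" and X: "X \<in> configs' N" and k: "Suc k \<le> N"
    and A: "A \<subseteq> lattice - B"
  shows "(\<lambda>y. link N (Suc k) X (insert y B)) summable_on A"
    and "infsum (\<lambda>y. link N (Suc k) X (insert y B)) A \<le> 1"
proof -
  let ?p = "\<lambda>y. link N (Suc k) X (insert y B)"
  note L = link_has_sum[OF k X]
  have inj: "inj_on (\<lambda>y. insert y B) A" using insertions(1)[OF B] A by (rule inj_on_subset)
  have sub: "(\<lambda>y. insert y B) ` A \<subseteq> configs' (Suc k)" using insertions(2)[OF B] A by blast
  have sm: "link N (Suc k) X summable_on (\<lambda>y. insert y B) ` A"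
    using has_sum_imp_summable[OF L] sub by (rule summable_on_subset)
  then show "?p summable_on A" by (simp add: summable_on_reindex[OF inj] o_def)
  have "infsum (link N (Suc k) X) ((\<lambda>y. insert y B) ` A) \<le> infsum (link N (Suc k) X) (configs' (Suc k))"
    using sm has_sum_imp_summable[OF L] sub link_nonneg by (intro infsum_mono2) auto
  then show "infsum ?p A \<le> 1"
    using infsumI[OF L] by (simp add: infsum_reindex[OF inj] o_def)
qed

text \<open>\<open>link_divdiff\<close> for the point masses at the elements of \<open>B\<close> together with the test function.\<close>

lemma test_identity:
  assumes B: "B \<in> configs' k" and X: "X \<in> configs' (Suc k + M)" and v: "v > 0"
    and ts: "distinct ts" "length ts = Suc k" "set ts \<subseteq> X"
  shows "((\<lambda>y. of_real (link (Suc k + M) (Suc k) X (insert y B) * insertion_weight B y) / qpoch (\<i> * of_real v) (Suc M) y) has_sum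
     of_real (link_const (Suc k) M) * detf (Suc k) (\<lambda>i j. divdiff (X - set (drop (Suc i) ts))
        (if j < k then (\<lambda>x. of_real (delta_chain (elt B j) M x)) else test_chain (\<i> * of_real v) M M))) (lattice - B)"
proof -
  let ?u = "\<i> * complex_of_real v"
  define \<psi> where "\<psi> = (\<lambda>j i. if j < k then (\<lambda>x. complex_of_real (delta_chain (elt B j) i x)) else test_chain ?u M i)"
  let ?f = "\<lambda>j. \<psi> j 0"
  let ?\<phi> = "test_chain ?u M 0"
  have \<phi>: "?\<phi> y = 1 / qpoch ?u (Suc M) y" for y by (simp add: test_chain_def)
  have f: "?f = (\<lambda>j. if j < k then (\<lambda>x. of_real (delta_chain (elt B j) 0 x)) else ?\<phi>)"
    by (auto simp: \<psi>_def fun_eq_iff)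
  have ins: "alternant_ratio ?f (insert y B) = of_real (insertion_weight B y) * ?\<phi> y" if "y \<in> lattice - B" for y
    by (rule alternant_ratio_insertion(1)[OF B f]) (use that in auto)
  have other: "alternant_ratio ?f Y = 0" if "Y \<in> configs' (Suc k)" "\<not> B \<subseteq> Y" for Y
    by (rule alternant_ratio_insertion(2)[OF B f]) (use that configs_memD in auto)
  obtain C where C: "C > 0" "\<And>y. y \<in> lattice - B \<Longrightarrow> \<bar>insertion_weight B y\<bar> \<le> C"
    using insertion_weight_bounded[OF B] by blast
  have bound: "norm (alternant_ratio ?f Y) \<le> C" if Y: "Y \<in> configs' (Suc k)" for Y
  proof (cases "B \<subseteq> Y")
    case True
    then have "Y \<in> (\<lambda>y. insert y B) ` (lattice - B)" using insertions(2)[OF B] Y by blast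
    then obtain y where y: "y \<in> lattice - B" "Y = insert y B" by blast
    have "1 / norm (qpoch ?u (Suc M) y) \<le> 1 / 1" using norm_qpoch[of v "Suc M" y] by (intro divide_left_mono) auto
    then have "norm (?\<phi> y) \<le> 1" unfolding \<phi> by (simp add: norm_divide)
    then have "\<bar>insertion_weight B y\<bar> * norm (?\<phi> y) \<le> C * 1"
      using C y by (intro mult_mono) auto
    then show ?thesis using ins[OF y(1)] y(2) by (simp add: norm_mult)
  next
    case False
    then show ?thesis using other[OF Y] C by simp
  qed
  have prim: "qprimitive (\<psi> j i) (\<psi> j (Suc i))" if "i < M" "j < Suc k" for i j
    using that qprimitive_test_chain[OF that(1) v] qprimitive_delta_chain[OF configs_elt(2)[OF B]]
    by (auto simp: \<psi>_def)
  let ?R = "of_real (link_const (Suc k) M) * detf (Suc k) (\<lambda>i j. divdiff (X - set (drop (Suc i) ts)) (\<psi> j M))"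
  have "((\<lambda>Y. of_real (link (Suc k + M) (Suc k) X Y) * alternant_ratio ?f Y) has_sum ?R) (configs' (Suc k))"
    by (rule link_divdiff[OF X ts prim bound])
  also have "((\<lambda>Y. of_real (link (Suc k + M) (Suc k) X Y) * alternant_ratio ?f Y) has_sum ?R) (configs' (Suc k)) \<longleftrightarrow>
     ((\<lambda>Y. of_real (link (Suc k + M) (Suc k) X Y) * alternant_ratio ?f Y) has_sum ?R) ((\<lambda>y. insert y B) ` (lattice - B))"
    unfolding insertions(2)[OF B] by (rule has_sum_cong_neutral) (auto simp: other)
  also have "\<dots> \<longleftrightarrow> ((\<lambda>y. of_real (link (Suc k + M) (Suc k) X (insert y B)) * alternant_ratio ?f (insert y B)) has_sum ?R) (lattice - B)"
    by (simp add: has_sum_reindex[OF insertions(1)[OF B]] o_def)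
  also have "\<dots> \<longleftrightarrow> ((\<lambda>y. of_real (link (Suc k + M) (Suc k) X (insert y B) * insertion_weight B y) / qpoch ?u (Suc M) y) has_sum ?R) (lattice - B)"
    by (rule has_sum_cong) (simp add: ins \<phi>)
  finally show ?thesis by (simp add: \<psi>_def)
qed

lemma link_const_le_1: "link_const K m \<le> 1"
proof -
  have "qfact (K + i) \<le> qfact i" for i using qfact_antimono by (simp add: decseq_def)
  then show ?thesis unfolding link_const_def
    by (intro prod_le_1) (use qfact_pos(1) in \<open>auto simp: less_imp_le\<close>)
qed

text \<open>In the column of the test function, the entry in row \<open>i\<close> is, up to a bounded factor,
  \<open>v\<^sup>i\<close> divided by a product of factors
  \<open>\<bar>1 - \<i> v x\<bar>\<close> over elements of \<open>Xs N\<close>. Since the limit \<open>X\<close> is infinite, more than \<open>i\<close> factors of size \<open>v\<close>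
  are eventually present, and the column is \<open>O(1 / v)\<close>. This is where a finite limit configuration
  would fail.\<close>

lemma test_sum_small:
  assumes X: "X \<in> inf_configs q zm zp" and conv: "outer_converges Xs X"
    and Xs: "\<And>N. 1 \<le> N \<Longrightarrow> Xs N \<in> configs' N" and B: "B \<in> configs' k"
  obtains C where "\<forall>\<^sub>F N in sequentially. \<forall>v\<ge>1. \<exists>R. norm R \<le> C / v \<and>
     ((\<lambda>y. of_real (link N (Suc k) (Xs N) (insert y B) * insertion_weight B y) / qpoch (\<i> * of_real v) (N - k) y) has_sum R) (lattice - B)"
proof -
  have X': "X \<subseteq> lattice" "infinite X" "bounded X" using X by (auto simp: inf_configs_def)
  obtain ts where ts: "distinct ts" "length ts = Suc k" "set ts \<subseteq> X" using distinct_list_in_infinite_set[OF X'(2)] .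
  have "infinite (X - set ts)" using X'(2) by simp
  \<comment> \<open>\<open>k + 1\<close> factors outweigh the powers \<open>v\<^sup>i\<close> of all rows \<open>i \<le> k\<close>\<close>
  then obtain F where F: "F \<subseteq> X - set ts" "finite F" "card F = Suc k" using infinite_arbitrarily_large by blast
  have F0: "x \<noteq> 0" if "x \<in> F" for x using F(1) X'(1) that lattice_nonzero by blast
  obtain c where c: "c > 0" "\<And>n. c \<le> qfact n" using qfact_lower_bound by blast
  let ?e = "\<lambda>N i j. divdiff (Xs N - set (drop (Suc i) ts)) (\<lambda>x. complex_of_real (delta_chain (elt B j) (N - Suc k) x))"
  have ex: "\<exists>D. \<forall>N. norm (?e N i j) \<le> D" if ij: "i < Suc k" "j < k" for i j
  proof -
    have sub: "set (drop (Suc i) ts) \<subseteq> X" using ts(3) set_drop_subset by fast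
    obtain l where "(\<lambda>N. ?e N i j) \<longlonglongrightarrow> l"
      by (rule entry_converges[OF X'(1,3) conv Xs _ sub card_set_drop[OF ts(1,2) ij(1)] configs_elt(2)[OF B ij(2)]]) auto
    then show ?thesis by (rule bounded_of_tendsto)
  qed
  define D where "D = (\<lambda>i j. SOME D. \<forall>N. norm (?e N i j) \<le> D)"
  have D: "norm (?e N i j) \<le> D i j" if "i < Suc k" "j < k" for N i j
    using someI_ex[OF ex[OF that]] unfolding D_def by blast
  define E where "E = (\<lambda>j. \<Sum>i<Suc k. \<bar>D i j\<bar>)"
  have E: "norm (?e N i j) \<le> E j" if "i < Suc k" "j < k" for N i j
  proof -
    have "\<bar>D i j\<bar> \<le> E j" unfolding E_def using that by (intro member_le_sum) auto
    then show ?thesis using D[OF that, of N] by linarith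
  qed
  have E0: "E j \<ge> 0" for j unfolding E_def by (intro sum_nonneg) auto
  define P where "P = c * (\<Prod>x\<in>F. \<bar>x\<bar>)"
  have P: "P > 0" unfolding P_def using c(1) F0 by (auto intro!: mult_pos_pos prod_pos)
  define C where "C = fact (Suc k) * (\<Prod>j<k. E j) / P"
  have ev: "\<forall>\<^sub>F N in sequentially. set ts \<union> F \<subseteq> Xs N"
    by (rule outer_converges_finite_subset[OF conv]) (use ts(3) F X'(1) lattice_zero_notin in auto)
  have "\<forall>\<^sub>F N in sequentially. \<forall>v\<ge>1. \<exists>R. norm R \<le> C / v \<and>
     ((\<lambda>y. of_real (link N (Suc k) (Xs N) (insert y B) * insertion_weight B y) / qpoch (\<i> * of_real v) (N - k) y) has_sum R) (lattice - B)"
    using ev eventually_ge_at_top[of "Suc k"]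
  proof eventually_elim
    case (elim N)
    define M where "M = N - Suc k"
    have N: "N = Suc k + M" "N - k = Suc M" using elim(2) by (auto simp: M_def)
    have XN: "Xs N \<in> configs' (Suc k + M)" using Xs[of N] N by simp
    have fN: "finite (Xs N)" "card (Xs N) = Suc k + M" using configs_memD[OF XN] by auto
    have tsN: "set ts \<subseteq> Xs N" using elim(1) by auto
    show ?case
    proof (intro allI impI)
      fix v :: real assume v: "1 \<le> v"
      let ?u = "\<i> * complex_of_real v"
      let ?S = "\<lambda>i. Xs N - set (drop (Suc i) ts)"
      let ?A = "\<lambda>i j. divdiff (?S i) (if j < k then (\<lambda>x. of_real (delta_chain (elt B j) M x)) else test_chain ?u M M)"
      have last: "norm (divdiff (?S i) (test_chain ?u M M)) \<le> 1 / (P * v)" if i: "i < Suc k" for i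
      proof -
        have sub: "set (drop (Suc i) ts) \<subseteq> Xs N" using tsN set_drop_subset by fast
        have card: "card (?S i) = M + i + 1"
          using card_Diff_subset[OF _ sub] card_set_drop[OF ts(1,2) i] fN by simp
        have FS: "F \<subseteq> ?S i" using F(1) elim(1) set_drop_subset[of "Suc i" ts] by blast
        have "v ^ Suc k * (\<Prod>x\<in>F. \<bar>x\<bar>) = (\<Prod>x\<in>F. \<bar>v * x\<bar>)"
          using v F(3) by (simp add: abs_mult prod.distrib)
        also have "\<dots> \<le> (\<Prod>x\<in>F. norm (1 - \<i> * of_real (v * x)))"
          by (intro prod_mono conjI abs_ge_zero norm_one_minus_imaginary(2))
        also have "\<dots> \<le> (\<Prod>x\<in>?S i. norm (1 - \<i> * of_real (v * x)))"
          by (rule prod_mono2) (use fN FS norm_one_minus_imaginary(1) order_trans[OF zero_le_one norm_one_minus_imaginary(1)] in blast)+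
        finally have p: "v ^ Suc k * (\<Prod>x\<in>F. \<bar>x\<bar>) \<le> (\<Prod>x\<in>?S i. norm (1 - \<i> * of_real (v * x)))" .
        have "P * v * v ^ i \<le> P * v ^ Suc k"
        proof -
          have "v * v ^ i \<le> v ^ Suc k" using v i power_increasing[of "Suc i" "Suc k" v] by simp
          then show ?thesis using P by (simp add: mult.assoc)
        qed
        also have "\<dots> = c * (v ^ Suc k * (\<Prod>x\<in>F. \<bar>x\<bar>))" by (simp add: P_def)
        also have "\<dots> \<le> qfact M * (\<Prod>x\<in>?S i. norm (1 - \<i> * of_real (v * x)))"
          using c p v qfact_pos(1)[of M] by (intro mult_mono) (auto intro!: mult_nonneg_nonneg prod_nonneg)
        finally have "P * v * v ^ i \<le> qfact M * (\<Prod>x\<in>?S i. norm (1 - \<i> * of_real (v * x)))" .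
        moreover have "0 < P * v * v ^ i" using P v by simp
        ultimately have "v ^ i / (qfact M * (\<Prod>x\<in>?S i. norm (1 - \<i> * of_real (v * x)))) \<le> v ^ i / (P * v * v ^ i)"
          using v by (intro divide_left_mono) (auto intro!: mult_pos_pos)
        also have "\<dots> = 1 / (P * v)" using v by simp
        finally show ?thesis using divdiff_test_chain[OF _ card, of v] fN v by simp
      qed
      have "norm (?A i j) \<le> (if j < k then E j else 1 / (P * v))" if "i < Suc k" "j < Suc k" for i j
        using last[OF that(1)] E[OF that(1), of j N] by (simp add: M_def)
      then have "norm (detf (Suc k) ?A) \<le> fact (Suc k) * (\<Prod>j<Suc k. if j < k then E j else 1 / (P * v))"
        by (rule norm_detf_le)
      also have "\<dots> = C / v" by (simp add: C_def)
      finally have d: "norm (detf (Suc k) ?A) \<le> C / v" .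
      have "norm (of_real (link_const (Suc k) M) * detf (Suc k) ?A) = link_const (Suc k) M * norm (detf (Suc k) ?A)"
        using link_const_pos[of "Suc k" M] by (simp add: norm_mult)
      also have "\<dots> \<le> norm (detf (Suc k) ?A)"
        using link_const_pos[of "Suc k" M] link_const_le_1[of "Suc k" M] by (simp add: mult_left_le_one_le)
      also note d
      finally have R: "norm (of_real (link_const (Suc k) M) * detf (Suc k) ?A) \<le> C / v" .
      show "\<exists>R. norm R \<le> C / v \<and>
         ((\<lambda>y. of_real (link N (Suc k) (Xs N) (insert y B) * insertion_weight B y) / qpoch ?u (N - k) y) has_sum R) (lattice - B)"
        using R test_identity[OF B XN _ ts(1,2) tsN, of v] v unfolding N by auto
    qed
  qed
  then show ?thesis by (rule that)
qed

lemma insertion_weight_near_zero: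
  assumes B: "B \<in> configs' k" and v: "v \<ge> 0" and \<epsilon>: "\<epsilon> > 0"
  obtains \<delta> where "\<delta> > 0" "\<And>y n. \<bar>y\<bar> < \<delta> \<Longrightarrow>
     norm (of_real (insertion_weight B y) / qpoch (\<i> * of_real v) n y - of_real (insertion_weight B 0)) \<le> \<epsilon>"
proof -
  let ?w = "insertion_weight B"
  have nz: "vandermonde B * (\<Prod>b\<in>B. 0 - b) \<noteq> 0"
    using vandermonde_positive[of B] configs_memD[OF B] lattice_zero_notin by auto
  have "((\<lambda>y. y) \<longlongrightarrow> 0) (nhds (0::real))" by (simp add: filterlim_def)
  then have w: "(?w \<longlongrightarrow> ?w 0) (nhds 0)"
    unfolding insertion_weight_def by (intro tendsto_intros nz)
  have "((\<lambda>y. \<bar>?w y\<bar> * (exp (v * \<bar>y\<bar> / (1 - q)) - 1) + \<bar>?w y - ?w 0\<bar>) \<longlongrightarrow>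
      \<bar>?w 0\<bar> * (exp (v * \<bar>0\<bar> / (1 - q)) - 1) + \<bar>?w 0 - ?w 0\<bar>) (nhds 0)"
    using q by (intro tendsto_intros w) (auto simp: filterlim_def)
  then have "\<forall>\<^sub>F y in nhds 0. \<bar>?w y\<bar> * (exp (v * \<bar>y\<bar> / (1 - q)) - 1) + \<bar>?w y - ?w 0\<bar> < \<epsilon>"
    by (rule order_tendstoD(2)) (use \<epsilon> in simp)
  then obtain \<delta> where \<delta>: "\<delta> > 0" "\<And>y. \<bar>y\<bar> < \<delta> \<Longrightarrow> \<bar>?w y\<bar> * (exp (v * \<bar>y\<bar> / (1 - q)) - 1) + \<bar>?w y - ?w 0\<bar> < \<epsilon>"
    unfolding eventually_nhds_metric by auto
  show ?thesis
  proof (rule that[OF \<delta>(1)])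
    fix y n assume y: "\<bar>y\<bar> < \<delta>"
    let ?P = "qpoch (\<i> * of_real v) n y"
    have "of_real (?w y) / ?P - of_real (?w 0) = of_real (?w y) * (1 / ?P - 1) + of_real (?w y - ?w 0)"
      by (simp add: algebra_simps)
    then have "norm (of_real (?w y) / ?P - of_real (?w 0)) \<le> \<bar>?w y\<bar> * norm (1 / ?P - 1) + \<bar>?w y - ?w 0\<bar>"
      using norm_triangle_ineq[of "of_real (?w y) * (1 / ?P - 1)" "of_real (?w y - ?w 0)"]
      by (simp only: norm_mult norm_of_real)
    also have "\<dots> \<le> \<bar>?w y\<bar> * (exp (v * \<bar>y\<bar> / (1 - q)) - 1) + \<bar>?w y - ?w 0\<bar>"
      using qpoch_near_1[OF v, of n y] by (intro add_right_mono mult_left_mono) auto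
    also have "\<dots> \<le> \<epsilon>" using \<delta>(2)[OF y] by simp
    finally show "norm (of_real (?w y) / ?P - of_real (?w 0)) \<le> \<epsilon>" .
  qed
qed

text \<open>The test function is \<open>1\<close> at \<open>0\<close> and small away from \<open>0\<close> when \<open>v\<close> is large, while its mean is \<open>O(1 / v)\<close> by
  \<open>test_sum_small\<close>; so there is little mass near \<open>0\<close>. Three ranges of \<open>y\<close> are distinguished. On the far
  one the test function is small. On the middle one, which is finite, the entries are close to
  their limits, and those have a small sum. On the near one the test function is almost constant, so
  that the sum there is essentially the mass in question.\<close>

lemma insertion_mass_vanishes:
  assumes X: "X \<in> inf_configs q zm zp" and conv: "outer_converges Xs X"
    and Xs: "\<And>N. 1 \<le> N \<Longrightarrow> Xs N \<in> configs' N" and B: "B \<in> configs' k" and \<epsilon>: "\<epsilon> > 0"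
  obtains \<delta> where "\<delta> > 0" "\<forall>\<^sub>F N in sequentially.
     infsum (\<lambda>y. link N (Suc k) (Xs N) (insert y B)) {y \<in> lattice - B. \<bar>y\<bar> < \<delta>} \<le> \<epsilon>"
proof -
  let ?A = "lattice - B"
  let ?p = "\<lambda>N y. link N (Suc k) (Xs N) (insert y B)"
  let ?w = "insertion_weight B"
  have ins: "insert y B \<in> configs' (Suc k)" if "y \<in> ?A" for y
    using insertions(2)[OF B] that by blast
  obtain C where C: "C > 0" "\<And>y. y \<in> ?A \<Longrightarrow> \<bar>?w y\<bar> \<le> C" using insertion_weight_bounded[OF B] by blast
  have w0: "\<bar>?w 0\<bar> > 0"
    using vandermonde_positive[of B] configs_memD[OF B] lattice_zero_notin by (auto simp: insertion_weight_def)
  \<comment> \<open>the four errors collected at the end add up to \<open>(3 + 2 * C) * \<eta>\<close>\<close>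
  define \<eta> where "\<eta> = \<epsilon> * \<bar>?w 0\<bar> / (3 + 2 * C)"
  have \<eta>: "\<eta> > 0" using \<epsilon> w0 C(1) by (simp add: \<eta>_def)
  define pl where "pl = (\<lambda>y. lim (\<lambda>N. ?p N y))"
  have pl: "(\<lambda>N. ?p N y) \<longlonglongrightarrow> pl y" if y: "y \<in> ?A" for y
  proof -
    obtain l where "(\<lambda>N. ?p N y) \<longlonglongrightarrow> l" using link_converges[OF X conv Xs ins[OF y]] by blast
    then show ?thesis unfolding pl_def by (simp add: limI)
  qed
  have pl0: "0 \<le> pl y" if "y \<in> ?A" for y
    by (rule LIMSEQ_le_const[OF pl[OF that]]) (auto simp: link_nonneg)
  have sum_le: "sum (?p N) S \<le> 1" if "finite S" "S \<subseteq> ?A" "Suc k \<le> N" for S N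
    using link_insertions_summable(2)[OF B Xs[of N] that(3,2)] that by simp
  have "pl summable_on ?A"
  proof (rule nonneg_bdd_above_summable_on[OF pl0])
    show "bdd_above (sum pl ` {F. F \<subseteq> ?A \<and> finite F})"
    proof (rule bdd_aboveI2)
      fix S assume S: "S \<in> {F. F \<subseteq> ?A \<and> finite F}"
      have "(\<lambda>N. sum (?p N) S) \<longlonglongrightarrow> sum pl S" by (intro tendsto_sum pl) (use S in auto)
      then show "sum pl S \<le> 1"
        by (rule LIMSEQ_le_const2) (use sum_le S in blast)
    qed
  qed
  then obtain \<delta>1 where \<delta>1: "\<delta>1 > 0" "\<And>S. finite S \<Longrightarrow> S \<subseteq> {y \<in> ?A. \<bar>y\<bar> < \<delta>1} \<Longrightarrow> sum pl S \<le> \<eta>"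
    using summable_small_tail[of pl ?A \<eta>] pl0 lattice_zero_notin \<eta> by blast
  obtain C1 where C1: "\<forall>\<^sub>F N in sequentially. \<forall>v\<ge>1. \<exists>R. norm R \<le> C1 / v \<and>
     ((\<lambda>y. of_real (?p N y * ?w y) / qpoch (\<i> * of_real v) (N - k) y) has_sum R) ?A"
    using test_sum_small[OF X conv Xs B] by blast
  \<comment> \<open>large enough for the mean and for the values on the far range\<close>
  define v where "v = 1 + \<bar>C1\<bar> / \<eta> + C / (\<delta>1 * \<eta>)"
  have v: "v \<ge> 1" using \<eta> C(1) \<delta>1(1) by (simp add: v_def)
  have v1: "C1 / v \<le> \<eta>"
  proof -
    have "\<bar>C1\<bar> / \<eta> \<le> v" using \<eta> C(1) \<delta>1(1) by (simp add: v_def)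
    then have "\<bar>C1\<bar> \<le> \<eta> * v" using \<eta> by (simp add: field_simps)
    then show ?thesis using v by (simp add: pos_divide_le_eq)
  qed
  have v2: "C / (v * \<delta>1) \<le> \<eta>"
  proof -
    have "C / (\<delta>1 * \<eta>) \<le> v" using \<eta> by (simp add: v_def)
    then have "C \<le> v * (\<delta>1 * \<eta>)" using \<eta> \<delta>1(1) by (simp add: pos_divide_le_eq)
    then show ?thesis using v \<delta>1(1) by (simp add: pos_divide_le_eq mult_ac)
  qed
  obtain \<delta>0 where \<delta>0: "\<delta>0 > 0" "\<And>y n. \<bar>y\<bar> < \<delta>0 \<Longrightarrow>
     norm (of_real (?w y) / qpoch (\<i> * of_real v) n y - of_real (?w 0)) \<le> \<eta>"
    by (rule insertion_weight_near_zero[OF B order_trans[OF zero_le_one v] \<eta>]) (rule that)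
  define \<delta> where "\<delta> = min \<delta>0 \<delta>1"
  have \<delta>: "\<delta> > 0" "\<delta> \<le> \<delta>0" "\<delta> \<le> \<delta>1" using \<delta>0 \<delta>1 by (auto simp: \<delta>_def)
  let ?near = "{y \<in> ?A. \<bar>y\<bar> < \<delta>}"
  let ?mid = "{y \<in> ?A. \<delta> \<le> \<bar>y\<bar> \<and> \<bar>y\<bar> < \<delta>1}"
  let ?far = "{y \<in> ?A. \<delta>1 \<le> \<bar>y\<bar>}"
  have fin1: "finite ?mid" by (rule finite_subset[OF _ finite_annulus[OF \<delta>(1), of \<delta>1]]) auto
  have "(\<lambda>N. sum (?p N) ?mid) \<longlonglongrightarrow> sum pl ?mid" by (intro tendsto_sum pl) auto
  moreover have "sum pl ?mid < 2 * \<eta>" using \<delta>1(2)[OF fin1] \<eta> by fastforce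
  ultimately have mid: "\<forall>\<^sub>F N in sequentially. sum (?p N) ?mid < 2 * \<eta>" by (rule order_tendstoD(2))
  have "\<forall>\<^sub>F N in sequentially. infsum (?p N) ?near \<le> \<epsilon>"
    using mid C1 eventually_ge_at_top[of "Suc k"]
  proof eventually_elim
    case (elim N)
    have XN: "Xs N \<in> configs' N" using Xs elim(3) by simp
    note LS = link_insertions_summable[OF B XN elim(3)]
    let ?g = "\<lambda>y. of_real (?w y) / qpoch (\<i> * of_real v) (N - k) y"
    let ?f = "\<lambda>y. of_real (?p N y) * ?g y"
    obtain R where R: "norm R \<le> C1 / v" "(?f has_sum R) ?A"
      using elim(2) v by (auto simp: mult.assoc)
    have gC: "norm (?g y) \<le> C" if "y \<in> ?A" for y
    proof -
      have "norm (?g y) \<le> \<bar>?w y\<bar> / 1"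
        unfolding norm_divide norm_of_real using norm_qpoch[of v "N - k" y] by (intro divide_left_mono) auto
      then show ?thesis using C(2)[OF that] by simp
    qed
    have f_sum: "?f summable_on S" if "S \<subseteq> ?A" for S
      using has_sum_imp_summable[OF R(2)] that by (rule summable_on_subset)
    have p_sum: "(\<lambda>y. ?p N y * c) summable_on S" if "S \<subseteq> ?A" for S c
      using LS(1)[OF that] by (rule summable_on_cmult_left)
    have bound: "norm (infsum (\<lambda>y. of_real (?p N y) * h y) S) \<le> c"
      if S: "S \<subseteq> ?A" and h: "\<And>y. y \<in> S \<Longrightarrow> norm (h y) \<le> c" and c: "c \<ge> 0"
        and sm: "(\<lambda>y. of_real (?p N y) * h y) summable_on S"
      for S and h :: "real \<Rightarrow> complex" and c
    proof -
      have "norm (infsum (\<lambda>y. of_real (?p N y) * h y) S) \<le> infsum (\<lambda>y. ?p N y * c) S"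
      proof (rule norm_infsum_le[OF has_sum_infsum[OF sm] has_sum_infsum[OF p_sum[OF S]]])
        fix y assume "y \<in> S"
        then show "norm (of_real (?p N y) * h y) \<le> ?p N y * c"
          using h link_nonneg by (simp add: norm_mult mult_left_mono)
      qed
      also have "\<dots> = infsum (?p N) S * c" by (rule infsum_cmult_left')
      also have "\<dots> \<le> 1 * c" using LS(2)[OF S] c by (intro mult_right_mono) auto
      finally show ?thesis by simp
    qed
    have R_split: "R = infsum ?f ?near + (infsum ?f ?mid + infsum ?f ?far)"
    proof -
      have A: "?A = ?near \<union> (?mid \<union> ?far)" using \<delta>(3) by auto
      have "infsum ?f (?near \<union> (?mid \<union> ?far)) = infsum ?f ?near + infsum ?f (?mid \<union> ?far)"
      proof (rule infsum_Un_disjoint)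
        show "?f summable_on ?near" by (rule f_sum) blast
        show "?f summable_on ?mid \<union> ?far" by (rule f_sum) blast
        show "?near \<inter> (?mid \<union> ?far) = {}" using \<delta>(3) by fastforce
      qed
      also have "infsum ?f (?mid \<union> ?far) = infsum ?f ?mid + infsum ?f ?far"
      proof (rule infsum_Un_disjoint)
        show "?f summable_on ?mid" by (rule f_sum) blast
        show "?f summable_on ?far" by (rule f_sum) blast
        show "?mid \<inter> ?far = {}" by fastforce
      qed
      finally have split: "infsum ?f (?near \<union> (?mid \<union> ?far)) = infsum ?f ?near + (infsum ?f ?mid + infsum ?f ?far)" .
      show ?thesis by (rule trans[OF infsumI[OF R(2), symmetric] split[folded A]])
    qed
    have b1: "norm (infsum ?f ?mid) \<le> 2 * C * \<eta>"
    proof -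
      have "norm (infsum ?f ?mid) \<le> (\<Sum>y\<in>?mid. ?p N y * C)"
        unfolding infsum_finite[OF fin1]
      proof (rule sum_norm_le)
        fix y assume "y \<in> ?mid"
        then have "norm (?g y) \<le> C" by (intro gC) blast
        then have "?p N y * norm (?g y) \<le> ?p N y * C" by (intro mult_left_mono link_nonneg)
        then show "norm (?f y) \<le> ?p N y * C"
          by (simp only: norm_mult norm_of_real abs_of_nonneg[OF link_nonneg])
      qed
      also have "\<dots> = sum (?p N) ?mid * C" by (simp add: sum_distrib_right)
      also have "\<dots> \<le> 2 * \<eta> * C" using elim(1) C(1) by (intro mult_right_mono) auto
      finally show ?thesis by (simp add: mult_ac)
    qed
    have b2: "norm (infsum ?f ?far) \<le> \<eta>"
    proof (rule bound)
      show "norm (?g y) \<le> \<eta>" if y: "y \<in> ?far" for y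
      proof -
        have "v * \<delta>1 \<le> \<bar>v * y\<bar>" using y v by (simp add: abs_mult)
        also have "\<dots> \<le> norm (qpoch (\<i> * of_real v) (N - k) y)" using elim(3) by (intro norm_qpoch_ge) auto
        finally have "norm (?g y) \<le> C / (v * \<delta>1)"
          unfolding norm_divide norm_of_real using C y v \<delta>1(1) by (intro frac_le) auto
        then show ?thesis using v2 by simp
      qed
      show "?f summable_on ?far" by (rule f_sum) auto
    qed (use \<eta> in auto)
    have s0: "(\<lambda>y. of_real (?p N y) * (?g y - of_real (?w 0))) summable_on ?near"
    proof -
      have "(\<lambda>y. complex_of_real (?p N y * ?w 0)) summable_on ?near"
        using p_sum[of ?near "?w 0"] by (intro summable_on_of_real) auto
      then have "(\<lambda>y. ?f y + - complex_of_real (?p N y * ?w 0)) summable_on ?near"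
        by (intro summable_on_add f_sum) (auto simp: summable_on_uminus)
      then show ?thesis by (simp add: algebra_simps)
    qed
    have b0: "norm (infsum (\<lambda>y. of_real (?p N y) * (?g y - of_real (?w 0))) ?near) \<le> \<eta>"
    proof (rule bound[OF _ _ _ s0])
      show "norm (?g y - of_real (?w 0)) \<le> \<eta>" if "y \<in> ?near" for y
        by (rule \<delta>0(2)) (use that \<delta>(2) in auto)
    qed (use \<eta> in auto)
    have hs: "((\<lambda>y. complex_of_real (?p N y)) has_sum of_real (infsum (?p N) ?near)) ?near"
      by (rule has_sum_of_real[OF has_sum_infsum[OF LS(1)]]) blast
    have "of_real (infsum (?p N) ?near) * of_real (?w 0) = infsum (\<lambda>y. complex_of_real (?p N y) * of_real (?w 0)) ?near"
      by (rule infsumI[OF has_sum_cmult_left[OF hs], symmetric])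
    also have "\<dots> = infsum (\<lambda>y. ?f y + - (of_real (?p N y) * (?g y - of_real (?w 0)))) ?near"
      by (rule infsum_cong) (simp add: algebra_simps)
    also have "\<dots> = infsum ?f ?near + infsum (\<lambda>y. - (of_real (?p N y) * (?g y - of_real (?w 0)))) ?near"
      by (intro infsum_add f_sum) (use s0 in \<open>auto simp: summable_on_uminus\<close>)
    also have "\<dots> = R - infsum ?f ?mid - infsum ?f ?far - infsum (\<lambda>y. of_real (?p N y) * (?g y - of_real (?w 0))) ?near"
      unfolding R_split infsum_uminus by simp
    finally have eq: "of_real (infsum (?p N) ?near) * of_real (?w 0) =
       R - infsum ?f ?mid - infsum ?f ?far - infsum (\<lambda>y. of_real (?p N y) * (?g y - of_real (?w 0))) ?near" .
    have tri: "norm (a - b - c - d) \<le> norm a + norm b + norm c + norm d" for a b c d :: complex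
      using norm_triangle_ineq4[of "a - b - c" d] norm_triangle_ineq4[of "a - b" c] norm_triangle_ineq4[of a b]
      by linarith
    have "norm (of_real (infsum (?p N) ?near) * complex_of_real (?w 0)) \<le>
       norm R + norm (infsum ?f ?mid) + norm (infsum ?f ?far) + norm (infsum (\<lambda>y. of_real (?p N y) * (?g y - of_real (?w 0))) ?near)"
      unfolding eq by (rule tri)
    also have "\<dots> \<le> \<eta> + 2 * C * \<eta> + \<eta> + \<eta>" using R(1) v1 b1 b2 b0 by linarith
    also have "\<dots> = (3 + 2 * C) * \<eta>" by (simp add: algebra_simps)
    also have "\<dots> = \<epsilon> * \<bar>?w 0\<bar>" using C(1) by (simp add: \<eta>_def)
    finally have "infsum (?p N) ?near * \<bar>?w 0\<bar> \<le> \<epsilon> * \<bar>?w 0\<bar>"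
      using infsum_nonneg[of ?near "?p N"] link_nonneg by (simp add: norm_mult)
    then show ?case using w0 by simp
  qed
  then show ?thesis using that \<delta>(1) by blast
qed

section \<open>Tightness\<close>

text \<open>By \<open>two_small_points\<close> such configurations lead with probability one to level \<open>k\<close> configurations outside
  \<open>F\<close>, so their mass is at most the mass of the complement of \<open>F\<close>.\<close>

lemma two_small_points_mass:
  assumes N: "Suc k \<le> N" "X \<in> configs' N"
    and F: "finite F" "F \<subseteq> configs' k" "\<And>Z z. Z \<in> F \<Longrightarrow> z \<in> Z \<Longrightarrow> \<delta> \<le> \<bar>z\<bar>"
    and S: "finite S" "S \<subseteq> configs' (Suc k)"
      "\<And>Y. Y \<in> S \<Longrightarrow> \<exists>u\<in>Y. \<exists>v\<in>Y. u \<noteq> v \<and> \<bar>u\<bar> < \<delta> \<and> \<bar>v\<bar> < \<delta>"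
  shows "sum (link N (Suc k) X) S \<le> 1 - sum (link N k X) F"
proof -
  let ?p = "link N (Suc k) X"
  \<comment> \<open>the probability to enter \<open>F\<close> in one step\<close>
  define l where "l = (\<lambda>Y. \<Sum>Z\<in>F. link1 k Y Z)"
  have "((\<lambda>Y. \<Sum>Z\<in>F. ?p Y * link1 k Y Z) has_sum (\<Sum>Z\<in>F. link N k X Z)) (configs' (Suc k))"
    using F(1,2)
  proof (induction F)
    case (insert Z F)
    then show ?case using link_coherent[OF N, of Z] by (auto intro!: has_sum_add)
  qed simp
  then have "((\<lambda>Y. ?p Y * l Y) has_sum sum (link N k X) F) (configs' (Suc k))"
    by (simp add: l_def sum_distrib_left)
  from has_sum_add[OF link_has_sum[OF N] has_sum_uminusI[OF this]]
  have hs: "((\<lambda>Y. ?p Y * (1 - l Y)) has_sum (1 - sum (link N k X) F)) (configs' (Suc k))"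
    by (simp add: algebra_simps)
  have l1: "l Y \<le> 1" if "Y \<in> configs' (Suc k)" for Y
    unfolding l_def using finite_sum_le_has_sum[OF link1_has_sum[OF that] F(1,2)] link1_nonneg by auto
  have l0: "l Y = 0" if Y: "Y \<in> S" for Y
    unfolding l_def
  proof (rule sum.neutral, rule ballI, rule ccontr)
    fix Z assume Z: "Z \<in> F" "link1 k Y Z \<noteq> 0"
    obtain u v where uv: "u \<in> Y" "v \<in> Y" "u \<noteq> v" "\<bar>u\<bar> < \<delta>" "\<bar>v\<bar> < \<delta>" using S(3)[OF Y] by blast
    have "Y \<in> configs' (Suc k)" "Z \<in> configs' k" using Y S(2) Z(1) F(2) by auto
    from two_small_points[OF this Z(2) uv] obtain z where "z \<in> Z" "\<bar>z\<bar> < \<delta>" .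
    then show False using F(3)[OF Z(1)] by fastforce
  qed
  have "sum ?p S = sum (\<lambda>Y. ?p Y * (1 - l Y)) S" using l0 by simp
  also have "\<dots> \<le> 1 - sum (link N k X) F"
    by (rule finite_sum_le_has_sum[OF hs S(1,2)]) (use l1 link_nonneg in auto)
  finally show ?thesis .
qed

lemma configs_0: "configs' 0 = {{}}"
  by (auto simp: configs_def)

lemma finite_configs_annulus:
  assumes "0 < \<delta>"
  shows "finite {Y \<in> configs' k. \<forall>y\<in>Y. \<delta> \<le> \<bar>y\<bar> \<and> \<bar>y\<bar> \<le> R}"
  by (rule finite_subset[OF _ finite_Pow_iff[THEN iffD2, OF finite_annulus[OF assms, of R]]])
     (auto simp: configs_def)

text \<open>Induction on the level. Mass that escapes from finite sets must go to configurations with points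
  near \<open>0\<close>, as the supports are bounded. Two or more such points are excluded by the level below
  (\<open>two_small_points_mass\<close>); a single one, next to one of finitely many possible configurations \<open>B\<close> of
  the remaining points, is excluded by \<open>insertion_mass_vanishes\<close>.\<close>

lemma link_tight:
  assumes X: "X \<in> inf_configs q zm zp" and conv: "outer_converges Xs X"
    and Xs: "\<And>N. 1 \<le> N \<Longrightarrow> Xs N \<in> configs' N" and \<epsilon>: "\<epsilon> > 0"
  shows "\<exists>F. finite F \<and> F \<subseteq> configs' K \<and> (\<forall>\<^sub>F N in sequentially. 1 - \<epsilon> \<le> sum (link N K (Xs N)) F)"
  using \<epsilon>
proof (induction K arbitrary: \<epsilon>)
  case 0
  have "\<forall>\<^sub>F N in sequentially. 1 - \<epsilon> \<le> sum (link N 0 (Xs N)) {{}}"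
    using eventually_ge_at_top[of 1]
  proof eventually_elim
    case (elim N)
    have "(link N 0 (Xs N) has_sum 1) {{}}" using link_has_sum[OF _ Xs[OF elim], of 0] by (simp add: configs_0)
    then have "link N 0 (Xs N) {} = 1" by (simp add: has_sum_finite_iff)
    then show ?case using 0 by simp
  qed
  then show ?case by (intro exI[of _ "{{}}"]) (auto simp: configs_0)
next
  case (Suc k)
  have X': "bounded X" using X by (auto simp: inf_configs_def)
  obtain R where R: "R > 0" "\<forall>\<^sub>F N in sequentially. \<forall>x\<in>Xs N. \<bar>x\<bar> \<le> R"
    using outer_converges_bounded[OF conv X'] .
  obtain F where F: "finite F" "F \<subseteq> configs' k" "\<forall>\<^sub>F N in sequentially. 1 - \<epsilon> / 2 \<le> sum (link N k (Xs N)) F"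
    using Suc.IH[of "\<epsilon> / 2"] Suc.prems by auto
  have "finite (\<Union> F)" "0 \<notin> \<Union> F"
    using F(1,2) configs_memD lattice_zero_notin by (blast, blast)
  then obtain \<delta>0 where \<delta>0: "\<delta>0 > 0" "\<And>z. z \<in> \<Union> F \<Longrightarrow> \<delta>0 \<le> \<bar>z\<bar>" using finite_min_abs by blast
  define BB where "BB = {B \<in> configs' k. \<forall>y\<in>B. \<delta>0 \<le> \<bar>y\<bar> \<and> \<bar>y\<bar> \<le> R}"
  have finBB: "finite BB" unfolding BB_def by (rule finite_configs_annulus[OF \<delta>0(1)])
  \<comment> \<open>half of \<open>\<epsilon>\<close> is shared by the finitely many \<open>B\<close>, the other half goes to two points near \<open>0\<close>\<close>
  define \<eta> where "\<eta> = \<epsilon> / (2 * (real (card BB) + 1))"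
  have \<eta>: "\<eta> > 0" using Suc.prems by (simp add: \<eta>_def)
  let ?near = "\<lambda>B \<delta>. {y \<in> lattice - B. \<bar>y\<bar> < \<delta>}"
  let ?q = "\<lambda>N B y. link N (Suc k) (Xs N) (insert y B)"
  have ex_d: "\<exists>\<delta>. \<delta> > 0 \<and> (\<forall>\<^sub>F N in sequentially. infsum (?q N B) (?near B \<delta>) \<le> \<eta>)" if "B \<in> BB" for B
  proof -
    have B: "B \<in> configs' k" using that by (simp add: BB_def)
    show ?thesis by (rule insertion_mass_vanishes[OF X conv Xs B \<eta>]) auto
  qed
  define d where "d = (\<lambda>B. SOME \<delta>. \<delta> > 0 \<and> (\<forall>\<^sub>F N in sequentially. infsum (?q N B) (?near B \<delta>) \<le> \<eta>))"
  have d: "d B > 0" "\<forall>\<^sub>F N in sequentially. infsum (?q N B) (?near B (d B)) \<le> \<eta>" if "B \<in> BB" for B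
    using someI_ex[OF ex_d[OF that]] unfolding d_def by (rule conjunct1, rule conjunct2)
  define \<delta> where "\<delta> = Min (insert \<delta>0 (d ` BB))"
  have \<delta>: "\<delta> > 0" "\<delta> \<le> \<delta>0" "\<And>B. B \<in> BB \<Longrightarrow> \<delta> \<le> d B"
    unfolding \<delta>_def using finBB d(1) \<delta>0(1) by (auto simp: Min_gr_iff)
  define F' where "F' = {Y \<in> configs' (Suc k). \<forall>y\<in>Y. \<delta> \<le> \<bar>y\<bar> \<and> \<bar>y\<bar> \<le> R}"
  have F': "finite F'" "F' \<subseteq> configs' (Suc k)"
    unfolding F'_def using finite_configs_annulus[OF \<delta>(1)] by auto
  have "\<forall>\<^sub>F N in sequentially. \<forall>B\<in>BB. infsum (?q N B) (?near B (d B)) \<le> \<eta>"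
    using d(2) finBB by (intro eventually_ball_finite) auto
  with R(2) F(3) eventually_ge_at_top[of "Suc k"]
  have "\<forall>\<^sub>F N in sequentially. 1 - \<epsilon> \<le> sum (link N (Suc k) (Xs N)) F'"
  proof eventually_elim
    case (elim N)
    let ?p = "link N (Suc k) (Xs N)"
    have XN: "Xs N \<in> configs' N" using Xs elim(3) by simp
    note L = link_has_sum[OF elim(3) XN]
    have hs: "(?p has_sum (1 - sum ?p F')) (configs' (Suc k) - F')"
      using has_sum_Diff[OF L has_sum_finite[OF F'(1)] F'(2)] .
    have "1 - sum ?p F' \<le> \<epsilon>"
    proof (rule has_sum_le_finite_sums[OF hs])
      fix S assume S: "finite S" "S \<subseteq> configs' (Suc k) - F'"
      \<comment> \<open>\<open>S1\<close> has two points near \<open>0\<close>; outside of it exactly one point is\<close>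
      define S1 where "S1 = {Y \<in> S. \<exists>u\<in>Y. \<exists>v\<in>Y. u \<noteq> v \<and> \<bar>u\<bar> < \<delta>0 \<and> \<bar>v\<bar> < \<delta>0}"
      define S2 where "S2 = {Y \<in> S - S1. ?p Y \<noteq> 0}"
      have fin: "finite S1" "finite S2" using S(1) by (auto simp: S1_def S2_def)
      have "sum ?p S = sum ?p (S1 \<union> S2)"
        by (rule sum.mono_neutral_right) (use S(1) in \<open>auto simp: S1_def S2_def\<close>)
      also have "\<dots> = sum ?p S1 + sum ?p S2"
        by (rule sum.union_disjoint) (use fin in \<open>auto simp: S2_def\<close>)
      also have "sum ?p S1 \<le> 1 - sum (link N k (Xs N)) F"
      proof (rule two_small_points_mass[OF elim(3) XN F(1,2) _ fin(1)])
        show "\<delta>0 \<le> \<bar>z\<bar>" if "Z \<in> F" "z \<in> Z" for Z z using \<delta>0(2) that by blast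
      qed (use S(2) in \<open>auto simp: S1_def\<close>)
      also have "\<dots> \<le> \<epsilon> / 2" using elim(2) by linarith
      also have "sum ?p S2 \<le> \<epsilon> / 2"
      proof -
        have ex: "\<exists>B\<in>BB. \<exists>y\<in>?near B (d B). Y = insert y B" if Y: "Y \<in> S2" for Y
        proof -
          have Y': "Y \<in> configs' (Suc k)" "Y \<notin> F'" "Y \<notin> S1" "Y \<in> S" "?p Y \<noteq> 0"
            using Y S(2) by (auto simp: S2_def)
          have YR: "\<bar>y\<bar> \<le> R" if "y \<in> Y" for y
            by (rule link_support_bounded[OF elim(3) XN Y'(1,5) _ that]) (use elim(1) in blast)
          obtain y where y: "y \<in> Y" "\<bar>y\<bar> < \<delta>"
            using Y'(1,2) YR by (fastforce simp: F'_def not_le)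
          have big: "\<delta>0 \<le> \<bar>x\<bar>" if "x \<in> Y" "x \<noteq> y" for x
          proof (rule ccontr)
            assume "\<not> \<delta>0 \<le> \<bar>x\<bar>"
            then have "\<bar>x\<bar> < \<delta>0" "\<bar>y\<bar> < \<delta>0" using y(2) \<delta>(2) by auto
            then have "Y \<in> S1" using that y(1) Y'(4) by (auto simp: S1_def)
            then show False using Y'(3) by simp
          qed
          define B where "B = Y - {y}"
          have fY: "finite Y" "card Y = Suc k" "Y \<subseteq> lattice" using configs_memD[OF Y'(1)] by auto
          have "B \<in> configs' k" using fY y(1) by (auto simp: B_def configs_def)
          then have BB: "B \<in> BB" using big YR by (auto simp: BB_def B_def)
          have "y \<in> ?near B (d B)" using fY y \<delta>(3)[OF BB] by (auto simp: B_def)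
          moreover have "Y = insert y B" using y(1) by (auto simp: B_def)
          ultimately show ?thesis using BB by blast
        qed
        define P where "P = (\<lambda>B. {y \<in> ?near B (d B). insert y B \<in> S2})"
        have inj: "inj_on (\<lambda>y. insert y B) (P B)" for B by (auto simp: P_def inj_on_def)
        have finP: "finite (P B)" for B
        proof (rule finite_imageD[OF _ inj])
          show "finite ((\<lambda>y. insert y B) ` P B)" by (rule finite_subset[OF _ fin(2)]) (auto simp: P_def)
        qed
        have "sum ?p S2 \<le> sum ?p (\<Union>B\<in>BB. (\<lambda>y. insert y B) ` P B)"
        proof (rule sum_mono2)
          show "S2 \<subseteq> (\<Union>B\<in>BB. (\<lambda>y. insert y B) ` P B)"
          proof
            fix Y assume Y: "Y \<in> S2"
            then obtain B y where "B \<in> BB" "y \<in> ?near B (d B)" "Y = insert y B" using ex by blast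
            then show "Y \<in> (\<Union>B\<in>BB. (\<lambda>y. insert y B) ` P B)" using Y by (auto simp: P_def)
          qed
        qed (use finBB finP link_nonneg in auto)
        also have "\<dots> \<le> (\<Sum>B\<in>BB. sum ?p ((\<lambda>y. insert y B) ` P B))"
          using finBB finP link_nonneg by (intro sum_UN_le) auto
        also have "\<dots> = (\<Sum>B\<in>BB. sum (?q N B) (P B))"
          by (simp add: sum.reindex[OF inj] o_def)
        also have "\<dots> \<le> (\<Sum>B\<in>BB. \<eta>)"
        proof (rule sum_mono)
          fix B assume B: "B \<in> BB"
          then have Bc: "B \<in> configs' k" by (simp add: BB_def)
          have "sum (?q N B) (P B) \<le> infsum (?q N B) (?near B (d B))"
            using link_insertions_summable(1)[OF Bc XN elim(3), of "?near B (d B)"] finP link_nonneg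
            by (intro finite_sum_le_infsum) (auto simp: P_def)
          then show "sum (?q N B) (P B) \<le> \<eta>" using elim(4) B by fastforce
        qed
        also have "\<dots> = real (card BB) * \<eta>" by simp
        also have "\<dots> \<le> \<epsilon> / 2"
        proof -
          have "(real (card BB) + 1) * \<eta> = \<epsilon> / 2" by (simp add: \<eta>_def field_simps)
          then show ?thesis using \<eta> by (simp add: algebra_simps)
        qed
        finally show ?thesis .
      qed
      finally show "sum ?p S \<le> \<epsilon>" by simp
    qed
    then show ?case by linarith
  qed
  then show ?case using F' by blast
qed

section \<open>Stabilizing sequences are regular\<close>

lemma link_measure_integral:
  assumes "K \<le> N" "X \<in> configs' N" "\<And>Y. Y \<in> configs' K \<Longrightarrow> \<bar>f Y\<bar> \<le> C"
  shows "integral\<^sup>L (link_measure q zm zp N K X) f = infsum (\<lambda>Y. link N K X Y * f Y) (configs' K)"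
  unfolding link_measure_def
  by (rule integral_point_measure(2)) (use assms link_nonneg has_sum_imp_summable[OF link_has_sum] in auto)

lemma config_seqs_mem: "Xs \<in> config_seqs q zm zp \<Longrightarrow> 1 \<le> N \<Longrightarrow> Xs N \<in> configs' N"
  by (auto simp: config_seqs_def PiE_iff)

text \<open>The entries converge by \<open>link_converges\<close>, the limits sum to one by \<open>link_tight\<close>, and Scheffe's lemma
  turns this into weak convergence.\<close>

lemma stabilizes_imp_regular:
  assumes Xs: "Xs \<in> config_seqs q zm zp" and X: "X \<in> inf_configs q zm zp" and st: "stabilizes_to Xs X"
  shows "regular_seq q zm zp Xs"
  unfolding regular_seq_def
proof (intro allI impI)
  fix K :: nat
  note XN = config_seqs_mem[OF Xs]
  have conv: "outer_converges Xs X" by (rule stabilizes_imp_outer_converges[OF X XN st])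
  define l where "l = (\<lambda>Y. if Y \<in> configs' K then lim (\<lambda>N. link N K (Xs N) Y) else 0)"
  have l: "(\<lambda>N. link N K (Xs N) Y) \<longlonglongrightarrow> l Y" if Y: "Y \<in> configs' K" for Y
  proof -
    obtain a where "(\<lambda>N. link N K (Xs N) Y) \<longlonglongrightarrow> a" using link_converges[OF X conv XN Y] by blast
    then show ?thesis using Y by (simp add: l_def limI)
  qed
  have l0: "0 \<le> l Y" for Y
  proof (cases "Y \<in> configs' K")
    case True
    show ?thesis by (rule LIMSEQ_le_const[OF l[OF True]]) (auto simp: link_nonneg)
  qed (simp add: l_def)
  have hsN: "\<forall>\<^sub>F N in sequentially. (link N K (Xs N) has_sum 1) (configs' K)"
    using eventually_ge_at_top[of "max 1 K"] by eventually_elim (use XN link_has_sum in auto)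
  have le1: "sum l S \<le> 1" if S: "finite S" "S \<subseteq> configs' K" for S
  proof -
    have "(\<lambda>N. sum (link N K (Xs N)) S) \<longlonglongrightarrow> sum l S" by (intro tendsto_sum l) (use S in auto)
    moreover have "\<forall>\<^sub>F N in sequentially. sum (link N K (Xs N)) S \<le> 1"
      using hsN
    proof eventually_elim
      case (elim N)
      show ?case by (rule finite_sum_le_has_sum[OF elim S]) (rule link_nonneg)
    qed
    ultimately show ?thesis by (intro tendsto_upperbound) auto
  qed
  have "bdd_above (sum l ` {F. F \<subseteq> configs' K \<and> finite F})"
    by (rule bdd_aboveI2[where M = 1]) (use le1 in auto)
  then have sm: "l summable_on configs' K" using l0 by (intro nonneg_bdd_above_summable_on) auto
  have "infsum l (configs' K) = 1"
  proof (rule antisym)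
    show "infsum l (configs' K) \<le> 1"
      by (rule has_sum_le_finite_sums[OF has_sum_infsum[OF sm]]) (rule le1)
    show "1 \<le> infsum l (configs' K)"
    proof (rule field_le_epsilon)
      fix \<epsilon> :: real assume "\<epsilon> > 0"
      then obtain F where F: "finite F" "F \<subseteq> configs' K"
        "\<forall>\<^sub>F N in sequentially. 1 - \<epsilon> \<le> sum (link N K (Xs N)) F"
        using link_tight[OF X conv XN, of \<epsilon> K] by auto
      have "(\<lambda>N. sum (link N K (Xs N)) F) \<longlonglongrightarrow> sum l F" by (intro tendsto_sum l) (use F in auto)
      then have "1 - \<epsilon> \<le> sum l F" using F(3) by (intro tendsto_lowerbound) auto
      also have "\<dots> \<le> infsum l (configs' K)" using F sm l0 by (intro finite_sum_le_infsum) auto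
      finally show "1 \<le> infsum l (configs' K) + \<epsilon>" by simp
    qed
  qed
  then have hl: "(l has_sum 1) (configs' K)" using sm by (simp add: has_sum_iff)
  let ?M = "point_measure (configs' K) (\<lambda>Y. ennreal (l Y))"
  have "is_limit_measure q zm zp Xs K ?M"
    unfolding is_limit_measure_def weakly_converges_def
  proof (intro conjI allI impI)
    show "prob_space ?M" by (rule prob_space_point_measure[OF l0 hl])
    show "sets ?M = Pow (configs' K)" by (simp add: sets_point_measure)
    fix f :: "real set \<Rightarrow> real"
    assume "continuous_map (discrete_topology (configs' K)) euclideanreal f \<and> bounded (f ` topspace (discrete_topology (configs' K)))"
    then obtain C where C: "\<And>Y. Y \<in> configs' K \<Longrightarrow> \<bar>f Y\<bar> \<le> C" by (auto simp: bounded_iff)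
    have "(\<lambda>N. infsum (\<lambda>Y. link N K (Xs N) Y * f Y) (configs' K)) \<longlonglongrightarrow> infsum (\<lambda>Y. l Y * f Y) (configs' K)"
      by (rule bounded_mean_converges[OF link_nonneg hsN l0 hl l C])
    also have "infsum (\<lambda>Y. l Y * f Y) (configs' K) = integral\<^sup>L ?M f"
      by (rule integral_point_measure(2)[OF l0 sm C, symmetric])
    finally have lim: "(\<lambda>N. infsum (\<lambda>Y. link N K (Xs N) Y * f Y) (configs' K)) \<longlonglongrightarrow> integral\<^sup>L ?M f" .
    have "\<forall>\<^sub>F N in sequentially. infsum (\<lambda>Y. link N K (Xs N) Y * f Y) (configs' K) = integral\<^sup>L (link_measure q zm zp N K (Xs N)) f"
      using eventually_ge_at_top[of "max 1 K"]
    proof eventually_elim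
      case (elim N)
      then show ?case using link_measure_integral[OF _ XN[of N] C, of K] by simp
    qed
    from Lim_transform_eventually[OF lim this]
    show "(\<lambda>N. integral\<^sup>L (link_measure q zm zp N K (Xs N)) f) \<longlonglongrightarrow> integral\<^sup>L ?M f" .
  qed
  then show "\<exists>M. is_limit_measure q zm zp Xs K M" by blast
qed

section \<open>Regular sequences stabilize\<close>

text \<open>Let \<open>s\<close> be the first point at which the two outer parts differ. If \<open>s\<close> belongs to the outer part of \<open>X\<close>,
  then that configuration has more points at least as far out as \<open>s\<close>, on the side of \<open>s\<close>, than \<open>X'\<close> has;
  \<open>link_count\<close> forbids this for a configuration reached from \<open>X'\<close>.\<close>

lemma no_first_difference:
  assumes X: "X \<in> configs' N" and X': "X' \<in> configs' N'" and K: "K \<le> N" "K \<le> N'"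
    and pos: "link N' K X' (top_part X K) \<noteq> 0"
    and s: "s \<in> top_part X K" "s \<notin> top_part X' K"
    and before: "\<And>t. precedes t s \<Longrightarrow> t \<in> top_part X K \<longleftrightarrow> t \<in> top_part X' K"
  shows False
proof -
  let ?T = "top_part X K" and ?T' = "top_part X' K"
  have tX': "tame X'" using tame_configs[OF X'] .
  have T: "?T \<in> configs' K" "?T' \<in> configs' K" using top_part_config[OF X K(1)] top_part_config[OF X' K(2)] by auto
  have fT: "finite ?T" "card ?T = K" "finite ?T'" "card ?T' = K" using configs_memD[OF T(1)] configs_memD[OF T(2)] by auto
  \<comment> \<open>both outer parts have \<open>K\<close> elements, so that of \<open>X'\<close> reaches beyond \<open>s\<close>\<close>
  have "\<exists>z\<in>?T'. precedes s z"
  proof (rule ccontr)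
    assume none: "\<not> (\<exists>z\<in>?T'. precedes s z)"
    have "?T' \<subseteq> ?T - {s}"
    proof
      fix t assume t: "t \<in> ?T'"
      then have "t \<noteq> s" "\<not> precedes s t" using s(2) none by auto
      then have "precedes t s" using precedes_total[of t s] by blast
      then show "t \<in> ?T - {s}" using before[of t] t \<open>t \<noteq> s\<close> by simp
    qed
    then have "card ?T' \<le> card (?T - {s})" using fT by (intro card_mono) auto
    then show False using fT card_Diff1_less[OF fT(1) s(1)] by linarith
  qed
  then obtain z where z: "z \<in> ?T'" "precedes s z" by blast
  have in_top: "x \<in> ?T - {s}" if x: "x \<in> X'" "x = s \<or> precedes x s" for x
  proof -
    have "precedes x z" using x(2) z(2) precedes_trans by blast
    then have "rank X' x < rank X' z" using rank_less_iff[OF tX' x(1)] z(1) by (auto simp: top_part_def)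
    then have "x \<in> ?T'" using x(1) z(1) by (auto simp: top_part_def)
    moreover from this s(2) x(2) have "precedes x s" by auto
    ultimately show ?thesis using before precedes_irrefl by auto
  qed
  have less: "card {x \<in> X'. P x} < card {y \<in> ?T. P y}"
    if "P s" "\<And>x. P x \<Longrightarrow> x = s \<or> precedes x s" for P
  proof -
    have "{x \<in> X'. P x} \<subseteq> {y \<in> ?T. P y} - {s}" using in_top that(2) by blast
    then have "{x \<in> X'. P x} \<subset> {y \<in> ?T. P y}" using that(1) s(1) by blast
    then show ?thesis using fT(1) by (intro psubset_card_mono) auto
  qed
  note cnt = link_count[OF K(2) X' T(1) pos, of s]
  have "s \<noteq> 0" using s(1) configs_memD(1)[OF T(1)] lattice_nonzero by blast
  then consider "s > 0" | "s < 0" by linarith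
  then show False
  proof cases
    case 1
    then have "card {x \<in> X'. s \<le> x} < card {y \<in> ?T. s \<le> y}"
      by (intro less) (auto simp: precedes_def)
    then show False using cnt by linarith
  next
    case 2
    then have "card {x \<in> X'. x \<le> s} < card {y \<in> ?T. y \<le> s}"
      by (intro less) (auto simp: precedes_def)
    then show False using cnt by linarith
  qed
qed

lemma top_parts_equal:
  assumes X: "X \<in> configs' N" and X': "X' \<in> configs' N'" and K: "K \<le> N" "K \<le> N'"
    and pos: "link N' K X' (top_part X K) \<noteq> 0" "link N K X (top_part X' K) \<noteq> 0"
  shows "top_part X K = top_part X' K"
proof (rule ccontr)
  assume ne: "top_part X K \<noteq> top_part X' K"
  let ?T = "top_part X K" and ?T' = "top_part X' K"
  define D where "D = (?T - ?T') \<union> (?T' - ?T)"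
  have T: "?T \<in> configs' K" "?T' \<in> configs' K" using top_part_config[OF X K(1)] top_part_config[OF X' K(2)] by auto
  have D: "finite D" "D \<noteq> {}" "D \<subseteq> lattice"
    using configs_memD[OF T(1)] configs_memD[OF T(2)] ne by (auto simp: D_def)
  then have tD: "tame D" by (auto simp: tame_def finite_imp_bounded)
  have "0 < card D" using D by (simp add: card_gt_0_iff)
  from rank_attained[OF tD order_refl D(1) this] obtain s where s: "s \<in> D" "rank D s = 0" .
  have "{y \<in> D. precedes y s} = {}" using s(2) D(1) by (simp add: rank_def)
  then have before: "t \<in> ?T \<longleftrightarrow> t \<in> ?T'" if "precedes t s" for t using that by (auto simp: D_def)
  from s(1) consider "s \<in> ?T" "s \<notin> ?T'" | "s \<in> ?T'" "s \<notin> ?T" by (auto simp: D_def)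
  then show False
  proof cases
    case 1
    from no_first_difference[OF X X' K pos(1) this before] show ?thesis .
  next
    case 2
    from no_first_difference[OF X' X K(2,1) pos(2) this before[symmetric]] show ?thesis .
  qed
qed

lemma rank_top_part:
  assumes "tame X" "x \<in> top_part X K"
  shows "rank (top_part X K) x = rank X x"
proof -
  have "{y \<in> top_part X K. precedes y x} = {y \<in> X. precedes y x}"
    using assms rank_less_iff[OF assms(1)] by (fastforce simp: top_part_def)
  then show ?thesis by (simp add: rank_def)
qed

lemma tame_subset: "tame X \<Longrightarrow> Y \<subseteq> X \<Longrightarrow> tame Y"
  using bounded_subset by (auto simp: tame_def)

lemma var_series_top_part:
  assumes tX: "tame X" and k: "k < K"
  shows "var_series (top_part X K) k = var_series X k"
proof -
  have tT: "tame (top_part X K)" by (rule tame_subset[OF tX]) (auto simp: top_part_def)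
  have "var_series (top_part X K) k = x \<longleftrightarrow> var_series X k = x" if "x \<noteq> 0" for x
  proof -
    have "var_series (top_part X K) k = x \<longleftrightarrow> x \<in> top_part X K \<and> rank (top_part X K) x = k"
      by (rule var_series_eq_iff[OF tT that])
    also have "\<dots> \<longleftrightarrow> x \<in> X \<and> rank X x = k" using rank_top_part[OF tX, of x K] k by (auto simp: top_part_def)
    also have "\<dots> \<longleftrightarrow> var_series X k = x" by (rule var_series_eq_iff[OF tX that, symmetric])
    finally show ?thesis .
  qed
  then show ?thesis by metis
qed

lemma countable_configs: "countable (configs' K)"
  by (rule countable_subset[OF _ countable_Collect_finite_subset[OF countable_lattice]])
     (auto simp: configs_def)

lemma limit_measure_finite_sets:
  assumes Xs: "Xs \<in> config_seqs q zm zp" and M: "is_limit_measure q zm zp Xs K M"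
    and F: "finite F" "F \<subseteq> configs' K"
  shows "(\<lambda>N. sum (link N K (Xs N)) F) \<longlonglongrightarrow> measure M F"
proof -
  have sets: "sets M = Pow (configs' K)" using M by (simp add: is_limit_measure_def)
  let ?f = "indicator F :: real set \<Rightarrow> real"
  have "bounded (?f ` configs' K)" by (rule boundedI[of _ 1]) (auto simp: indicator_def)
  then have "continuous_map (discrete_topology (configs' K)) euclideanreal ?f \<and>
      bounded (?f ` topspace (discrete_topology (configs' K)))" by simp
  then have lim: "(\<lambda>N. integral\<^sup>L (link_measure q zm zp N K (Xs N)) ?f) \<longlonglongrightarrow> integral\<^sup>L M ?f"
    using M unfolding is_limit_measure_def weakly_converges_def by blast
  have "F \<subseteq> space M" using F(2) sets_eq_imp_space_eq[of M "count_space (configs' K)"] sets by simp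
  then have "integral\<^sup>L M ?f = measure M F" by (simp add: Int_absorb2)
  moreover have "\<forall>\<^sub>F N in sequentially. integral\<^sup>L (link_measure q zm zp N K (Xs N)) ?f = sum (link N K (Xs N)) F"
    using eventually_ge_at_top[of "max 1 K"]
  proof eventually_elim
    case (elim N)
    have "integral\<^sup>L (link_measure q zm zp N K (Xs N)) ?f = infsum (\<lambda>Y. link N K (Xs N) Y * ?f Y) (configs' K)"
      by (rule link_measure_integral[where C = 1]) (use elim config_seqs_mem[OF Xs] in \<open>auto simp: indicator_def\<close>)
    also have "\<dots> = infsum (link N K (Xs N)) F"
      by (rule infsum_cong_neutral) (use F in \<open>auto simp: indicator_def\<close>)
    finally show ?case using F(1) by simp
  qed
  ultimately show ?thesis using Lim_transform_eventually[OF lim] by simp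
qed

text \<open>Under a convergent sequence of laws all but an arbitrarily small part of the mass stays in a fixed
  finite set, so the outer parts, whose mass is bounded below, eventually lie in that set. There the
  convergence is uniform; hence the outer part of \<open>Xs N\<close> has positive mass also under the law that
  starts from \<open>Xs N'\<close>, and conversely. By \<open>top_parts_equal\<close> the two outer parts agree.\<close>

lemma regular_top_parts_constant:
  assumes Xs: "Xs \<in> config_seqs q zm zp" and reg: "regular_seq q zm zp Xs" and K: "1 \<le> K"
  obtains N0 where "K \<le> N0" "\<And>N N'. N0 \<le> N \<Longrightarrow> N0 \<le> N' \<Longrightarrow> top_part (Xs N) K = top_part (Xs N') K"
proof -
  obtain M where M: "is_limit_measure q zm zp Xs K M" using reg K by (auto simp: regular_seq_def)
  have PM: "prob_space M" "sets M = Pow (configs' K)" using M by (auto simp: is_limit_measure_def)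
  obtain c where c: "c > 0" "\<And>X N. X \<in> configs' N \<Longrightarrow> K \<le> N \<Longrightarrow> c \<le> link N K X (top_part X K)"
    using link_top_part_lower_bound[where K = K] by blast
  obtain F where F: "finite F" "F \<subseteq> configs' K" "1 - c / 2 < measure M F"
    using prob_finite_approximation[OF PM countable_configs, of "c / 2"] c(1) by auto
  have ev1: "\<forall>\<^sub>F N in sequentially. 1 - c / 2 < sum (link N K (Xs N)) F"
    by (rule order_tendstoD(1)[OF limit_measure_finite_sets[OF Xs M F(1,2)] F(3)])
  have single: "(\<lambda>N. link N K (Xs N) Y) \<longlonglongrightarrow> measure M {Y}" if "Y \<in> F" for Y
    using limit_measure_finite_sets[OF Xs M, of "{Y}"] that F(2) by auto
  have "\<forall>\<^sub>F N in sequentially. dist (link N K (Xs N) Y) (measure M {Y}) < c / 2" if "Y \<in> F" for Y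
    using tendstoD[OF single[OF that], of "c / 2"] c(1) by simp
  then have "\<forall>\<^sub>F N in sequentially. \<forall>Y\<in>F. dist (link N K (Xs N) Y) (measure M {Y}) < c / 2"
    using F(1) by (intro eventually_ball_finite) auto
  with ev1 eventually_ge_at_top[of K] have "\<forall>\<^sub>F N in sequentially. K \<le> N \<and> 1 - c / 2 < sum (link N K (Xs N)) F \<and>
      (\<forall>Y\<in>F. dist (link N K (Xs N) Y) (measure M {Y}) < c / 2)"
    by eventually_elim auto
  then obtain N0 where N0: "\<And>N. N0 \<le> N \<Longrightarrow> K \<le> N \<and> 1 - c / 2 < sum (link N K (Xs N)) F \<and>
      (\<forall>Y\<in>F. dist (link N K (Xs N) Y) (measure M {Y}) < c / 2)"
    unfolding eventually_sequentially by blast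
  have XN: "Xs N \<in> configs' N" "K \<le> N" if "N0 \<le> N" for N
    using config_seqs_mem[OF Xs, of N] N0[OF that] K by auto
  have inF: "top_part (Xs N) K \<in> F" if N: "N0 \<le> N" for N
  proof (rule ccontr)
    let ?T = "top_part (Xs N) K"
    assume "?T \<notin> F"
    then have "link N K (Xs N) ?T + sum (link N K (Xs N)) F = sum (link N K (Xs N)) (insert ?T F)"
      using F(1) by simp
    also have "\<dots> \<le> 1"
      by (rule finite_sum_le_has_sum[OF link_has_sum[OF XN(2)[OF N] XN(1)[OF N]]])
         (use F top_part_config[OF XN[OF N]] link_nonneg in auto)
    finally show False using c(2)[OF XN[OF N]] N0[OF N] c(1) by linarith
  qed
  have pos: "link N' K (Xs N') (top_part (Xs N) K) \<noteq> 0" if N: "N0 \<le> N" "N0 \<le> N'" for N N'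
  proof -
    let ?T = "top_part (Xs N) K"
    have "dist (link N K (Xs N) ?T) (measure M {?T}) < c / 2" "dist (link N' K (Xs N') ?T) (measure M {?T}) < c / 2"
      using N0[OF N(1)] N0[OF N(2)] inF[OF N(1)] by auto
    then show ?thesis using c(2)[OF XN[OF N(1)]] c(1) unfolding dist_real_def by linarith
  qed
  show ?thesis
  proof (rule that[of N0])
    show "K \<le> N0" using N0[of N0] by simp
    fix N N' assume "N0 \<le> N" "N0 \<le> N'"
    then show "top_part (Xs N) K = top_part (Xs N') K"
      using top_parts_equal[OF XN(1) XN(1) XN(2) XN(2)] pos by blast
  qed
qed

text \<open>Each member of the variational series is determined by an outer part and is therefore eventually
  constant; \<open>X\<close> is the set of these values.\<close>

lemma regular_imp_stabilizes:
  assumes Xs: "Xs \<in> config_seqs q zm zp" and reg: "regular_seq q zm zp Xs"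
  obtains X where "X \<in> inf_configs q zm zp" "stabilizes_to Xs X"
proof -
  have XN: "Xs N \<in> configs' N" if "1 \<le> N" for N using config_seqs_mem[OF Xs that] .
  have ex_n: "\<exists>N0. k < N0 \<and> (\<forall>N\<ge>N0. var_series (Xs N) k = var_series (Xs N0) k)" for k
  proof -
    obtain N0 where N0: "Suc k \<le> N0" "\<And>N N'. N0 \<le> N \<Longrightarrow> N0 \<le> N' \<Longrightarrow> top_part (Xs N) (Suc k) = top_part (Xs N') (Suc k)"
      using regular_top_parts_constant[OF Xs reg, of "Suc k"] by auto
    have "var_series (Xs N) k = var_series (Xs N0) k" if "N0 \<le> N" for N
    proof -
      have t: "tame (Xs N)" "tame (Xs N0)"
        using XN[of N] XN[of N0] tame_configs that N0(1) by auto
      show ?thesis using var_series_top_part[OF t(1), of k "Suc k"] var_series_top_part[OF t(2), of k "Suc k"]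
        N0(2)[OF that order_refl] by simp
    qed
    moreover have "k < N0" using N0(1) by simp
    ultimately show ?thesis by blast
  qed
  define n where "n = (\<lambda>k. SOME N0. k < N0 \<and> (\<forall>N\<ge>N0. var_series (Xs N) k = var_series (Xs N0) k))"
  have n_prop: "k < n k \<and> (\<forall>N\<ge>n k. var_series (Xs N) k = var_series (Xs (n k)) k)" for k
    using someI_ex[OF ex_n[of k]] unfolding n_def .
  have n: "k < n k" "n k \<le> N \<Longrightarrow> var_series (Xs N) k = var_series (Xs (n k)) k" for k N
    using n_prop[of k] by blast+
  define x where "x = (\<lambda>k. var_series (Xs (n k)) k)"
  have x: "x k \<in> Xs N \<and> rank (Xs N) (x k) = k" if N: "n k \<le> N" for k N
  proof -
    have C: "Xs N \<in> configs' N" "k < N" using XN[of N] n(1)[of k] N by auto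
    have t: "tame (Xs N)" using tame_configs[OF C(1)] .
    have "finite (Xs N)" "k < card (Xs N)" using configs_memD[OF C(1)] C(2) by auto
    from rank_attained[OF t order_refl this] obtain y where y: "y \<in> Xs N" "rank (Xs N) y = k" .
    have "var_series (Xs N) k = y" using var_series_rank[OF t y(1)] y(2) by simp
    then show ?thesis using n(2)[OF N] y by (simp add: x_def)
  qed
  have ord: "precedes (x j) (x k) \<longleftrightarrow> j < k" for j k
  proof -
    let ?N = "max (n j) (n k)"
    have "1 \<le> ?N" using n(1)[of j] by simp
    then have "tame (Xs ?N)" using XN tame_configs by blast
    then show ?thesis using rank_less_iff[of "Xs ?N" "x j" "x k"] x[of j ?N] x[of k ?N] by simp
  qed
  have inj: "inj x"
  proof (rule injI)
    fix j k assume "x j = x k"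
    then have "\<not> j < k" "\<not> k < j" using ord[of j k] ord[of k j] precedes_irrefl by auto
    then show "j = k" by simp
  qed
  have xL: "x k \<in> lattice" for k
    using x[of k "n k"] configs_memD(1)[OF XN[of "n k"]] n(1)[of k] by auto
  define X where "X = range x"
  have "\<bar>y\<bar> \<le> \<bar>x 0\<bar>" if "y \<in> X" for y
  proof -
    from that obtain k where "y = x k" by (auto simp: X_def)
    then show ?thesis using ord[of 0 k] precedes_abs[of "x 0" "x k"] by (cases k) auto
  qed
  then have "bounded X" by (auto simp: bounded_iff)
  then have X: "X \<in> inf_configs q zm zp"
    using xL inj by (auto simp: inf_configs_def X_def dest: finite_imageD)
  have tX: "tame X" using tame_inf_configs[OF X] .
  have var: "var_series X k = x k" for k
  proof -
    have "{y \<in> X. precedes y (x k)} = x ` {..<k}" using ord by (auto simp: X_def)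
    then have "rank X (x k) = k" using inj_on_subset[OF inj, of "{..<k}"] by (simp add: rank_def card_image)
    then show ?thesis using var_series_rank[OF tX, of "x k"] by (simp add: X_def)
  qed
  have "stabilizes_to Xs X"
    unfolding stabilizes_to_def
  proof (intro allI exI impI)
    fix k N assume "n k \<le> N"
    from n(2)[OF this] show "var_series (Xs N) k = var_series X k" unfolding var x_def .
  qed
  then show ?thesis using X that by blast
qed

section \<open>The Martin boundary\<close>

lemma stabilizes_common:
  assumes "X \<in> inf_configs q zm zp" "Y \<in> inf_configs q zm zp" "stabilizes_to Xs X" "stabilizes_to Zs Y"
    and "\<And>n. \<exists>N\<ge>n. Xs N = Zs N"
  shows "X = Y"
proof (rule stabilizes_unique[OF assms(1,2)])
  show "stabilizes_to (\<lambda>_. X) X" by (simp add: stabilizes_to_def)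
  show "stabilizes_to (\<lambda>_. X) Y"
    unfolding stabilizes_to_def
  proof (intro allI exI impI)
    fix k N :: nat
    obtain N1 N2 where N: "\<forall>N\<ge>N1. var_series (Xs N) k = var_series X k" "\<forall>N\<ge>N2. var_series (Zs N) k = var_series Y k"
      using assms(3,4) unfolding stabilizes_to_def by blast
    obtain n where "n \<ge> max N1 N2" "Xs n = Zs n" using assms(5) by blast
    then show "var_series X k = var_series Y k" using N by (metis max.bounded_iff)
  qed
qed

lemma merge_config_seqs:
  "Xs \<in> config_seqs q zm zp \<Longrightarrow> Ys \<in> config_seqs q zm zp \<Longrightarrow> merge Xs Ys \<in> config_seqs q zm zp"
  by (auto simp: config_seqs_def merge_def PiE_iff extensional_def)

lemma merge_limit_measure:
  assumes "is_limit_measure q zm zp Xs K M" "is_limit_measure q zm zp Ys K M"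
  shows "is_limit_measure q zm zp (merge Xs Ys) K M"
  unfolding is_limit_measure_def weakly_converges_def
proof (intro conjI allI impI)
  fix f :: "real set \<Rightarrow> real"
  assume f: "continuous_map (discrete_topology (configs' K)) euclideanreal f \<and> bounded (f ` topspace (discrete_topology (configs' K)))"
  let ?i = "\<lambda>Xs N. integral\<^sup>L (link_measure q zm zp N K (Xs N)) f"
  have lim: "(\<lambda>N. ?i Xs N) \<longlonglongrightarrow> integral\<^sup>L M f" "(\<lambda>N. ?i Ys N) \<longlonglongrightarrow> integral\<^sup>L M f"
    using assms f unfolding is_limit_measure_def weakly_converges_def by blast+
  show "(\<lambda>N. ?i (merge Xs Ys) N) \<longlonglongrightarrow> integral\<^sup>L M f"
  proof (rule tendstoI)
    fix e :: real assume "e > 0"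
    from tendstoD[OF lim(1) this] tendstoD[OF lim(2) this]
    show "\<forall>\<^sub>F N in sequentially. dist (?i (merge Xs Ys) N) (integral\<^sup>L M f) < e"
      by eventually_elim (simp add: merge_def)
  qed
qed (use assms in \<open>auto simp: is_limit_measure_def\<close>)

text \<open>Both sequences of means converge, and they share infinitely many terms.\<close>

lemma limit_measure_transfer:
  assumes X: "is_limit_measure q zm zp Xs K M'" and Z: "is_limit_measure q zm zp Zs K M"
    and agree: "\<And>n. \<exists>N\<ge>n. Xs N = Zs N"
  shows "is_limit_measure q zm zp Xs K M"
  unfolding is_limit_measure_def weakly_converges_def
proof (intro conjI allI impI)
  fix f :: "real set \<Rightarrow> real"
  assume f: "continuous_map (discrete_topology (configs' K)) euclideanreal f \<and> bounded (f ` topspace (discrete_topology (configs' K)))"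
  let ?i = "\<lambda>Xs N. integral\<^sup>L (link_measure q zm zp N K (Xs N)) f"
  have lim: "(\<lambda>N. ?i Xs N) \<longlonglongrightarrow> integral\<^sup>L M' f" "(\<lambda>N. ?i Zs N) \<longlonglongrightarrow> integral\<^sup>L M f"
    using X Z f unfolding is_limit_measure_def weakly_converges_def by blast+
  have "integral\<^sup>L M' f = integral\<^sup>L M f"
  proof (rule ccontr)
    assume ne: "integral\<^sup>L M' f \<noteq> integral\<^sup>L M f"
    let ?e = "dist (integral\<^sup>L M' f) (integral\<^sup>L M f) / 2"
    have "?e > 0" using ne by simp
    from tendstoD[OF lim(1) this] tendstoD[OF lim(2) this]
    have "\<forall>\<^sub>F N in sequentially. dist (?i Xs N) (integral\<^sup>L M' f) < ?e \<and> dist (?i Zs N) (integral\<^sup>L M f) < ?e"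
      by (rule eventually_conj)
    then obtain n where n: "\<forall>N\<ge>n. dist (?i Xs N) (integral\<^sup>L M' f) < ?e \<and> dist (?i Zs N) (integral\<^sup>L M f) < ?e"
      unfolding eventually_sequentially by blast
    obtain N where N: "N \<ge> n" "Xs N = Zs N" using agree by blast
    then have "dist (?i Zs N) (integral\<^sup>L M' f) < ?e" "dist (?i Zs N) (integral\<^sup>L M f) < ?e" using n by auto
    then show False unfolding dist_real_def by argo
  qed
  then show "(\<lambda>N. ?i Xs N) \<longlonglongrightarrow> integral\<^sup>L M f" using lim(1) by simp
qed (use Z in \<open>auto simp: is_limit_measure_def\<close>)

text \<open>If the limit measures agree, the merged sequence is regular and hence stabilizes, to \<open>X\<close> and to \<open>Y\<close>
  alike. If \<open>X = Y\<close>, the merged sequence stabilizes and hence is regular, with limit measures common to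
  both sequences.\<close>

lemma same_limits_iff:
  assumes Xs: "Xs \<in> regular_seqs q zm zp" and Ys: "Ys \<in> regular_seqs q zm zp"
    and X: "X \<in> inf_configs q zm zp" "stabilizes_to Xs X" and Y: "Y \<in> inf_configs q zm zp" "stabilizes_to Ys Y"
  shows "(Xs, Ys) \<in> same_limits q zm zp \<longleftrightarrow> X = Y"
proof
  let ?Z = "merge Xs Ys"
  have c: "Xs \<in> config_seqs q zm zp" "Ys \<in> config_seqs q zm zp" using Xs Ys by (auto simp: regular_seqs_def)
  have Zc: "?Z \<in> config_seqs q zm zp" by (rule merge_config_seqs[OF c])
  {
    assume "(Xs, Ys) \<in> same_limits q zm zp"
    then have "regular_seq q zm zp ?Z"
      unfolding regular_seq_def same_limits_def using merge_limit_measure by blast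
    from regular_imp_stabilizes[OF Zc this] obtain Z where Z: "Z \<in> inf_configs q zm zp" "stabilizes_to ?Z Z" .
    have "X = Z" by (rule stabilizes_common[OF X(1) Z(1) X(2) Z(2) merge_agrees(1)])
    moreover have "Y = Z" by (rule stabilizes_common[OF Y(1) Z(1) Y(2) Z(2) merge_agrees(2)])
    ultimately show "X = Y" by simp
  }
  assume "X = Y"
  then have "stabilizes_to ?Z X" using merge_stabilizes X(2) Y(2) by blast
  then have reg: "regular_seq q zm zp ?Z" by (rule stabilizes_imp_regular[OF Zc X(1)])
  have "\<exists>M. is_limit_measure q zm zp Xs K M \<and> is_limit_measure q zm zp Ys K M" if K: "1 \<le> K" for K
  proof -
    obtain M where M: "is_limit_measure q zm zp ?Z K M" using reg K by (auto simp: regular_seq_def)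
    have "\<exists>M. is_limit_measure q zm zp Xs K M" "\<exists>M. is_limit_measure q zm zp Ys K M"
      using Xs Ys K by (simp_all add: regular_seqs_def regular_seq_def)
    then obtain M1 M2 where "is_limit_measure q zm zp Xs K M1" "is_limit_measure q zm zp Ys K M2" by blast
    then show ?thesis using limit_measure_transfer[OF _ M merge_agrees(1)] limit_measure_transfer[OF _ M merge_agrees(2)] by blast
  qed
  then show "(Xs, Ys) \<in> same_limits q zm zp" using Xs Ys by (auto simp: same_limits_def)
qed

lemma stabilizing_sequence_exists:
  assumes X: "X \<in> inf_configs q zm zp"
  obtains Xs where "Xs \<in> regular_seqs q zm zp" "stabilizes_to Xs X"
proof -
  have tX: "tame X" and inf: "infinite X" using X tame_inf_configs by (auto simp: inf_configs_def)
  define Xs where "Xs = (\<lambda>N\<in>{1..}. top_part X N)"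
  have "top_part X N \<in> configs' N" for N
  proof -
    obtain F where F: "F \<subseteq> X" "finite F" "card F = N" using infinite_arbitrarily_large[OF inf] by blast
    have "bij_betw (rank X) (top_part X N) {..<N}" by (rule bij_betw_rank_top_part[OF tX F(1,2)]) (use F(3) in simp)
    then have "card (top_part X N) = N" "finite (top_part X N)"
      using bij_betw_same_card bij_betw_finite by fastforce+
    then show ?thesis using X by (auto simp: configs_def top_part_def inf_configs_def)
  qed
  then have c: "Xs \<in> config_seqs q zm zp" by (auto simp: Xs_def config_seqs_def)
  have st: "stabilizes_to Xs X"
    unfolding stabilizes_to_def
  proof
    fix k
    have "var_series (Xs N) k = var_series X k" if "Suc k \<le> N" for N
      using var_series_top_part[OF tX, of k N] that by (simp add: Xs_def)
    then show "\<exists>N0. \<forall>N\<ge>N0. var_series (Xs N) k = var_series X k" by blast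
  qed
  show ?thesis
    by (rule that[OF _ st]) (use c stabilizes_imp_regular[OF c X st] in \<open>simp add: regular_seqs_def\<close>)
qed

lemma martin_boundary_bij:
  "\<exists>\<Phi>. bij_betw \<Phi> (martin_boundary q zm zp) (inf_configs q zm zp)
     \<and> (\<forall>C\<in>martin_boundary q zm zp. \<forall>Xs\<in>C. stabilizes_to Xs (\<Phi> C))"
proof -
  let ?A = "regular_seqs q zm zp" and ?r = "same_limits q zm zp"
  define s where "s = (\<lambda>Xs. SOME X. X \<in> inf_configs q zm zp \<and> stabilizes_to Xs X)"
  have s: "s Xs \<in> inf_configs q zm zp \<and> stabilizes_to Xs (s Xs)" if "Xs \<in> ?A" for Xs
  proof -
    have "Xs \<in> config_seqs q zm zp" "regular_seq q zm zp Xs" using that by (auto simp: regular_seqs_def)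
    from regular_imp_stabilizes[OF this] obtain X where "X \<in> inf_configs q zm zp" "stabilizes_to Xs X" .
    then have "\<exists>X. X \<in> inf_configs q zm zp \<and> stabilizes_to Xs X" by blast
    then show ?thesis unfolding s_def by (rule someI_ex)
  qed
  have ker: "(Xs, Ys) \<in> ?r \<longleftrightarrow> Xs \<in> ?A \<and> Ys \<in> ?A \<and> s Xs = s Ys" for Xs Ys
  proof (cases "Xs \<in> ?A \<and> Ys \<in> ?A")
    case True
    then show ?thesis using same_limits_iff[of Xs Ys "s Xs" "s Ys"] s[of Xs] s[of Ys] by simp
  next
    case False
    then show ?thesis by (auto simp: same_limits_def)
  qed
  have "s ` ?A = inf_configs q zm zp"
  proof (intro equalityI subsetI)
    fix X assume X: "X \<in> inf_configs q zm zp"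
    obtain Xs where Xs: "Xs \<in> ?A" "stabilizes_to Xs X" using stabilizing_sequence_exists[OF X] .
    then have "s Xs = X" using s[OF Xs(1)] stabilizes_unique[OF _ X _ Xs(2)] by blast
    then show "X \<in> s ` ?A" using Xs(1) by blast
  qed (use s in auto)
  then have "bij_betw (\<lambda>C. s (SOME x. x \<in> C)) (martin_boundary q zm zp) (inf_configs q zm zp)"
    using quotient_by_kernel_bij(1)[of ?r ?A s] ker by (simp add: martin_boundary_def)
  moreover have "stabilizes_to Xs (s (SOME x. x \<in> C))" if "C \<in> martin_boundary q zm zp" "Xs \<in> C" for C Xs
  proof -
    have "Xs \<in> ?A \<and> s (SOME x. x \<in> C) = s Xs"
      by (rule quotient_by_kernel_bij(2)[of ?r ?A s, OF ker]) (use that in \<open>auto simp: martin_boundary_def\<close>)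
    then show ?thesis using s[of Xs] by simp
  qed
  ultimately show ?thesis by blast
qed

end

theorem theorem3p9:
  fixes q zm zp :: real
  assumes "0 < q" and "q < 1" and "zm < 0" and "zp > 0"
  shows "(\<forall>Xs\<in>config_seqs q zm zp.
            regular_seq q zm zp Xs \<longleftrightarrow> (\<exists>X\<in>inf_configs q zm zp. stabilizes_to Xs X))
       \<and> (\<forall>Xs\<in>regular_seqs q zm zp. \<exists>!X. X \<in> inf_configs q zm zp \<and> stabilizes_to Xs X)
       \<and> (\<exists>\<Phi>. bij_betw \<Phi> (martin_boundary q zm zp) (inf_configs q zm zp)
            \<and> (\<forall>C\<in>martin_boundary q zm zp. \<forall>Xs\<in>C. stabilizes_to Xs (\<Phi> C)))"
proof -
  interpret two_sided_lattice q zm zp by unfold_locales (use assms in auto)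
  have ex: "\<exists>X\<in>inf_configs q zm zp. stabilizes_to Xs X" if "Xs \<in> config_seqs q zm zp" "regular_seq q zm zp Xs" for Xs
    using regular_imp_stabilizes[OF that] by blast
  show ?thesis
  proof (intro conjI ballI iffI martin_boundary_bij)
    fix Xs assume "Xs \<in> config_seqs q zm zp" "regular_seq q zm zp Xs"
    then show "\<exists>X\<in>inf_configs q zm zp. stabilizes_to Xs X" by (rule ex)
  next
    fix Xs assume "Xs \<in> config_seqs q zm zp" "\<exists>X\<in>inf_configs q zm zp. stabilizes_to Xs X"
    then show "regular_seq q zm zp Xs" using stabilizes_imp_regular by blast
  next
    fix Xs assume "Xs \<in> regular_seqs q zm zp"
    then have "\<exists>X\<in>inf_configs q zm zp. stabilizes_to Xs X" using ex by (simp add: regular_seqs_def)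
    then show "\<exists>!X. X \<in> inf_configs q zm zp \<and> stabilizes_to Xs X" using stabilizes_unique by blast
  qed
qed

end
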